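(* There is an algorithm for the minimum 2-edge-connected spanning subgraph problem (2ECSS) that runs in $\mathcal{O}(\min\{nm,\; m + n^2 \log n\})$ time and $\mathcal{O}(m)$ space, and that always outputs a feasible solution whose cost is at most three times the optimum cost.
   Context: An undirected multigraph $G=(V,E)$ (parallel edges allowed; edges are identified by name) is 2-edge-connected if for every edge $e\in E$ the graph $(V,E\setminus\{e\})$ is connected. The problem 2ECSS: given a 2-edge-connected undirected multigraph $G=(V,E)$ with $n:=|V|$, $m:=|E|$, $m\ge n$, and edge costs $c\colon E\to\mathbb{R}_{\ge 0}$, find an edge subset $E'\subseteq E$ (each edge of $G$ usable at most once) minimizing $c(E'):=\sum_{e\in E'}c(e)$ such that $(V,E')$ is 2-edge-connected. *)

theory Defs
  imports Complex_Main "HOL-Library.Monad_Syntax"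
begin

section \<open>Undirected multigraphs and the problem 2ECSS\<close>

record ('v, 'e) multigraph =
  verts :: "'v set"
  edges :: "'e set"
  ends :: "'e \<Rightarrow> 'v set"

text \<open>An edge with a single end is a loop.\<close>

definition finite_multigraph :: "('v, 'e) multigraph \<Rightarrow> bool" where
  "finite_multigraph G \<longleftrightarrow> finite (verts G) \<and> finite (edges G) \<and>
     (\<forall>e\<in>edges G. ends G e \<subseteq> verts G \<and> card (ends G e) \<in> {1, 2})"

definition adjacency :: "('v, 'e) multigraph \<Rightarrow> 'v rel" where
  "adjacency G = {(u, v). \<exists>e\<in>edges G. ends G e = {u, v}}"

definition connected_graph :: "('v, 'e) multigraph \<Rightarrow> bool" where
  "connected_graph G \<longleftrightarrow> verts G \<noteq> {} \<and>
     (\<forall>u\<in>verts G. \<forall>v\<in>verts G. (u, v) \<in> (adjacency G)\<^sup>*)"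

text \<open>
  The first conjunct follows from the second one unless the graph has no edges; it rules
  out that a graph with several vertices and no edge is vacuously 2-edge-connected.
\<close>

definition two_edge_connected :: "('v, 'e) multigraph \<Rightarrow> bool" where
  "two_edge_connected G \<longleftrightarrow> connected_graph G \<and>
     (\<forall>e\<in>edges G. connected_graph (G\<lparr>edges := edges G - {e}\<rparr>))"

definition tecss_instance :: "('v, 'e) multigraph \<Rightarrow> ('e \<Rightarrow> real) \<Rightarrow> bool" where
  "tecss_instance G c \<longleftrightarrow> finite_multigraph G \<and> two_edge_connected G \<and>
     card (verts G) \<le> card (edges G) \<and> (\<forall>e\<in>edges G. 0 \<le> c e)"

definition tecss_feasible :: "('v, 'e) multigraph \<Rightarrow> 'e set \<Rightarrow> bool" where
  "tecss_feasible G F \<longleftrightarrow> F \<subseteq> edges G \<and> two_edge_connected (G\<lparr>edges := F\<rparr>)"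

definition tecss_opt :: "('v, 'e) multigraph \<Rightarrow> ('e \<Rightarrow> real) \<Rightarrow> real" where
  "tecss_opt G c = Min {\<Sum>e\<in>F. c e | F. tecss_feasible G F}"


section \<open>Random access machine\<close>

text \<open>
  A word RAM with an additional memory for real numbers. Words can be used as addresses.
  Real numbers can only be copied, added, subtracted and compared; there is no
  conversion between reals and words.
\<close>

record state =
  imem :: "nat \<Rightarrow> nat"
  rmem :: "nat \<Rightarrow> real"

datatype iop = Plus | Monus | Times | Div | Mod

datatype iexp = Const nat | Load iexp | Op iop iexp iexp

datatype rexp = RLoad iexp | RPlus rexp rexp | RMinus rexp rexp

datatype bexp = Less iexp iexp | RLess rexp rexp | Neg bexp | And bexp bexp

datatype com =
    Skip
  | Store iexp iexp
  | RStore iexp rexp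
  | Seq com com
  | Cond bexp com com
  | While bexp com

fun iop_val :: "iop \<Rightarrow> nat \<Rightarrow> nat \<Rightarrow> nat" where
  "iop_val Plus x y = x + y"
| "iop_val Monus x y = x - y"
| "iop_val Times x y = x * y"
| "iop_val Div x y = x div y"
| "iop_val Mod x y = x mod y"

text \<open>
  \<open>S\<close> is the number of available cells in each of the two memories and words range over
  \<open>{0..<W}\<close>. Evaluation fails (\<open>None\<close>) as soon as an address is not below \<open>S\<close> or a computed
  word is not below \<open>W\<close>; the limits have no other influence on a computation.
\<close>

definition below :: "nat \<Rightarrow> nat \<Rightarrow> nat option" where
  "below b x = (if x < b then Some x else None)"

fun ival :: "nat \<Rightarrow> nat \<Rightarrow> state \<Rightarrow> iexp \<Rightarrow> nat option" where
  "ival S W s (Const k) = below W k"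
| "ival S W s (Load e) = do {a \<leftarrow> ival S W s e; a \<leftarrow> below S a; Some (imem s a)}"
| "ival S W s (Op f e1 e2) = do {x \<leftarrow> ival S W s e1; y \<leftarrow> ival S W s e2; below W (iop_val f x y)}"

fun rval :: "nat \<Rightarrow> nat \<Rightarrow> state \<Rightarrow> rexp \<Rightarrow> real option" where
  "rval S W s (RLoad e) = do {a \<leftarrow> ival S W s e; a \<leftarrow> below S a; Some (rmem s a)}"
| "rval S W s (RPlus r1 r2) = do {x \<leftarrow> rval S W s r1; y \<leftarrow> rval S W s r2; Some (x + y)}"
| "rval S W s (RMinus r1 r2) = do {x \<leftarrow> rval S W s r1; y \<leftarrow> rval S W s r2; Some (x - y)}"

fun bval :: "nat \<Rightarrow> nat \<Rightarrow> state \<Rightarrow> bexp \<Rightarrow> bool option" where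
  "bval S W s (Less e1 e2) = do {x \<leftarrow> ival S W s e1; y \<leftarrow> ival S W s e2; Some (x < y)}"
| "bval S W s (RLess r1 r2) = do {x \<leftarrow> rval S W s r1; y \<leftarrow> rval S W s r2; Some (x < y)}"
| "bval S W s (Neg b) = do {x \<leftarrow> bval S W s b; Some (\<not> x)}"
| "bval S W s (And b1 b2) = do {x \<leftarrow> bval S W s b1; y \<leftarrow> bval S W s b2; Some (x \<and> y)}"

text \<open>
  \<open>exec S W p s t s'\<close>: started in \<open>s\<close>, program \<open>p\<close> halts in \<open>s'\<close> after \<open>t\<close> steps without
  exceeding the limits \<open>S\<close> and \<open>W\<close>. A step is an assignment or the evaluation of a test.
  The expressions have a size that is fixed by the program, so up to a constant factor
  depending on the program only, \<open>t\<close> is the number of elementary operations.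
\<close>

inductive exec :: "nat \<Rightarrow> nat \<Rightarrow> com \<Rightarrow> state \<Rightarrow> nat \<Rightarrow> state \<Rightarrow> bool" for S W :: nat where
  Skip: "exec S W Skip s 1 s"
| Store: "\<lbrakk>ival S W s d = Some a; a < S; ival S W s e = Some x\<rbrakk> \<Longrightarrow>
    exec S W (Store d e) s 1 (s\<lparr>imem := (imem s)(a := x)\<rparr>)"
| RStore: "\<lbrakk>ival S W s d = Some a; a < S; rval S W s r = Some x\<rbrakk> \<Longrightarrow>
    exec S W (RStore d r) s 1 (s\<lparr>rmem := (rmem s)(a := x)\<rparr>)"
| Seq: "\<lbrakk>exec S W p s t1 s'; exec S W q s' t2 s''\<rbrakk> \<Longrightarrow> exec S W (Seq p q) s (t1 + t2) s''"
| CondTrue: "\<lbrakk>bval S W s b = Some True; exec S W p s t s'\<rbrakk> \<Longrightarrow> exec S W (Cond b p q) s (1 + t) s'"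
| CondFalse: "\<lbrakk>bval S W s b = Some False; exec S W q s t s'\<rbrakk> \<Longrightarrow> exec S W (Cond b p q) s (1 + t) s'"
| WhileFalse: "bval S W s b = Some False \<Longrightarrow> exec S W (While b p) s 1 s"
| WhileTrue: "\<lbrakk>bval S W s b = Some True; exec S W p s t1 s'; exec S W (While b p) s' t2 s''\<rbrakk> \<Longrightarrow>
    exec S W (While b p) s (1 + t1 + t2) s''"

inductive_cases exec_SkipE: "exec S W Skip s t s'"
inductive_cases exec_StoreE: "exec S W (Store d e) s t s'"
inductive_cases exec_RStoreE: "exec S W (RStore d r) s t s'"
inductive_cases exec_SeqE: "exec S W (Seq p q) s t s'"
inductive_cases exec_CondE: "exec S W (Cond b p q) s t s'"
inductive_cases exec_WhileE: "exec S W (While b p) s t s'"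

lemma below_eq_Some [simp]: "below b x = Some y \<longleftrightarrow> x < b \<and> y = x"
  by (auto simp: below_def)

lemma ival_unique: "ival S W s e = Some x \<Longrightarrow> ival S' W' s e = Some y \<Longrightarrow> x = y"
  by (induction e arbitrary: x y) (fastforce simp: bind_eq_Some_conv)+

lemma rval_unique: "rval S W s r = Some x \<Longrightarrow> rval S' W' s r = Some y \<Longrightarrow> x = y"
  by (induction r arbitrary: x y) (fastforce simp: bind_eq_Some_conv dest: ival_unique)+

lemma bval_unique: "bval S W s b = Some x \<Longrightarrow> bval S' W' s b = Some y \<Longrightarrow> x = y"
  by (induction b arbitrary: x y)
    (fastforce simp: bind_eq_Some_conv dest: ival_unique rval_unique)+

lemma exec_deterministic:
  "exec S W p s t s' \<Longrightarrow> exec S' W' p s u s'' \<Longrightarrow> u = t \<and> s'' = s'"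
proof (induction arbitrary: u s'' rule: exec.induct)
  case (Skip s)
  then show ?case by (auto elim: exec_SkipE)
next
  case (Store s d a e x)
  from Store.prems show ?case
    by (rule exec_StoreE)
      (use ival_unique[OF Store.hyps(1)] ival_unique[OF Store.hyps(3)] in auto)
next
  case (RStore s d a r x)
  from RStore.prems show ?case
    by (rule exec_RStoreE)
      (use ival_unique[OF RStore.hyps(1)] rval_unique[OF RStore.hyps(3)] in auto)
next
  case (Seq p s t1 s' q t2 s3)
  from Seq.prems show ?case
    by (rule exec_SeqE) (use Seq.IH in blast)
next
  case (CondTrue s b p t s' q)
  from CondTrue.prems show ?case
    by (rule exec_CondE) (use CondTrue.IH in \<open>auto dest: bval_unique[OF CondTrue.hyps(1)]\<close>)
next
  case (CondFalse s b q t s' p)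
  from CondFalse.prems show ?case
    by (rule exec_CondE) (use CondFalse.IH in \<open>auto dest: bval_unique[OF CondFalse.hyps(1)]\<close>)
next
  case (WhileFalse s b p)
  from WhileFalse.prems show ?case
    by (rule exec_WhileE) (auto dest: bval_unique[OF WhileFalse.hyps])
next
  case (WhileTrue s b p t1 s' t2 s3)
  have "bval S' W' s b \<noteq> Some False"
    by (auto dest: bval_unique[OF WhileTrue.hyps(1)])
  with WhileTrue.prems obtain u1 r u2 where u: "u = 1 + u1 + u2"
    and "exec S' W' p s u1 r" and rest: "exec S' W' (While b p) r u2 s''"
    by (auto elim: exec_WhileE)
  then have "u1 = t1" "r = s'"
    using WhileTrue.IH(1) by auto
  with u rest WhileTrue.IH(2) show ?case by auto
qed


section \<open>Input and output\<close>

text \<open>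
  Vertices and edges are numbered from 0. The word memory holds the number of vertices, the
  number of edges and then the two ends of every edge (equal for a loop), in arbitrary order;
  the real memory holds the costs. All other cells are 0.
\<close>

definition encodes :: "state \<Rightarrow> (nat, nat) multigraph \<Rightarrow> (nat \<Rightarrow> real) \<Rightarrow> bool" where
  "encodes s G c \<longleftrightarrow> (\<exists>n m.
     verts G = {..<n} \<and> edges G = {..<m} \<and>
     imem s 0 = n \<and> imem s 1 = m \<and>
     (\<forall>e<m. ends G e = {imem s (2 + 2 * e), imem s (3 + 2 * e)}) \<and>
     (\<forall>a\<ge>2 + 2 * m. imem s a = 0) \<and>
     (\<forall>e<m. rmem s e = c e) \<and>
     (\<forall>a\<ge>m. rmem s a = 0))"

definition output_edges :: "(nat, nat) multigraph \<Rightarrow> state \<Rightarrow> nat set" where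
  "output_edges G s = {e \<in> edges G. imem s e = 1}"

end

theory Submission
  imports Defs
begin

text \<open>
  A minimum spanning tree costs at most the optimum, so it suffices to augment it to a
  2-edge-connected graph at twice the optimum cost. Root the tree and split every other edge at the
  lowest common ancestor of its ends into two vertical links of the same cost; this loses a
  factor of 2. Covering all tree edges by vertical links is solved exactly by a primal-dual method:
  bottom-up, the dual variable of an uncovered tree edge is raised until some link covering it gets
  tight, and that link is chosen; top-down, a chosen link is kept unless the tree edge it was chosen
  for is covered by a link kept before. Then a tree edge with a positive dual variable is covered by
  exactly one kept link, so the kept links cost as much as the dual solution.

  With Prim's algorithm and vertices numbered in the order in which it reaches them, all this takes
  \<open>O(m + n\<^sup>2)\<close> steps, which is within both bounds. Of the links that start in a vertex \<open>u\<close>, only those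
  matter that are cheaper than all links from \<open>u\<close> with a higher upper end. They form a list sorted by
  upper end, and processing an ancestor of \<open>u\<close> discards at most the first element of this list. A
  pass over all vertices for every vertex therefore suffices.
\<close>

subsection \<open>Arrays on the random access machine\<close>

text \<open>Two choices of representation carry the proof. A vertical link is a half-edge, seen from
  its lower end; splitting an edge creates no new objects, and the lost factor 2 is the number of
  half-edges per edge. In Prim's numbering every parent is smaller than its child. So the ancestors
  of a vertex are sorted by number, lowest common ancestors are maxima, bottom-up and top-down are
  plain counting loops, and inductions on the tree are inductions on numbers.

  The running time hinges on finding, for each tree edge, a link of least slack that covers it.
  Rescanning all links for every tree edge costs \<open>n * m\<close>, which misses the second
  bound. Two facts avoid this. Passing a vertex \<open>v\<close> invalidates only links with upper
  end \<open>v\<close>, so a minimum per lower end can be maintained. And the dual variables above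
  the current vertex are still 0, so the load of a link that covers this vertex is the sum of the
  dual variables on the entire root path of its lower end: one number per vertex replaces one per
  link.\<close>

text \<open>
  The half-edges \<open>2 * e\<close> and \<open>2 * e + 1\<close> are the two ends of edge \<open>e\<close>. Arrays refer to half-edge \<open>h\<close>
  as \<open>Suc h\<close>, and 0 stands for none. \<open>Head\<close> and \<open>Next\<close> are adjacency lists; \<open>Ord\<close> is the order of
  Prim's algorithm and \<open>Pos\<close> its inverse plus 1, with 0 for vertices not reached yet; \<open>Par\<close> and \<open>Q\<close>
  are the parents and the edge ends in terms of this order; \<open>Sel\<close> marks the selected edges.
  \<open>Cur\<close>, \<open>Nxt\<close> and \<open>Top\<close> are the lists of links and their upper ends, and \<open>Ch\<close> the chosen links.
  \<open>Cov\<close> and \<open>Kov\<close> mark the tree edges covered by the chosen and by the kept links; a tree edge is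
  identified with its lower end.
\<close>

datatype ivar = Inp | Head | Next | Pos | Ord | Best | Par | Sel | Q | Mark | Lca | Bst
  | Cur | Nxt | Top | Sub | Cov | Ch | Kov | I | J | P | X

datatype rvar = Cost | Ysum | Dual

record store =
  iv :: "ivar \<Rightarrow> nat \<Rightarrow> nat"
  rv :: "rvar \<Rightarrow> nat \<Rightarrow> real"

datatype aexp = C nat | VN | VM | Get ivar aexp | Bin iop aexp aexp

datatype rxp = RGet rvar aexp | RAdd rxp rxp | RSub rxp rxp

datatype bxp = Lt aexp aexp | Eq aexp aexp | RLt rxp rxp | Not bxp | Conj bxp bxp | Disj bxp bxp

datatype cmd = Nop | Asg ivar aexp aexp | RAsg rvar aexp rxp | Then cmd cmd (infixr ";;" 55)
  | If bxp cmd cmd | Loop bxp cmd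

fun slot :: "ivar \<Rightarrow> nat" where
  "slot Inp = 0" | "slot Head = 1" | "slot Next = 2" | "slot Pos = 3" | "slot Ord = 4"
| "slot Best = 5" | "slot Par = 6" | "slot Sel = 7" | "slot Q = 8" | "slot Mark = 9"
| "slot Lca = 10" | "slot Bst = 11" | "slot Cur = 12" | "slot Nxt = 13" | "slot Top = 14"
| "slot Sub = 15" | "slot Cov = 16" | "slot Ch = 17" | "slot Kov = 18" | "slot I = 19"
| "slot J = 20" | "slot P = 21" | "slot X = 22"

fun rslot :: "rvar \<Rightarrow> nat" where
  "rslot Cost = 0" | "rslot Ysum = 1" | "rslot Dual = 2"

lemma slot_less: "slot a < 32"
  by (cases a) auto

lemma slot_inject: "slot a = slot b \<longleftrightarrow> a = b"
proof -
  \<comment> \<open>The list is a left inverse of \<open>slot\<close>; this avoids a case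
    distinction over all pairs of names.\<close>
  have "[Inp, Head, Next, Pos, Ord, Best, Par, Sel, Q, Mark, Lca, Bst, Cur, Nxt, Top, Sub, Cov,
    Ch, Kov, I, J, P, X] ! slot a = a" for a
    by (cases a) auto
  then show ?thesis by metis
qed

lemma rslot_less: "rslot a < 32"
  by (cases a) auto

lemma rslot_inject: "rslot a = rslot b \<longleftrightarrow> a = b"
  by (cases a; cases b) simp_all

text \<open>
  The arrays are interleaved behind the input: cell \<open>i\<close> of array \<open>a\<close> has the address
  \<open>2 + 2 * m + slot a + 32 * i\<close>. A scalar variable is cell 0 of its array, since no constant
  address above 1 is free. The exceptions are the input arrays \<open>Inp\<close> and \<open>Cost\<close>.
\<close>

definition cell :: "nat \<Rightarrow> iexp \<Rightarrow> iexp" where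
  "cell k e = Op Plus (Op Plus (Const (2 + k)) (Op Times (Const 2) (Load (Const 1)))) (Op Times (Const 32) e)"

definition iaddr :: "ivar \<Rightarrow> iexp \<Rightarrow> iexp" where
  "iaddr a e = (if a = Inp then Op Plus (Const 2) e else cell (slot a) e)"

definition raddr :: "rvar \<Rightarrow> iexp \<Rightarrow> iexp" where
  "raddr a e = (if a = Cost then e else cell (rslot a) e)"

primrec acomp :: "aexp \<Rightarrow> iexp" where
  "acomp (C k) = Const k"
| "acomp VN = Load (Const 0)"
| "acomp VM = Load (Const 1)"
| "acomp (Get a e) = Load (iaddr a (acomp e))"
| "acomp (Bin f d e) = Op f (acomp d) (acomp e)"

primrec rcomp :: "rxp \<Rightarrow> rexp" where
  "rcomp (RGet a e) = RLoad (raddr a (acomp e))"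
| "rcomp (RAdd d e) = RPlus (rcomp d) (rcomp e)"
| "rcomp (RSub d e) = RMinus (rcomp d) (rcomp e)"

primrec bcomp :: "bxp \<Rightarrow> bexp" where
  "bcomp (Lt d e) = Less (acomp d) (acomp e)"
| "bcomp (Eq d e) = And (Neg (Less (acomp d) (acomp e))) (Neg (Less (acomp e) (acomp d)))"
| "bcomp (RLt d e) = RLess (rcomp d) (rcomp e)"
| "bcomp (Not b) = Neg (bcomp b)"
| "bcomp (Conj b d) = And (bcomp b) (bcomp d)"
| "bcomp (Disj b d) = Neg (And (Neg (bcomp b)) (Neg (bcomp d)))"

primrec comp :: "cmd \<Rightarrow> com" where
  "comp Nop = Skip"
| "comp (Asg a d e) = Store (iaddr a (acomp d)) (acomp e)"
| "comp (RAsg a d e) = RStore (raddr a (acomp d)) (rcomp e)"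
| "comp (p ;; q) = Seq (comp p) (comp q)"
| "comp (If b p q) = Cond (bcomp b) (comp p) (comp q)"
| "comp (Loop b p) = While (bcomp b) (comp p)"

text \<open>Meant for loop-free commands. An \<open>If\<close> is charged for both branches, which
  avoids a maximum.\<close>

primrec cost :: "cmd \<Rightarrow> nat" where
  "cost Nop = 1"
| "cost (Asg a d e) = 1"
| "cost (RAsg a d e) = 1"
| "cost (p ;; q) = cost p + cost q"
| "cost (If b p q) = 1 + cost p + cost q"
| "cost (Loop b p) = 1"

section \<open>Abstract stores and their representation in the two memories\<close>

locale machine =
  fixes n m S W :: nat
  assumes n_pos: "1 \<le> n" and n_le_m: "n \<le> m" and S_bound: "100 * m \<le> S" and W_bound: "100 * m \<le> W"
begin

definition lim :: "ivar \<Rightarrow> nat" where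
  "lim a = (if a = Inp then 2 * m else 2 * m + 1)"

definition rlim :: "rvar \<Rightarrow> nat" where
  "rlim a = (if a = Cost then m else 2 * m + 1)"

definition iloc :: "ivar \<Rightarrow> nat \<Rightarrow> nat" where
  "iloc a i = (if a = Inp then 2 + i else 2 + slot a + 2 * m + 32 * i)"

definition rloc :: "rvar \<Rightarrow> nat \<Rightarrow> nat" where
  "rloc a i = (if a = Cost then i else 2 + rslot a + 2 * m + 32 * i)"

definition rep :: "store \<Rightarrow> state \<Rightarrow> bool" where
  "rep st s \<longleftrightarrow> imem s 0 = n \<and> imem s 1 = m \<and>
     (\<forall>a i. i < lim a \<longrightarrow> imem s (iloc a i) = iv st a i \<and> iv st a i < W) \<and>
     (\<forall>a i. i < rlim a \<longrightarrow> rmem s (rloc a i) = rv st a i)"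

primrec av :: "store \<Rightarrow> aexp \<Rightarrow> nat" where
  "av st (C k) = k"
| "av st VN = n"
| "av st VM = m"
| "av st (Get a e) = iv st a (av st e)"
| "av st (Bin f d e) = iop_val f (av st d) (av st e)"

text \<open>\<open>Monus\<close>, \<open>Div\<close> and \<open>Mod\<close> never exceed their first
  operand, so only sums and products can overflow.\<close>

primrec asafe :: "store \<Rightarrow> aexp \<Rightarrow> bool" where
  "asafe st (C k) \<longleftrightarrow> k < 100"
| "asafe st VN \<longleftrightarrow> True"
| "asafe st VM \<longleftrightarrow> True"
| "asafe st (Get a e) \<longleftrightarrow> asafe st e \<and> av st e < lim a"
| "asafe st (Bin f d e) \<longleftrightarrow> asafe st d \<and> asafe st e \<and> 
    (f = Plus \<or> f = Times \<longrightarrow> iop_val f (av st d) (av st e) < 100 * m)"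

primrec rvl :: "store \<Rightarrow> rxp \<Rightarrow> real" where
  "rvl st (RGet a e) = rv st a (av st e)"
| "rvl st (RAdd d e) = rvl st d + rvl st e"
| "rvl st (RSub d e) = rvl st d - rvl st e"

primrec rsafe :: "store \<Rightarrow> rxp \<Rightarrow> bool" where
  "rsafe st (RGet a e) \<longleftrightarrow> asafe st e \<and> av st e < rlim a"
| "rsafe st (RAdd d e) \<longleftrightarrow> rsafe st d \<and> rsafe st e"
| "rsafe st (RSub d e) \<longleftrightarrow> rsafe st d \<and> rsafe st e"

primrec bv :: "store \<Rightarrow> bxp \<Rightarrow> bool" where
  "bv st (Lt d e) \<longleftrightarrow> av st d < av st e"
| "bv st (Eq d e) \<longleftrightarrow> av st d = av st e"
| "bv st (RLt d e) \<longleftrightarrow> rvl st d < rvl st e"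
| "bv st (Not b) \<longleftrightarrow> \<not> bv st b"
| "bv st (Conj b d) \<longleftrightarrow> bv st b \<and> bv st d"
| "bv st (Disj b d) \<longleftrightarrow> bv st b \<or> bv st d"

text \<open>The \<open>And\<close> of the machine evaluates both operands, so a null test does not
  guard the access next to it. Programs rely on truncated subtraction instead: \<open>dec\<close> of
  a null pointer is 0, a legal index.\<close>

primrec bsafe :: "store \<Rightarrow> bxp \<Rightarrow> bool" where
  "bsafe st (Lt d e) \<longleftrightarrow> asafe st d \<and> asafe st e"
| "bsafe st (Eq d e) \<longleftrightarrow> asafe st d \<and> asafe st e"
| "bsafe st (RLt d e) \<longleftrightarrow> rsafe st d \<and> rsafe st e"
| "bsafe st (Not b) \<longleftrightarrow> bsafe st b"
| "bsafe st (Conj b d) \<longleftrightarrow> bsafe st b \<and> bsafe st d"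
| "bsafe st (Disj b d) \<longleftrightarrow> bsafe st b \<and> bsafe st d"

lemma m_pos: "1 \<le> m"
  using n_pos n_le_m by simp

lemma const_less: "k < 100 \<Longrightarrow> k < W"
  using m_pos W_bound by linarith

lemma ival_cell:
  assumes "imem s 1 = m" "ival S W s e = Some i" "i < 2 * m + 1" "k < 32"
  shows "ival S W s (cell k e) = Some (2 + k + 2 * m + 32 * i)"
proof -
  have "2 + k + 2 * m + 32 * i < 100 * m" using assms m_pos by linarith
  moreover have "1 < S" using S_bound m_pos by linarith
  ultimately show ?thesis
    using assms W_bound const_less[of 1] const_less[of "2 + k"] const_less[of 2] const_less[of 32]
    by (auto simp: cell_def below_def)
qed

text \<open>Origin of the factor 100: with a slot below 32 and an index of at most
  \<open>2 * m\<close>, an address is at most \<open>66 * m + 33\<close>, and \<open>m\<close> is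
  positive.\<close>

lemma loc_less: "i < lim a \<Longrightarrow> iloc a i < 100 * m" "j < rlim b \<Longrightarrow> rloc b j < 100 * m"
  using slot_less[of a] rslot_less[of b] m_pos
  by (auto simp: lim_def iloc_def rlim_def rloc_def split: if_splits)

lemma ival_iaddr:
  assumes "imem s 1 = m" "ival S W s e = Some i" "i < lim a"
  shows "ival S W s (iaddr a e) = Some (iloc a i)"
  using ival_cell[OF assms(1,2) _ slot_less[of a]] assms m_pos W_bound const_less[of 2]
  by (auto simp: iaddr_def lim_def iloc_def below_def split: if_splits)

lemma ival_raddr:
  assumes "imem s 1 = m" "ival S W s e = Some i" "i < rlim a"
  shows "ival S W s (raddr a e) = Some (rloc a i)"
  using ival_cell[OF assms(1,2) _ rslot_less[of a]] assms
  by (auto simp: raddr_def rlim_def rloc_def split: if_splits)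

lemma rep_m: "rep st s \<Longrightarrow> imem s 1 = m"
  by (simp add: rep_def)

lemma interleaved_eq_iff:
  "k < 32 \<Longrightarrow> l < 32 \<Longrightarrow> k + (b::nat) + 32 * i = l + b + 32 * j \<longleftrightarrow> k = l \<and> i = j"
  by presburger

lemma iloc_inject: "i < lim a \<Longrightarrow> j < lim b \<Longrightarrow> iloc a i = iloc b j \<longleftrightarrow> a = b \<and> i = j"
  using interleaved_eq_iff[OF slot_less[of a] slot_less[of b], of "2 * m" i j]
  by (auto simp: iloc_def lim_def slot_inject split: if_splits)

lemma rloc_inject: "i < rlim a \<Longrightarrow> j < rlim b \<Longrightarrow> rloc a i = rloc b j \<longleftrightarrow> a = b \<and> i = j"
  using interleaved_eq_iff[OF rslot_less[of a] rslot_less[of b], of "2 * m" i j]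
  by (auto simp: rloc_def rlim_def rslot_inject split: if_splits)

lemma ival_acomp:
  assumes "rep st s" "asafe st e"
  shows "ival S W s (acomp e) = Some (av st e) \<and> av st e < W"
  using assms(2)
proof (induction e)
  case (Bin f d e)
  have "av st d < W" using Bin by simp
  then have "iop_val f (av st d) (av st e) < W"
    using Bin.prems W_bound le_less_trans[OF mod_less_eq_dividend] le_less_trans[OF div_le_dividend]
    by (cases f) auto
  then show ?case using Bin by auto
next
  case (Get a e)
  then have "ival S W s (iaddr a (acomp e)) = Some (iloc a (av st e))"
    using ival_iaddr[OF rep_m[OF assms(1)]] by simp
  then show ?case
    using Get assms(1) loc_less(1)[of "av st e" a] S_bound by (auto simp: rep_def below_def)
qed (use assms(1) const_less n_le_m W_bound S_bound m_pos in \<open>auto simp: rep_def below_def\<close>)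

lemma rval_rcomp: "rep st s \<Longrightarrow> rsafe st e \<Longrightarrow> rval S W s (rcomp e) = Some (rvl st e)"
proof (induction e)
  case (RGet a e)
  then have "ival S W s (raddr a (acomp e)) = Some (rloc a (av st e))"
    using ival_raddr[OF rep_m[OF RGet(1)]] ival_acomp by simp
  then show ?case
    using RGet loc_less(2)[of "av st e" a] S_bound by (auto simp: rep_def below_def)
qed auto

lemma bval_bcomp: "rep st s \<Longrightarrow> bsafe st b \<Longrightarrow> bval S W s (bcomp b) = Some (bv st b)"
  by (induction b) (auto simp: ival_acomp rval_rcomp)

section \<open>Timed total correctness\<close>

definition put :: "store \<Rightarrow> ivar \<Rightarrow> nat \<Rightarrow> nat \<Rightarrow> store" where
  "put st a i x = st\<lparr>iv := (iv st)(a := (iv st a)(i := x))\<rparr>"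

definition rput :: "store \<Rightarrow> rvar \<Rightarrow> nat \<Rightarrow> real \<Rightarrow> store" where
  "rput st a i x = st\<lparr>rv := (rv st)(a := (rv st a)(i := x))\<rparr>"

lemma put_simps [simp]:
  "iv (put st a i x) b = (if a = b then (iv st b)(i := x) else iv st b)"
  "rv (put st a i x) = rv st"
  "rv (rput st c i y) d = (if c = d then (rv st d)(i := y) else rv st d)"
  "iv (rput st c i y) = iv st"
  by (auto simp: put_def rput_def)

lemma rep_put:
  assumes "rep st s" "i < lim a" "x < W"
  shows "rep (put st a i x) (s\<lparr>imem := (imem s)(iloc a i := x)\<rparr>)"
proof -
  have "iloc a i \<noteq> 0" "iloc a i \<noteq> 1" by (auto simp: iloc_def)
  then show ?thesis using assms by (auto simp: rep_def iloc_inject)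
qed

lemma rep_rput:
  assumes "rep st s" "i < rlim a"
  shows "rep (rput st a i x) (s\<lparr>rmem := (rmem s)(rloc a i := x)\<rparr>)"
  using assms by (auto simp: rep_def rloc_inject)

text \<open>Total correctness with a step bound. The final store is quantified existentially because
  the machine state determines a store only within the limits of the arrays.\<close>

definition run :: "cmd \<Rightarrow> store \<Rightarrow> (store \<Rightarrow> bool) \<Rightarrow> nat \<Rightarrow> bool" where
  "run p st R T \<longleftrightarrow> (\<forall>s. rep st s \<longrightarrow>
     (\<exists>t s' st'. exec S W (comp p) s t s' \<and> rep st' s' \<and> R st' \<and> t \<le> T))"

text \<open>The weakest precondition of loop-free code, so that such code is verified by
  simplification. Loops are refused and left to \<open>run_Loop\<close>.\<close>

primrec pre :: "cmd \<Rightarrow> (store \<Rightarrow> bool) \<Rightarrow> store \<Rightarrow> bool" where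
  "pre Nop R st \<longleftrightarrow> R st"
| "pre (Asg a d e) R st \<longleftrightarrow> asafe st d \<and> asafe st e \<and> av st d < lim a \<and> R (put st a (av st d) (av st e))"
| "pre (RAsg a d e) R st \<longleftrightarrow> asafe st d \<and> rsafe st e \<and> av st d < rlim a \<and> R (rput st a (av st d) (rvl st e))"
| "pre (p ;; q) R st \<longleftrightarrow> pre p (pre q R) st"
| "pre (If b p q) R st \<longleftrightarrow> bsafe st b \<and> (if bv st b then pre p R st else pre q R st)"
| "pre (Loop b p) R st \<longleftrightarrow> False"

lemma run_mono: "run p st R T \<Longrightarrow> (\<And>st'. R st' \<Longrightarrow> R' st') \<Longrightarrow> T \<le> T' \<Longrightarrow> run p st R' T'"
  unfolding run_def by (meson le_trans)

lemma run_Then: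
  assumes "run p st (\<lambda>st'. run q st' R T2) T1" "T1 + T2 \<le> T"
  shows "run (p ;; q) st R T"
  unfolding run_def
proof (intro allI impI)
  fix s assume "rep st s"
  then obtain t1 s1 st1 where 1: "exec S W (comp p) s t1 s1" "rep st1 s1" "run q st1 R T2" "t1 \<le> T1"
    using assms(1) unfolding run_def[of p] by blast
  then obtain t2 s2 st2 where 2: "exec S W (comp q) s1 t2 s2" "rep st2 s2" "R st2" "t2 \<le> T2"
    unfolding run_def by blast
  have "exec S W (comp (p ;; q)) s (t1 + t2) s2"
    using exec.Seq[OF 1(1) 2(1)] by simp
  moreover have "t1 + t2 \<le> T" using 1 2 assms(2) by linarith
  ultimately show "\<exists>t s' st'. exec S W (comp (p ;; q)) s t s' \<and> rep st' s' \<and> R st' \<and> t \<le> T"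
    using 2 by blast
qed

lemma run_If:
  assumes "bsafe st b" "bv st b \<Longrightarrow> run p st R T" "\<not> bv st b \<Longrightarrow> run q st R T" "T + 1 \<le> T'"
  shows "run (If b p q) st R T'"
  unfolding run_def
proof (intro allI impI)
  fix s assume s: "rep st s"
  have b: "bval S W s (bcomp b) = Some (bv st b)" using bval_bcomp s assms by blast
  show "\<exists>t s' st'. exec S W (comp (If b p q)) s t s' \<and> rep st' s' \<and> R st' \<and> t \<le> T'"
  proof (cases "bv st b")
    case True
    then obtain t s' st' where 1: "exec S W (comp p) s t s'" "rep st' s'" "R st'" "t \<le> T"
      using assms(2) s unfolding run_def by blast
    then have "exec S W (comp (If b p q)) s (1 + t) s'" using exec.CondTrue b True by simp
    moreover have "1 + t \<le> T'" using 1 assms(4) by linarith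
    ultimately show ?thesis using 1 by blast
  next
    case False
    then obtain t s' st' where 1: "exec S W (comp q) s t s'" "rep st' s'" "R st'" "t \<le> T"
      using assms(3) s unfolding run_def by blast
    then have "exec S W (comp (If b p q)) s (1 + t) s'" using exec.CondFalse b False by simp
    moreover have "1 + t \<le> T'" using 1 assms(4) by linarith
    ultimately show ?thesis using 1 by blast
  qed
qed

lemma run_pre: "pre p R st \<Longrightarrow> run p st R (cost p)"
proof (induction p arbitrary: R st)
  case Nop
  then show ?case by (auto simp: run_def intro!: exI exec.Skip)
next
  case (Asg a d e)
  show ?case unfolding run_def
  proof (intro allI impI)
    fix s assume s: "rep st s"
    have d: "ival S W s (acomp d) = Some (av st d)" and e: "ival S W s (acomp e) = Some (av st e)" "av st e < W"
      using ival_acomp[OF s] Asg by auto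
    have "iloc a (av st d) < S"
      using loc_less(1)[of "av st d" a] Asg S_bound by simp
    then have "exec S W (comp (Asg a d e)) s 1 (s\<lparr>imem := (imem s)(iloc a (av st d) := av st e)\<rparr>)"
      using exec.Store[OF ival_iaddr[OF rep_m[OF s] d] _ e(1)] Asg by simp
    with rep_put[OF s _ e(2), of "av st d" a] Asg
    show "\<exists>t s' st'. exec S W (comp (Asg a d e)) s t s' \<and> rep st' s' \<and> R st' \<and> t \<le> cost (Asg a d e)"
      by (auto intro!: exI)
  qed
next
  case (RAsg a d e)
  show ?case unfolding run_def
  proof (intro allI impI)
    fix s assume s: "rep st s"
    have d: "ival S W s (acomp d) = Some (av st d)" and e: "rval S W s (rcomp e) = Some (rvl st e)"
      using ival_acomp[OF s] rval_rcomp[OF s] RAsg by auto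
    have "rloc a (av st d) < S"
      using loc_less(2)[of "av st d" a] RAsg S_bound by simp
    then have "exec S W (comp (RAsg a d e)) s 1 (s\<lparr>rmem := (rmem s)(rloc a (av st d) := rvl st e)\<rparr>)"
      using exec.RStore[OF ival_raddr[OF rep_m[OF s] d] _ e(1)] RAsg by simp
    with rep_rput[OF s, of "av st d" a] RAsg
    show "\<exists>t s' st'. exec S W (comp (RAsg a d e)) s t s' \<and> rep st' s' \<and> R st' \<and> t \<le> cost (RAsg a d e)"
      by (auto intro!: exI)
  qed
next
  case (Then p q)
  have "run p st (pre q R) (cost p)" using Then by simp
  then have "run p st (\<lambda>st'. run q st' R (cost q)) (cost p)"
    by (rule run_mono) (use Then in auto)
  then show ?case by (rule run_Then) simp
next
  case (If b p q)
  show ?case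
    by (rule run_If[where T = "cost p + cost q"])
      (use If in \<open>auto split: if_splits intro: run_mono[OF If.IH(1)] run_mono[OF If.IH(2)]\<close>)
qed auto

lemma run_basic: "pre p R st \<Longrightarrow> cost p \<le> T \<Longrightarrow> run p st R T"
  using run_pre run_mono by blast

text \<open>The potential \<open>\<Phi>\<close> pays for the remaining iterations, which also gives termination.\<close>

lemma run_Loop:
  assumes "Inv st"
    and safe: "\<And>st. Inv st \<Longrightarrow> bsafe st b"
    and body: "\<And>st. Inv st \<Longrightarrow> bv st b \<Longrightarrow> run p st (\<lambda>st'. Inv st' \<and> T st + 1 + \<Phi> st' \<le> \<Phi> st) (T st)"
    and post: "\<And>st. Inv st \<Longrightarrow> \<not> bv st b \<Longrightarrow> R st"
    and "1 + \<Phi> st \<le> T'"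
  shows "run (Loop b p) st R T'"
proof -
  have "run (Loop b p) st R (1 + \<Phi> st)"
    using assms(1)
  proof (induction "\<Phi> st" arbitrary: st rule: less_induct)
    case less
    show ?case unfolding run_def
    proof (intro allI impI)
      fix s assume s: "rep st s"
      have b: "bval S W s (bcomp b) = Some (bv st b)" using bval_bcomp s less safe by blast
      show "\<exists>t s' st'. exec S W (comp (Loop b p)) s t s' \<and> rep st' s' \<and> R st' \<and> t \<le> 1 + \<Phi> st"
      proof (cases "bv st b")
        case True
        with body less.prems s obtain t1 s1 st1 where 1: "exec S W (comp p) s t1 s1" "rep st1 s1"
          "Inv st1" "T st + 1 + \<Phi> st1 \<le> \<Phi> st" "t1 \<le> T st"
          unfolding run_def by blast
        with less.hyps[of st1] obtain t2 s2 st2 where 2: "exec S W (comp (Loop b p)) s1 t2 s2" "rep st2 s2"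
          "R st2" "t2 \<le> 1 + \<Phi> st1"
          unfolding run_def by auto
        have "exec S W (comp (Loop b p)) s (1 + t1 + t2) s2"
          using exec.WhileTrue[of S W s "bcomp b", OF _ 1(1)] b True 2 by simp
        moreover have "1 + t1 + t2 \<le> 1 + \<Phi> st" using 1 2 by linarith
        ultimately show ?thesis using 2 by blast
      next
        case False
        then have "exec S W (comp (Loop b p)) s 1 s" using exec.WhileFalse b by simp
        then show ?thesis using s post[OF less.prems False] by fastforce
      qed
    qed
  qed
  then show ?thesis using assms(5) by (blast intro: run_mono)
qed

end

text \<open>The other half of the same edge, that is, the last bit flipped. The formula consists of
  machine operations, so that \<open>mate_of\<close> can evaluate it.\<close>

definition mate :: "nat \<Rightarrow> nat" where
  "mate h = Suc h - 2 * (h mod 2)"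

lemma mate_double [simp]: "mate (2 * e) = Suc (2 * e)" "mate (Suc (2 * e)) = 2 * e"
  by (simp_all add: mate_def)

lemma half_edge_cases:
  obtains e where "h = 2 * e" | e where "h = Suc (2 * e)"
  by (cases "even h") (auto elim!: evenE oddE)

lemma mate_less: "h < 2 * m \<Longrightarrow> mate h < 2 * m"
  by (cases h rule: half_edge_cases) auto

lemma mate_div_2 [simp]: "mate h div 2 = h div 2"
  by (cases h rule: half_edge_cases) auto

subsection \<open>Connectivity by cuts\<close>

text \<open>A loop crosses no cut, so loops need no special treatment.\<close>

definition crosses :: "(nat \<Rightarrow> nat) \<Rightarrow> nat \<Rightarrow> nat set \<Rightarrow> bool" where
  "crosses E e S \<longleftrightarrow> (E (2 * e) \<in> S) \<noteq> (E (2 * e + 1) \<in> S)"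

text \<open>Connectivity by cuts instead of paths: monotonicity and invariance under renumbering are
  then immediate, and exchange arguments inspect one cut at a time.\<close>

definition spans :: "(nat \<Rightarrow> nat) \<Rightarrow> nat \<Rightarrow> nat set \<Rightarrow> bool" where
  "spans E n F \<longleftrightarrow> (\<forall>S. S \<subseteq> {..<n} \<and> S \<noteq> {} \<and> S \<noteq> {..<n} \<longrightarrow> (\<exists>e\<in>F. crosses E e S))"

definition spans2 :: "(nat \<Rightarrow> nat) \<Rightarrow> nat \<Rightarrow> nat set \<Rightarrow> bool" where
  "spans2 E n F \<longleftrightarrow> spans E n F \<and> (\<forall>e\<in>F. spans E n (F - {e}))"

lemma crosses_half: "crosses E (h div 2) S \<longleftrightarrow> (E h \<in> S) \<noteq> (E (mate h) \<in> S)"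
  by (cases h rule: half_edge_cases) (auto simp: crosses_def)

lemma crosses_halfE:
  assumes "crosses E e S"
  obtains h where "h div 2 = e" "E h \<in> S" "E (mate h) \<notin> S"
proof (cases "E (2 * e) \<in> S")
  case True
  then show ?thesis using assms that[of "2 * e"] by (auto simp: crosses_def)
next
  case False
  then show ?thesis using assms that[of "Suc (2 * e)"] by (auto simp: crosses_def)
qed

lemma spansD: "spans E n F \<Longrightarrow> S \<subseteq> {..<n} \<Longrightarrow> S \<noteq> {} \<Longrightarrow> S \<noteq> {..<n} \<Longrightarrow> \<exists>e\<in>F. crosses E e S"
  by (simp add: spans_def)

lemma spans_mono: "spans E n F \<Longrightarrow> F \<subseteq> F' \<Longrightarrow> spans E n F'"
  unfolding spans_def by blast

text \<open>A path from inside to outside of a cut uses a crossing edge. Conversely, the set of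
  vertices reachable from \<open>u\<close> is a cut that no edge crosses, so it contains all
  vertices.\<close>

lemma connected_graph_iff_spans:
  assumes V: "verts G = {..<n}" "1 \<le> n"
    and E: "\<And>e. e \<in> F \<Longrightarrow> ends G e = {E (2 * e), E (2 * e + 1)} \<and> E (2 * e) < n \<and> E (2 * e + 1) < n"
  shows "connected_graph (G\<lparr>edges := F\<rparr>) \<longleftrightarrow> spans E n F"
proof -
  let ?A = "adjacency (G\<lparr>edges := F\<rparr>)"
  show ?thesis
  proof
    assume conn: "connected_graph (G\<lparr>edges := F\<rparr>)"
    show "spans E n F" unfolding spans_def
    proof (intro allI impI, elim conjE)
      fix S assume S: "S \<subseteq> {..<n}" "S \<noteq> {}" "S \<noteq> {..<n}"
      then obtain u v where uv: "u \<in> S" "v \<in> {..<n}" "v \<notin> S" by auto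
      with conn S V have "(u, v) \<in> ?A\<^sup>*" by (auto simp: connected_graph_def)
      then have "v \<in> S \<or> (\<exists>e\<in>F. crosses E e S)"
      proof (induction rule: rtrancl_induct)
        case base
        then show ?case using uv by simp
      next
        case (step x y)
        then obtain e where "e \<in> F" "ends G e = {x, y}" by (auto simp: adjacency_def)
        then show ?case using step.IH E[of e] by (auto simp: crosses_def doubleton_eq_iff)
      qed
      then show "\<exists>e\<in>F. crosses E e S" using uv by simp
    qed
  next
    assume sp: "spans E n F"
    have "(u, v) \<in> ?A\<^sup>*" if uv: "u < n" "v < n" for u v
    proof -
      let ?S = "{w. w < n \<and> (u, w) \<in> ?A\<^sup>*}"
      have "?S = {..<n}"
      proof (rule ccontr)
        assume "?S \<noteq> {..<n}"
        moreover have "u \<in> ?S" "?S \<subseteq> {..<n}" using uv by auto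
        ultimately obtain e where e: "e \<in> F" "crosses E e ?S"
          using sp unfolding spans_def by blast
        have "(E (2 * e), E (2 * e + 1)) \<in> ?A" "(E (2 * e + 1), E (2 * e)) \<in> ?A"
          using e(1) E[of e] by (auto simp: adjacency_def intro!: bexI[of _ e])
        then show False
          using e E[of e] unfolding crosses_def by (auto dest: rtrancl_into_rtrancl)
      qed
      then show ?thesis using uv by auto
    qed
    then show "connected_graph (G\<lparr>edges := F\<rparr>)"
      using V by (auto simp: connected_graph_def lessThan_empty_iff)
  qed
qed

lemma spans_relabel:
  assumes "bij_betw f {..<n} {..<n}" "\<And>e. e \<in> F \<Longrightarrow> E (2 * e) < n \<and> E (2 * e + 1) < n"
    "\<And>e. e \<in> F \<Longrightarrow> q (2 * e) = f (E (2 * e)) \<and> q (2 * e + 1) = f (E (2 * e + 1))"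
  shows "spans q n F \<longleftrightarrow> spans E n F"
proof
  assume sp: "spans q n F"
  show "spans E n F" unfolding spans_def
  proof (intro allI impI, elim conjE)
    fix S assume S: "S \<subseteq> {..<n}" "S \<noteq> {}" "S \<noteq> {..<n}"
    have "f ` S \<subseteq> {..<n}" "f ` S \<noteq> {}" using S assms(1) by (auto simp: bij_betw_def)
    moreover have "f ` S \<noteq> {..<n}"
      using S assms(1) by (metis bij_betw_def inj_on_image_eq_iff order_refl)
    ultimately obtain e where e: "e \<in> F" "crosses q e (f ` S)"
      using sp unfolding spans_def by blast
    then have "crosses E e S"
      using assms(2,3)[OF e(1)] inj_on_image_mem_iff[OF bij_betw_imp_inj_on[OF assms(1)] _ S(1)]
      unfolding crosses_def by (metis lessThan_iff)
    then show "\<exists>e\<in>F. crosses E e S" using e by blast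
  qed
next
  assume sp: "spans E n F"
  show "spans q n F" unfolding spans_def
  proof (intro allI impI, elim conjE)
    fix S assume S: "S \<subseteq> {..<n}" "S \<noteq> {}" "S \<noteq> {..<n}"
    \<comment> \<open>The preimage of the cut, restricted to the vertices because \<open>f\<close>
      is a bijection only there.\<close>
    let ?S = "{v. v < n \<and> f v \<in> S}"
    have im: "f ` {..<n} = {..<n}" using assms(1) by (simp add: bij_betw_def)
    obtain a where "a \<in> S" using S by auto
    then have "a \<in> f ` {..<n}" using im S(1) by blast
    then have 1: "?S \<noteq> {}" using \<open>a \<in> S\<close> by auto
    obtain b where "b < n" "b \<notin> S" using S by auto
    then have "b \<in> f ` {..<n}" using im by blast
    then have 2: "?S \<noteq> {..<n}" using \<open>b \<notin> S\<close> by auto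
    obtain e where e: "e \<in> F" "crosses E e ?S"
      using spansD[OF sp _ 1 2] by blast
    then have "crosses q e S"
      using assms(2,3)[OF e(1)] by (simp add: crosses_def)
    then show "\<exists>e\<in>F. crosses q e S" using e by blast
  qed
qed

text \<open>Following parents ends in 0 because they decrease. With \<open>f\<close> as membership
  in a cut, this says that a tree crosses every nontrivial cut.\<close>

lemma parent_constant:
  fixes par :: "nat \<Rightarrow> nat"
  assumes "\<And>k. 0 < k \<Longrightarrow> k < i \<Longrightarrow> par k < k \<and> f k = f (par k)" "k < i"
  shows "f k = f 0"
  using assms(2)
proof (induction k rule: less_induct)
  case (less k)
  show ?case
  proof (cases "k = 0")
    case False
    then have "par k < k" "f k = f (par k)" using assms(1)[of k] less.prems by auto
    then show ?thesis using less.IH[of "par k"] less.prems by simp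
  qed simp
qed

text \<open>
  The exchange step of Prim's algorithm. Let \<open>Z\<close> be the component of the new vertex in the part
  of \<open>F\<close> that avoids the cut \<open>V\<close>. An edge \<open>f\<close> of \<open>F\<close> that leaves \<open>Z\<close> also crosses \<open>V\<close>; a cut that
  is crossed by \<open>f\<close> only must have \<open>V\<close> and \<open>Z\<close> on different sides and hence is crossed by the new
  edge.
\<close>

lemma prim_exchange:
  assumes F: "spans E n F" "F \<subseteq> {..<m}" and T: "T \<subseteq> F"
    and E: "\<And>h. h < 2 * m \<Longrightarrow> E h < n"
    and V: "\<And>S. (\<exists>x\<in>V. x \<in> S) \<Longrightarrow> (\<exists>x\<in>V. x \<notin> S) \<Longrightarrow> \<exists>t\<in>T. crosses E t S"
    and TV: "\<And>t. t \<in> T \<Longrightarrow> \<not> crosses E t V"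
    and h: "h < 2 * m" "E h \<in> V" "E (mate h) \<notin> V"
    and min: "\<And>f. f < m \<Longrightarrow> crosses E f V \<Longrightarrow> c (h div 2) \<le> (c f :: real)"
  shows "\<exists>F'. F' \<subseteq> {..<m} \<and> spans E n F' \<and> insert (h div 2) T \<subseteq> F' \<and> sum c F' \<le> sum c F"
proof (cases "h div 2 \<in> F")
  case True
  then show ?thesis using F T by blast
next
  case False
  define A where "A = {(x, y). \<exists>k. k div 2 \<in> F \<and> x = E k \<and> y = E (mate k) \<and> \<not> crosses E (k div 2) V}"
  define Z where "Z = {z. z < n \<and> (E (mate h), z) \<in> A\<^sup>*}"
  have y: "E (mate h) < n" using E mate_less h by blast
  have ZV: "z \<notin> V" if "z \<in> Z" for z
  proof -
    have "(E (mate h), z) \<in> A\<^sup>*" using that by (simp add: Z_def)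
    then show ?thesis
      by (induction rule: rtrancl_induct) (use h in \<open>auto simp: A_def crosses_half\<close>)
  qed
  have hx: "E h < n" using E h by blast
  have "Z \<subseteq> {..<n}" "Z \<noteq> {}" "Z \<noteq> {..<n}"
    using y hx ZV h(2) by (auto simp: Z_def)
  then obtain f where f: "f \<in> F" "crosses E f Z" using F(1) unfolding spans_def by blast
  then obtain k where k: "k div 2 = f" "E k \<in> Z" "E (mate k) \<notin> Z" by (auto elim: crosses_halfE)
  have "k < 2 * m" using k(1) f(1) F(2) by auto
  then have kn: "E (mate k) < n" using E mate_less by blast
  have fV: "crosses E f V"
  proof (rule ccontr)
    assume "\<not> crosses E f V"
    then have "(E k, E (mate k)) \<in> A" using k f by (auto simp: A_def)
    then have "E (mate k) \<in> Z" using k(2) kn by (auto simp: Z_def dest: rtrancl_into_rtrancl)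
    then show False using k by simp
  qed
  then have kV: "E (mate k) \<in> V" using ZV[OF k(2)] k(1) by (auto simp: crosses_half)
  have fm: "f < m" using f F by auto
  let ?F = "insert (h div 2) (F - {f})"
  have "spans E n ?F" unfolding spans_def
  proof (intro allI impI, elim conjE)
    fix S assume S: "S \<subseteq> {..<n}" "S \<noteq> {}" "S \<noteq> {..<n}"
    show "\<exists>e\<in>?F. crosses E e S"
    proof (cases "\<exists>e\<in>F - {f}. crosses E e S")
      case False
      have "crosses E f S" using F(1) S False unfolding spans_def by blast
      then have fS: "(E k \<in> S) \<noteq> (E (mate k) \<in> S)" using k(1) by (auto simp: crosses_half)
      have Zs: "(z \<in> S) = (E (mate h) \<in> S)" if "z \<in> Z" for z
      proof -
        have "(E (mate h), z) \<in> A\<^sup>*" using that by (simp add: Z_def)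
        then show ?thesis
        proof (induction rule: rtrancl_induct)
          case (step x z)
          then obtain l where l: "l div 2 \<in> F" "x = E l" "z = E (mate l)" "\<not> crosses E (l div 2) V"
            by (auto simp: A_def)
          then have "\<not> crosses E (l div 2) S" using False fV by blast
          then show ?case using step l by (auto simp: crosses_half)
        qed simp
      qed
      have Vs: "(x \<in> S) = (E h \<in> S)" if xV: "x \<in> V" for x
      proof (rule ccontr)
        assume "(x \<in> S) \<noteq> (E h \<in> S)"
        then obtain t where "t \<in> T" "crosses E t S" using V[of S] xV h(2) by (cases "x \<in> S") auto
        then have "t \<in> F - {f}" using T TV fV by blast
        then show False using False \<open>crosses E t S\<close> by blast
      qed
      have "crosses E (h div 2) S"
        using fS Zs[OF k(2)] Vs[OF kV] by (auto simp: crosses_half)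
      then show ?thesis by blast
    qed blast
  qed
  moreover have "?F \<subseteq> {..<m}" using F h by auto
  moreover have "insert (h div 2) T \<subseteq> ?F" using T TV fV by blast
  moreover have "sum c ?F \<le> sum c F"
  proof -
    have fin: "finite F" using F finite_subset by blast
    have "sum c ?F = c (h div 2) + sum c (F - {f})" using False fin by simp
    also have "\<dots> \<le> c f + sum c (F - {f})" using min[OF fm fV] by simp
    also have "\<dots> = sum c F" using fin f(1) by (simp add: sum.remove)
    finally show ?thesis .
  qed
  ultimately show ?thesis by blast
qed

subsection \<open>Augmenting a rooted spanning tree\<close>

text \<open>\<open>desc par x u\<close> reads: \<open>x\<close> is an ancestor of \<open>u\<close>.
  The root is 0; the guard \<open>0 < u\<close> keeps the meaningless value \<open>par 0\<close> out
  of the recursion.\<close>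

inductive desc :: "(nat \<Rightarrow> nat) \<Rightarrow> nat \<Rightarrow> nat \<Rightarrow> bool" for par where
  self [intro]: "desc par x x"
| step: "0 < u \<Longrightarrow> desc par x (par u) \<Longrightarrow> desc par x u"

text \<open>\<open>te i\<close> is the name of the edge from \<open>i\<close> to its parent.
  Decreasing parents are demanded of all positive numbers, also from \<open>n\<close> on, so facts
  on ancestors carry no range conditions; Prim's parent array provides this because it starts with
  zeros.\<close>

locale rooted_tree =
  fixes n m :: nat and q par te :: "nat \<Rightarrow> nat" and c :: "nat \<Rightarrow> real"
  assumes n_pos: "1 \<le> n"
    and par_less: "\<And>i. 0 < i \<Longrightarrow> par i < i"
    and q_less: "\<And>h. h < 2 * m \<Longrightarrow> q h < n"
    and te_less: "\<And>i. 0 < i \<Longrightarrow> i < n \<Longrightarrow> te i < m"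
    and te_inj: "inj_on te {1..<n}"
    and te_ends: "\<And>i. 0 < i \<Longrightarrow> i < n \<Longrightarrow> {q (2 * te i), q (2 * te i + 1)} = {i, par i}"
    and c_nonneg: "\<And>e. e < m \<Longrightarrow> 0 \<le> c e"
begin

abbreviation anc :: "nat \<Rightarrow> nat \<Rightarrow> bool" where
  "anc \<equiv> desc par"

definition tree :: "nat set" where
  "tree = te ` {1..<n}"

text \<open>The tree edge above \<open>x\<close> separates the ends of the edge of \<open>h\<close>
  and lies on the side of \<open>q h\<close>. So half-edge \<open>h\<close> acts as the vertical
  link from \<open>q h\<close> up to the lowest common ancestor of both ends, and its mate as the
  link from the other end.\<close>

definition covers :: "nat \<Rightarrow> nat \<Rightarrow> bool" where
  "covers h x \<longleftrightarrow> anc x (q h) \<and> \<not> anc x (q (mate h))"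

lemma anc_le: "anc x u \<Longrightarrow> x \<le> u"
proof (induction rule: desc.induct)
  case (step u x)
  then show ?case using par_less[of u] by simp
qed simp

lemma anc_trans: "anc y u \<Longrightarrow> anc x y \<Longrightarrow> anc x u"
  by (induction rule: desc.induct) (auto intro: desc.step)

lemma anc_par_iff: "x \<noteq> u \<Longrightarrow> 0 < u \<Longrightarrow> anc x u \<longleftrightarrow> anc x (par u)"
  by (subst desc.simps) auto

lemma anc_0: "anc 0 u"
proof (induction u rule: less_induct)
  case (less u)
  then show ?case using par_less[of u] by (cases "u = 0") (auto intro: desc.intros)
qed

text \<open>The ancestors of a vertex form a chain ordered by number. Comparing numbers thus
  replaces comparing depths throughout.\<close>

lemma anc_chain: "anc y u \<Longrightarrow> anc x u \<Longrightarrow> x \<le> y \<Longrightarrow> anc x y"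
proof (induction rule: desc.induct)
  case (step u y)
  have "y < u" using anc_le[OF step(2)] par_less[OF step(1)] by simp
  then show ?case using step anc_par_iff[of x u] by auto
qed simp

lemma covers_pos: "covers h x \<Longrightarrow> 0 < x"
  unfolding covers_def using anc_0 by (cases "x = 0") auto

text \<open>An ancestor \<open>x\<close> of \<open>y\<close> is also an ancestor of everything below
  \<open>y\<close>, so \<open>y\<close> cannot be above the mate if \<open>x\<close> is not. Hence a
  link covers a contiguous piece of the root path that starts at its lower end.\<close>

lemma covers_up: "covers h x \<Longrightarrow> anc y (q h) \<Longrightarrow> x \<le> y \<Longrightarrow> covers h y"
  unfolding covers_def using anc_chain anc_trans by blast

lemma crosses_te: "0 < i \<Longrightarrow> i < n \<Longrightarrow> crosses q (te i) S \<longleftrightarrow> (i \<in> S) \<noteq> (par i \<in> S)"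
  using te_ends[of i] by (auto simp: crosses_def doubleton_eq_iff)

lemma crosses_te_subtree: "0 < i \<Longrightarrow> i < n \<Longrightarrow> crosses q (te i) {u. anc x u} \<Longrightarrow> i = x"
  using anc_par_iff[of x i] by (auto simp: crosses_te)

lemma spans_tree: "spans q n tree"
  unfolding spans_def
proof (intro allI impI, elim conjE)
  fix S assume S: "S \<subseteq> {..<n}" "S \<noteq> {}" "S \<noteq> {..<n}"
  show "\<exists>e\<in>tree. crosses q e S"
  proof (rule ccontr)
    assume "\<not> ?thesis"
    then have eq: "(i \<in> S) = (par i \<in> S)" if "0 < i" "i < n" for i
      using that crosses_te[of i S] by (auto simp: tree_def)
    have "(k \<in> S) = (0 \<in> S)" if "k < n" for k
      using parent_constant[where f = "\<lambda>k. k \<in> S", OF _ that, of par] eq par_less by blast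
    then show False using S by auto
  qed
qed

lemma spans2_tree_union:
  assumes cov: "\<And>v. 0 < v \<Longrightarrow> v < n \<Longrightarrow> \<exists>h. h < 2 * m \<and> h div 2 \<in> K \<and> h div 2 \<notin> tree \<and> covers h v"
  shows "spans2 q n (tree \<union> K)"
  unfolding spans2_def
proof (intro conjI ballI)
  show "spans q n (tree \<union> K)" by (rule spans_mono[OF spans_tree]) blast
  fix e assume e: "e \<in> tree \<union> K"
  show "spans q n (tree \<union> K - {e})"
  proof (cases "e \<in> tree")
    case False
    then show ?thesis by (intro spans_mono[OF spans_tree]) blast
  next
    case True
    then obtain v where v: "0 < v" "v < n" "e = te v" by (auto simp: tree_def Suc_le_eq)
    show ?thesis unfolding spans_def
    proof (intro allI impI, elim conjE)
      fix S assume S: "S \<subseteq> {..<n}" "S \<noteq> {}" "S \<noteq> {..<n}"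
      show "\<exists>e\<in>tree \<union> K - {e}. crosses q e S"
      proof (cases "\<exists>i. 0 < i \<and> i < n \<and> i \<noteq> v \<and> (i \<in> S) \<noteq> (par i \<in> S)")
        case True
        then obtain i where i: "0 < i" "i < n" "i \<noteq> v" "(i \<in> S) \<noteq> (par i \<in> S)" by blast
        then have "te i \<in> tree - {e}" "crosses q (te i) S"
          using v te_inj by (auto simp: tree_def crosses_te inj_on_def)
        then show ?thesis by blast
      next
        case False
        \<comment> \<open>If no tree edge except \<open>te v\<close> crosses \<open>S\<close>,
          membership in \<open>S\<close> is constant on the subtree of \<open>v\<close> and constant
          outside it. The two values must differ, so every link that covers \<open>v\<close> crosses
          \<open>S\<close>.\<close>
        have const: "(i \<in> S) = ((if anc v i then v else 0) \<in> S)" if "i < n" for i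
          using that
        proof (induction i rule: less_induct)
          case (less i)
          show ?case
          proof (cases "i = 0 \<or> i = v")
            case True
            then show ?thesis using anc_le[of v i] v by auto
          next
            case i: False
            then have "(i \<in> S) = (par i \<in> S)" using False less.prems by auto
            then show ?thesis
              using less.IH[of "par i"] less.prems par_less[of i] i anc_par_iff[of v i] by auto
          qed
        qed
        have ne: "(v \<in> S) \<noteq> (0 \<in> S)"
        proof
          assume "(v \<in> S) = (0 \<in> S)"
          then have "\<And>i. i < n \<Longrightarrow> (i \<in> S) = (0 \<in> S)" using const by metis
          then show False using S by auto
        qed
        obtain h where h: "h < 2 * m" "h div 2 \<in> K" "h div 2 \<notin> tree" "covers h v" using cov v by blast
        have "crosses q (h div 2) S"
          using h(4) ne const[OF q_less[OF h(1)]] const[OF q_less[OF mate_less[OF h(1)]]]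
          by (auto simp: covers_def crosses_half)
        moreover have "h div 2 \<noteq> e" using \<open>e \<in> tree\<close> h by auto
        ultimately show ?thesis using h by blast
      qed
    qed
  qed
qed

text \<open>The cut is the subtree of \<open>x\<close>. Without \<open>te x\<close>, the only tree
  edge across it, some other edge of \<open>F\<close> must cross; its half inside the subtree is the
  link.\<close>

lemma spans2_covers:
  assumes F: "spans2 q n F" "F \<subseteq> {..<m}" and x: "0 < x" "x < n"
  shows "\<exists>h. h < 2 * m \<and> h div 2 \<in> F - tree \<and> covers h x"
proof -
  have "spans q n (F - {te x})" using F(1) by (cases "te x \<in> F") (auto simp: spans2_def)
  moreover have "{u. u < n \<and> anc x u} \<subseteq> {..<n}" "{u. u < n \<and> anc x u} \<noteq> {}"
    using x by auto
  moreover have "0 \<notin> {u. u < n \<and> anc x u}" using anc_le[of x 0] x by auto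
  moreover have "0 \<in> {..<n}" using x by auto
  ultimately obtain e where e: "e \<in> F - {te x}" "crosses q e {u. u < n \<and> anc x u}"
    using spansD[of q n "F - {te x}" "{u. u < n \<and> anc x u}"] by metis
  then obtain h where h: "h div 2 = e" "q h \<in> {u. u < n \<and> anc x u}" "q (mate h) \<notin> {u. u < n \<and> anc x u}"
    by (auto elim: crosses_halfE)
  have hm: "h < 2 * m" using h(1) e F by auto
  have cov: "covers h x" using h q_less[OF mate_less[OF hm]] by (auto simp: covers_def)
  have "e \<notin> tree"
  proof
    assume "e \<in> tree"
    then obtain i where i: "0 < i" "i < n" "e = te i" by (auto simp: tree_def Suc_le_eq)
    have "crosses q e {u. anc x u}" using cov h(1) by (auto simp: crosses_half covers_def)
    then have "i = x" using crosses_te_subtree i by blast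
    then show False using i e by auto
  qed
  then show ?thesis using h hm e cov by blast
qed

text \<open>Weak duality: every \<open>y x\<close> is charged to a link of \<open>F\<close> that
  covers \<open>x\<close>, and no link receives more than its cost. An edge of \<open>F\<close> pays
  for its two halves, hence the factor 2.\<close>

lemma dual_bound:
  assumes y: "\<And>x. 0 \<le> y x"
    and feas: "\<And>h. h < 2 * m \<Longrightarrow> h div 2 \<notin> tree \<Longrightarrow> (\<Sum>x | x < n \<and> covers h x. y x) \<le> c (h div 2)"
    and F: "spans2 q n F" "F \<subseteq> {..<m}"
  shows "(\<Sum>x\<in>{1..<n}. y x) \<le> 2 * (\<Sum>e\<in>F - tree. c e)"
proof -
  have fin: "finite F" using F finite_subset by blast
  define H where "H = {h. h < 2 * m \<and> h div 2 \<in> F - tree}"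
  have finH: "finite H" by (simp add: H_def)
  have ex: "\<exists>h\<in>H. covers h x" if x: "x \<in> {1..<n}" for x
    using spans2_covers[OF F, of x] x by (auto simp: H_def)
  have "(\<Sum>x\<in>{1..<n}. y x) \<le> (\<Sum>x\<in>{1..<n}. \<Sum>h\<in>H. if covers h x then y x else 0)"
  proof (rule sum_mono)
    fix x assume "x \<in> {1..<n}"
    then obtain h where h: "h \<in> H" "covers h x" using ex by blast
    have "y x = (if covers h x then y x else 0)" using h by simp
    also have "\<dots> \<le> (\<Sum>h\<in>H. if covers h x then y x else 0)"
      by (rule member_le_sum[OF h(1) _ finH]) (use y in auto)
    finally show "y x \<le> (\<Sum>h\<in>H. if covers h x then y x else 0)" .
  qed
  also have "\<dots> = (\<Sum>h\<in>H. \<Sum>x\<in>{1..<n}. if covers h x then y x else 0)"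
    by (rule sum.swap)
  also have "\<dots> \<le> (\<Sum>h\<in>H. c (h div 2))"
  proof (rule sum_mono)
    fix h assume h: "h \<in> H"
    have "(\<Sum>x\<in>{1..<n}. if covers h x then y x else 0) = (\<Sum>x | x < n \<and> covers h x. y x)"
      by (rule sum.mono_neutral_cong_right) (auto dest: covers_pos simp: Suc_le_eq)
    then show "(\<Sum>x\<in>{1..<n}. if covers h x then y x else 0) \<le> c (h div 2)"
      using feas h by (simp add: H_def)
  qed
  also have "\<dots> = (\<Sum>e\<in>F - tree. \<Sum>h | h \<in> H \<and> h div 2 = e. c (h div 2))"
    by (rule sum.group[symmetric]) (use finH fin in \<open>auto simp: H_def\<close>)
  also have "\<dots> = (\<Sum>e\<in>F - tree. 2 * c e)"
  proof (rule sum.cong[OF refl])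
    fix e assume e: "e \<in> F - tree"
    then have "e < m" using F by auto
    then have "{h. h \<in> H \<and> h div 2 = e} = {2 * e, Suc (2 * e)}" using e by (auto simp: H_def)
    then show "(\<Sum>h | h \<in> H \<and> h div 2 = e. c (h div 2)) = 2 * c e" by simp
  qed
  finally show ?thesis by (simp add: sum_distrib_left)
qed

end

text \<open>
  The result of the bottom-up phase: \<open>y\<close> is a dual solution, and \<open>ch v\<close> is the link (plus 1) that
  became tight when \<open>v\<close> was processed, or 0 if \<open>v\<close> had been covered before.
\<close>

locale chosen_links = rooted_tree +
  fixes ch :: "nat \<Rightarrow> nat" and y :: "nat \<Rightarrow> real"
  assumes y_nonneg: "\<And>x. 0 \<le> y x"
    and y_feasible: "\<And>h. h < 2 * m \<Longrightarrow> h div 2 \<notin> tree \<Longrightarrow> (\<Sum>x | x < n \<and> covers h x. y x) \<le> c (h div 2)"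
    and ch_link: "\<And>v. 0 < v \<Longrightarrow> v < n \<Longrightarrow> ch v \<noteq> 0 \<Longrightarrow> ch v - 1 < 2 * m \<and> (ch v - 1) div 2 \<notin> tree \<and>
      covers (ch v - 1) v \<and> c ((ch v - 1) div 2) = (\<Sum>x | x < n \<and> covers (ch v - 1) x. y x)"
    and ch_uncovered: "\<And>v w. 0 < v \<Longrightarrow> v < w \<Longrightarrow> w < n \<Longrightarrow> ch v \<noteq> 0 \<Longrightarrow> ch w \<noteq> 0 \<Longrightarrow> \<not> covers (ch w - 1) v"
    and ch_0: "\<And>v. 0 < v \<Longrightarrow> v < n \<Longrightarrow> ch v = 0 \<Longrightarrow> y v = 0 \<and> (\<exists>w. v < w \<and> w < n \<and> ch w \<noteq> 0 \<and> covers (ch w - 1) v)"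
begin

text \<open>The equation is a recursion on \<open>v\<close>, since only smaller members of
  \<open>K\<close> occur on the right. It describes the top-down deletion without a recursive
  function, in the form that the loop invariant later delivers.\<close>

context
  fixes K :: "nat set"
  assumes K: "\<And>v. v \<in> K \<longleftrightarrow> 0 < v \<and> v < n \<and> ch v \<noteq> 0 \<and> \<not> (\<exists>f\<in>K. f < v \<and> covers (ch f - 1) v)"
begin

text \<open>Let the link chosen for \<open>w\<close> cover \<open>v\<close>, and suppose it was
  dropped because a kept link, chosen for \<open>f < w\<close>, covers \<open>w\<close>. The link of
  \<open>w\<close> does not cover \<open>f\<close>, which was processed later and still uncovered
  then. So \<open>f\<close> lies above \<open>v\<close>, and the link of \<open>f\<close>, which
  starts below \<open>w\<close>, passes \<open>v\<close> on its way.\<close>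

lemma kept_cover:
  assumes v: "0 < v" "v < n"
  shows "\<exists>k\<in>K. covers (ch k - 1) v"
proof -
  obtain w where w: "v \<le> w" "w < n" "ch w \<noteq> 0" "covers (ch w - 1) v"
  proof (cases "ch v = 0")
    case True
    then show ?thesis using ch_0[OF v] that less_imp_le by blast
  next
    case False
    then show ?thesis using ch_link[OF v] that[of v] v by blast
  qed
  show ?thesis
  proof (cases "w \<in> K")
    case True
    then show ?thesis using w by blast
  next
    case False
    then obtain f where f: "f \<in> K" "f < w" "covers (ch f - 1) w" using K[of w] w v by auto
    have f': "0 < f" "ch f \<noteq> 0" "f < n" using f(1) K by blast+
    have "covers (ch f - 1) f" using ch_link f' by blast
    then have "anc f w" using f(2,3) anc_chain[of w "q (ch f - 1)" f] by (auto simp: covers_def)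
    have "covers (ch w - 1) w" using ch_link[of w] w v by linarith
    then have aw: "anc w (q (ch w - 1))" by (simp add: covers_def)
    have "f < v"
    proof (rule ccontr)
      assume "\<not> f < v"
      then have "covers (ch w - 1) f"
        using covers_up[OF w(4), of f] anc_trans[OF aw \<open>anc f w\<close>] by simp
      then show False using ch_uncovered[of f w] f f' w by blast
    qed
    have "anc v w" using anc_chain[OF aw _ w(1)] w(4) by (simp add: covers_def)
    then have "anc v (q (ch f - 1))" using f(3) anc_trans[of w _ v] by (auto simp: covers_def)
    then have "covers (ch f - 1) v" using covers_up[OF \<open>covers (ch f - 1) f\<close>] \<open>f < v\<close> by simp
    then show ?thesis using f by blast
  qed
qed

text \<open>A nonzero \<open>y x\<close> means that \<open>x\<close> was uncovered when processed,
  so \<open>l\<close> was not processed before \<open>x\<close> and is an ancestor of it. Being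
  below \<open>k\<close>, it is covered by the link of \<open>k\<close> and would have been
  dropped.\<close>

lemma kept_unique:
  assumes "0 < x" "x < n" "y x \<noteq> 0" "k \<in> K" "l \<in> K" "k < l" "covers (ch k - 1) x" "covers (ch l - 1) x"
  shows False
proof -
  have "ch x \<noteq> 0" using ch_0 assms by blast
  have k: "0 < k" "k < n" "ch k \<noteq> 0" and l: "0 < l" "l < n" "ch l \<noteq> 0" using assms(4,5) K by blast+
  have "l \<le> x" using ch_uncovered[of x l] assms \<open>ch x \<noteq> 0\<close> l by (meson not_le)
  have "covers (ch k - 1) k" "covers (ch l - 1) l" using ch_link k l by blast+
  then have "anc l x" using anc_chain[of x "q (ch l - 1)" l] assms(8) \<open>l \<le> x\<close> by (auto simp: covers_def)
  then have "anc l (q (ch k - 1))" using assms(7) anc_trans[of x _ l] by (auto simp: covers_def)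
  then have "covers (ch k - 1) l" using covers_up[OF \<open>covers (ch k - 1) k\<close>] assms(6) by simp
  then show False using assms(4-6) K by blast
qed

text \<open>Complementary slackness: kept links are tight, so each costs as much as the dual
  variables it covers, and after swapping the sums every nonzero \<open>y x\<close> is counted
  once.\<close>

lemma kept_cost: "(\<Sum>v\<in>K. c ((ch v - 1) div 2)) \<le> (\<Sum>x\<in>{1..<n}. y x)"
proof -
  have "K \<subseteq> {..<n}" using K by blast
  then have fin: "finite K" using finite_subset by blast
  have "(\<Sum>v\<in>K. c ((ch v - 1) div 2)) = (\<Sum>v\<in>K. \<Sum>x\<in>{1..<n}. if covers (ch v - 1) x then y x else 0)"
  proof (rule sum.cong[OF refl])
    fix v assume "v \<in> K"
    then have "c ((ch v - 1) div 2) = (\<Sum>x | x < n \<and> covers (ch v - 1) x. y x)" using ch_link K by blast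
    also have "\<dots> = (\<Sum>x\<in>{1..<n}. if covers (ch v - 1) x then y x else 0)"
      by (rule sum.mono_neutral_cong_left) (auto dest: covers_pos simp: Suc_le_eq)
    finally show "c ((ch v - 1) div 2) = (\<Sum>x\<in>{1..<n}. if covers (ch v - 1) x then y x else 0)" .
  qed
  also have "\<dots> = (\<Sum>x\<in>{1..<n}. \<Sum>v\<in>K. if covers (ch v - 1) x then y x else 0)"
    by (rule sum.swap)
  also have "\<dots> \<le> (\<Sum>x\<in>{1..<n}. y x)"
  proof (rule sum_mono)
    fix x assume x: "x \<in> {1..<n}"
    show "(\<Sum>v\<in>K. if covers (ch v - 1) x then y x else 0) \<le> y x"
    proof (cases "y x = 0")
      case False
      obtain k where k: "k \<in> K" "covers (ch k - 1) x" using kept_cover[of x] x by auto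
      have uniq: "l = k" if "l \<in> K" "covers (ch l - 1) x" for l
        using kept_unique[of x k l] kept_unique[of x l k] k that x False
        by (cases k l rule: linorder_cases) (simp_all add: Suc_le_eq)
      have "(\<Sum>v\<in>K. if covers (ch v - 1) x then y x else 0) = (\<Sum>v\<in>K. if v = k then y x else 0)"
      proof (rule sum.cong[OF refl])
        fix v assume "v \<in> K"
        then show "(if covers (ch v - 1) x then y x else 0) = (if v = k then y x else 0)"
          using uniq[of v] k(2) by (cases "v = k") auto
      qed
      then show ?thesis using fin k(1) by simp
    qed (simp only: if_cancel sum.neutral_const order_refl)
  qed
  finally show ?thesis .
qed

lemma augmented_tree:
  shows "spans2 q n (tree \<union> (\<lambda>k. (ch k - 1) div 2) ` K)"
    and "spans2 q n F \<Longrightarrow> F \<subseteq> {..<m} \<Longrightarrow> sum c tree \<le> sum c F \<Longrightarrow>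
      sum c (tree \<union> (\<lambda>k. (ch k - 1) div 2) ` K) \<le> 3 * sum c F"
proof -
  let ?L = "(\<lambda>k. (ch k - 1) div 2) ` K"
  show "spans2 q n (tree \<union> ?L)"
  proof (rule spans2_tree_union)
    fix v assume "0 < v" "v < n"
    then obtain k where k: "k \<in> K" "covers (ch k - 1) v" using kept_cover by blast
    then have "ch k - 1 < 2 * m" "(ch k - 1) div 2 \<notin> tree" using ch_link K by blast+
    then show "\<exists>h. h < 2 * m \<and> h div 2 \<in> ?L \<and> h div 2 \<notin> tree \<and> covers h v" using k by blast
  qed
  assume F: "spans2 q n F" "F \<subseteq> {..<m}" and T: "sum c tree \<le> sum c F"
  have "K \<subseteq> {..<n}" using K by blast
  then have fin: "finite K" using finite_subset by blast
  have L: "?L \<subseteq> {..<m}"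
  proof
    fix e assume "e \<in> ?L"
    then obtain k where k: "k \<in> K" "e = (ch k - 1) div 2" by blast
    then have "ch k - 1 < 2 * m" using ch_link[of k] K[of k] by blast
    then show "e \<in> {..<m}" using k by simp
  qed
  have "sum c (tree \<union> ?L) = sum c tree + sum c (?L - tree)"
    using fin sum.union_disjoint[of tree "?L - tree" c] by (simp add: tree_def)
  also have "sum c (?L - tree) \<le> sum c ?L"
    by (rule sum_mono2) (use L c_nonneg fin in auto)
  \<comment> \<open>Two kept links may be halves of one edge, which is then paid only once; hence an
    inequality.\<close>
  also have "sum c ?L \<le> (\<Sum>v\<in>K. c ((ch v - 1) div 2))"
    using sum_image_le[OF fin, of c "\<lambda>k. (ch k - 1) div 2"] L c_nonneg by (force simp: o_def)
  also have "\<dots> \<le> (\<Sum>x\<in>{1..<n}. y x)" by (rule kept_cost)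
  also have "\<dots> \<le> 2 * sum c (F - tree)" by (rule dual_bound[OF y_nonneg y_feasible F])
  also have "sum c (F - tree) \<le> sum c F"
    by (rule sum_mono2) (use F c_nonneg finite_subset[OF F(2)] in auto)
  finally show "sum c (tree \<union> ?L) \<le> 3 * sum c F" using T by simp
qed

end

end

subsection \<open>Linked lists\<close>

abbreviation "reg r \<equiv> Get r (C 0)"
abbreviation "set_reg r e \<equiv> Asg r (C 0) e"
abbreviation "inc e \<equiv> Bin Plus e (C 1)"
abbreviation "dec e \<equiv> Bin Monus e (C 1)"
abbreviation "link_cost e \<equiv> RGet Cost (Bin Div (dec e) (C 2))"

definition mate_of :: "aexp \<Rightarrow> aexp" where
  "mate_of e = Bin Monus (inc e) (Bin Times (C 2) (Bin Mod e (C 2)))"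

definition adjacency_loop :: cmd where
  "adjacency_loop =
     Loop (Lt (reg I) (Bin Times (C 2) VM))
      (Asg Next (reg I) (Get Head (Get Inp (reg I))) ;;
       Asg Head (Get Inp (reg I)) (inc (reg I)) ;;
       set_reg I (inc (reg I)))"

text \<open>\<open>p\<close> points to a minimizer of \<open>f\<close> over \<open>A\<close>, in the encoding by \<open>Suc\<close> and 0.\<close>

definition amin :: "(nat \<Rightarrow> real) \<Rightarrow> nat set \<Rightarrow> nat \<Rightarrow> bool" where
  "amin f A p \<longleftrightarrow> (if p = 0 then A = {} else p - 1 \<in> A \<and> (\<forall>x\<in>A. f (p - 1) \<le> f x))"

lemma amin_empty [simp]: "amin f {} p \<longleftrightarrow> p = 0"
  by (auto simp: amin_def)

lemma amin_insert: "amin f A p \<Longrightarrow> amin f (insert x A) (if p = 0 \<or> f x < f (p - 1) then Suc x else p)"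
  by (fastforce simp: amin_def split: if_splits)

text \<open>
  The pointer to the last half-edge below \<open>k\<close> at vertex \<open>u\<close>: the closed form of the linked lists that
  arise by prepending the half-edges in increasing order.
\<close>

primrec prv :: "(nat \<Rightarrow> nat) \<Rightarrow> nat \<Rightarrow> nat \<Rightarrow> nat" where
  "prv E u 0 = 0"
| "prv E u (Suc k) = (if E k = u then Suc k else prv E u k)"

lemma prv_le: "prv E u k \<le> k"
  by (induction k) auto

lemma prv_end: "prv E u k \<noteq> 0 \<Longrightarrow> E (prv E u k - 1) = u"
  by (induction k) auto

lemma prv_gap: "prv E u k \<le> h \<Longrightarrow> h < k \<Longrightarrow> E h \<noteq> u"
  by (induction k) (auto simp: less_Suc_eq split: if_splits)

lemma prv_cong: "(\<And>h. h < k \<Longrightarrow> (E h = u) = (E' h = u')) \<Longrightarrow> prv E u k = prv E' u' k"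
  by (induction k) auto

text \<open>One step of a list traversal. Lists run downwards, so the elements not below the pointer
  are the visited ones. As \<open>p\<close> stands for half-edge \<open>p - 1\<close>, the bound
  \<open>p\<close> leaves it out and the next pointer includes it.\<close>

lemma prv_scan:
  assumes "E (p - 1) = u" "p \<noteq> 0" "p \<le> k"
  shows "{h. prv E u (p - 1) \<le> h \<and> h < k \<and> E h = u} = insert (p - 1) {h. p \<le> h \<and> h < k \<and> E h = u}" (is "?A = ?B")
proof
  show "?A \<subseteq> ?B" using prv_gap[of E u "p - 1"] by fastforce
  show "?B \<subseteq> ?A" using prv_le[of E u "p - 1"] assms by auto
qed

text \<open>With a list pointer for \<open>k\<close> this is the length of the remaining list, which
  serves as the potential of a scan. With \<open>2 * m\<close> it is the degree of \<open>u\<close>,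
  a loop counting twice.\<close>

definition deg :: "(nat \<Rightarrow> nat) \<Rightarrow> nat \<Rightarrow> nat \<Rightarrow> nat" where
  "deg E u k = card {h. h < k \<and> E h = u}"

lemma deg_prv:
  assumes "E (p - 1) = u" "p \<noteq> 0"
  shows "Suc (deg E u (prv E u (p - 1))) = deg E u p"
proof -
  have "{h. h < p \<and> E h = u} = insert (p - 1) {h. h < prv E u (p - 1) \<and> E h = u}" (is "?A = ?B")
  proof
    show "?A \<subseteq> ?B"
    proof
      fix h assume "h \<in> ?A"
      then show "h \<in> ?B" using prv_gap[of E u "p - 1" h] by (cases "h = p - 1") force+
    qed
    show "?B \<subseteq> ?A" using prv_le[of E u "p - 1"] assms by auto
  qed
  moreover have "p - 1 \<notin> {h. h < prv E u (p - 1) \<and> E h = u}" using prv_le[of E u "p - 1"] by auto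
  ultimately show ?thesis by (simp add: deg_def)
qed

definition frame :: "ivar set \<Rightarrow> store \<Rightarrow> store \<Rightarrow> bool" where
  "frame A st st' \<longleftrightarrow> (\<forall>a. a \<notin> A \<longrightarrow> iv st' a = iv st a)"

lemma frame_refl [simp]: "frame A st st"
  by (simp add: frame_def)

lemma frameD: "frame A st st' \<Longrightarrow> a \<notin> A \<Longrightarrow> iv st' a = iv st a"
  by (simp add: frame_def)

context machine
begin

lemma frame_put [simp]: "a \<in> A \<Longrightarrow> frame A st st' \<Longrightarrow> frame A st (put st' a i x)"
  "frame A st st' \<Longrightarrow> frame A st (rput st' r i z)"
  by (auto simp: frame_def)

lemma mate_of_simps [simp]:
  "av st (mate_of e) = mate (av st e)"
  "asafe st (mate_of e) \<longleftrightarrow> asafe st e \<and> av st e + 1 < 100 * m"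
proof -
  have "2 * (av st e mod 2) < 100 * m" using m_pos by linarith
  then show "asafe st (mate_of e) \<longleftrightarrow> asafe st e \<and> av st e + 1 < 100 * m"
    by (auto simp: mate_of_def)
qed (simp add: mate_of_def mate_def)

declare lim_def [simp] rlim_def [simp]

lemma run_seq:
  "run p st R' T1 \<Longrightarrow> (\<And>st'. R' st' \<Longrightarrow> run q st' R T2) \<Longrightarrow> T1 + T2 \<le> T \<Longrightarrow> run (p ;; q) st R T"
  by (rule run_Then[where ?T1.0 = T1 and ?T2.0 = T2]) (auto intro: run_mono)

lemma run_set_reg:
  assumes "asafe st e" "run q (put st r 0 (av st e)) R T" "Suc T \<le> T'"
  shows "run (set_reg r e ;; q) st R T'"
  by (rule run_Then[where ?T1.0 = 1 and ?T2.0 = T, OF run_basic]) (use assms m_pos in simp_all)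

lemma run_pre_seq: "pre p (\<lambda>st'. run q st' R T') st \<Longrightarrow> cost p + T' \<le> T \<Longrightarrow> run (p ;; q) st R T"
  by (rule run_Then[OF run_pre])

lemma adjacency_loop:
  assumes E: "\<And>h. h < 2 * m \<Longrightarrow> iv st Inp h < n" and 0: "iv st Head = (\<lambda>_. 0)" "iv st I 0 = 0"
  shows "run adjacency_loop st (\<lambda>st'. frame {Head, Next, I} st st' \<and> rv st' = rv st \<and>
      (\<forall>u. iv st' Head u = prv (iv st Inp) u (2 * m)) \<and>
      (\<forall>h<2 * m. iv st' Next h = prv (iv st Inp) (iv st Inp h) h)) (8 * m + 1)"
proof -
  let ?E = "iv st Inp"
  let ?Inv = "\<lambda>st'. frame {Head, Next, I} st st' \<and> rv st' = rv st \<and> iv st' I 0 \<le> 2 * m \<and>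
      (\<forall>u. iv st' Head u = prv ?E u (iv st' I 0)) \<and>
      (\<forall>h<iv st' I 0. iv st' Next h = prv ?E (?E h) h)"
  show ?thesis unfolding adjacency_loop_def
  \<comment> \<open>Each of the \<open>2 * m\<close> iterations takes 3 assignments and one test.
    The potentials of the other counting loops are formed in the same way.\<close>
  proof (rule run_Loop[where Inv = ?Inv and \<Phi> = "\<lambda>st'. 4 * (2 * m - iv st' I 0)" and T = "\<lambda>_. 3"], goal_cases)
    case (3 st')
    then have "iv st' Inp = ?E" by (auto dest!: frameD[where a = Inp])
    with 3 E[of "iv st' I 0"] n_le_m show ?case
      by (intro run_basic) (auto simp: less_Suc_eq)
  qed (use 0 m_pos in auto)
qed

end

subsection \<open>Prim's algorithm\<close>

definition prim_scan :: cmd where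
  "prim_scan =
     Loop (Lt (C 0) (reg P))
      (set_reg X (Get Inp (mate_of (dec (reg P)))) ;;
       If (Conj (Eq (Get Pos (reg X)) (C 0))
            (Disj (Eq (Get Best (reg X)) (C 0)) (RLt (link_cost (reg P)) (link_cost (Get Best (reg X))))))
         (Asg Best (reg X) (reg P)) Nop ;;
       set_reg P (Get Next (dec (reg P))))"

definition prim_min :: cmd where
  "prim_min =
     Loop (Lt (reg J) VN)
      (If (Conj (Conj (Eq (Get Pos (reg J)) (C 0)) (Not (Eq (Get Best (reg J)) (C 0))))
            (Disj (Eq (reg X) (C 0)) (RLt (link_cost (Get Best (reg J))) (link_cost (Get Best (dec (reg X)))))))
         (set_reg X (inc (reg J))) Nop ;;
       set_reg J (inc (reg J)))"

definition prim_extend :: cmd where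
  "prim_extend =
     Asg Ord (reg I) (dec (reg X)) ;;
     Asg Par (reg I) (dec (Get Pos (Get Inp (dec (Get Best (dec (reg X))))))) ;;
     Asg Sel (Bin Div (dec (Get Best (dec (reg X)))) (C 2)) (C 1) ;;
     Asg Pos (dec (reg X)) (inc (reg I)) ;;
     set_reg I (inc (reg I))"

definition prim_loop :: cmd where
  "prim_loop =
     Loop (Lt (reg I) VN)
      (set_reg P (Get Head (Get Ord (dec (reg I)))) ;;
       prim_scan ;;
       (set_reg X (C 0) ;; set_reg J (C 0)) ;;
       prim_min ;;
       prim_extend)"

text \<open>\<open>best\<close> lags behind by one vertex: the list of the vertex reached last is
  scanned at the start of the next iteration. Once a vertex is reached its entry is frozen and
  records its tree edge. The last clause expresses optimality without fixing an optimum: every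
  spanning edge set can be exchanged for one that contains the tree and is not more
  expensive.\<close>

definition prim_inv where
  "prim_inv n m E c i pos ord best par sel \<longleftrightarrow>
     1 \<le> i \<and> i \<le> n \<and> (\<forall>k<i. ord k < n \<and> pos (ord k) = Suc k) \<and>
     (\<forall>v<n. pos v \<noteq> 0 \<longrightarrow> pos v \<le> i \<and> ord (pos v - 1) = v) \<and> (\<forall>w<n. best w \<le> 2 * m) \<and>
     (\<forall>w<n. pos w = 0 \<longrightarrow>
        amin (\<lambda>h. c (h div 2)) {h. h < 2 * m \<and> E h \<in> ord ` {..<i - 1} \<and> E (mate h) = w} (best w)) \<and>
     (\<forall>k>0. par k < k) \<and>
     (\<forall>k. 0 < k \<and> k < i \<longrightarrow> best (ord k) \<noteq> 0 \<and> E (best (ord k) - 1) = ord (par k) \<and>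
        E (mate (best (ord k) - 1)) = ord k) \<and>
     (\<forall>e. sel e = of_bool (\<exists>k. 0 < k \<and> k < i \<and> e = (best (ord k) - 1) div 2)) \<and>
     (\<forall>F. F \<subseteq> {..<m} \<and> spans E n F \<longrightarrow>
        (\<exists>F'. F' \<subseteq> {..<m} \<and> spans E n F' \<and> {e. sel e = 1} \<subseteq> F' \<and> sum c F' \<le> sum c F))"

text \<open>An edge that leaves the reached set costs at least as much as the entry of
  \<open>best'\<close> at its outer end. So the minimum of these entries is a cheapest edge across
  the cut, and \<open>prim_exchange\<close> applies.\<close>

lemma prim_inv_step:
  fixes E pos ord best best' par sel :: "nat \<Rightarrow> nat" and c :: "nat \<Rightarrow> real"
  assumes inv: "prim_inv n m E c i pos ord best par sel" and i: "i < n"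
    and E: "\<And>h. h < 2 * m \<Longrightarrow> E h < n" and sp: "spans E n {..<m}"
    and best': "\<And>w. w < n \<Longrightarrow> best' w \<le> 2 * m \<and> (pos w \<noteq> 0 \<longrightarrow> best' w = best w) \<and>
      (pos w = 0 \<longrightarrow> amin (\<lambda>h. c (h div 2)) {h. h < 2 * m \<and> E h \<in> ord ` {..<i} \<and> E (mate h) = w} (best' w))"
    and x: "amin (\<lambda>w. c ((best' w - 1) div 2)) {w. w < n \<and> pos w = 0 \<and> best' w \<noteq> 0} x"
  shows "x \<noteq> 0 \<and> x \<le> n \<and> best' (x - 1) \<noteq> 0 \<and> prim_inv n m E c (Suc i) (pos(x - 1 := Suc i)) (ord(i := x - 1)) best'
    (par(i := pos (E (best' (x - 1) - 1)) - 1)) (sel((best' (x - 1) - 1) div 2 := 1))"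
proof -
  let ?c = "\<lambda>h. c (h div 2)"
  define V where "V = ord ` {..<i}"
  note inv' = inv[unfolded prim_inv_def]
  have i1: "1 \<le> i" and ord: "\<And>k. k < i \<Longrightarrow> ord k < n \<and> pos (ord k) = Suc k"
    and pos: "\<And>v. v < n \<Longrightarrow> pos v \<noteq> 0 \<Longrightarrow> pos v \<le> i \<and> ord (pos v - 1) = v"
    and par: "\<And>k. 0 < k \<Longrightarrow> par k < k"
    and bst: "\<And>k. 0 < k \<Longrightarrow> k < i \<Longrightarrow> best (ord k) \<noteq> 0 \<and> E (best (ord k) - 1) = ord (par k) \<and>
        E (mate (best (ord k) - 1)) = ord k"
    and sel: "\<And>e. sel e = of_bool (\<exists>k. 0 < k \<and> k < i \<and> e = (best (ord k) - 1) div 2)"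
    and opt: "\<And>F. F \<subseteq> {..<m} \<Longrightarrow> spans E n F \<Longrightarrow>
        (\<exists>F'. F' \<subseteq> {..<m} \<and> spans E n F' \<and> {e. sel e = 1} \<subseteq> F' \<and> sum c F' \<le> sum c F)"
    using inv' by (elim conjE; simp)+
  have V_iff: "v \<in> V \<longleftrightarrow> pos v \<noteq> 0" if "v < n" for v
  proof
    show "v \<in> V \<Longrightarrow> pos v \<noteq> 0" using ord by (auto simp: V_def)
    assume "pos v \<noteq> 0"
    then have "pos v - 1 < i" "ord (pos v - 1) = v" using pos[OF that] by auto
    then show "v \<in> V" unfolding V_def by (metis imageI lessThan_iff)
  qed
  have Vn: "V \<subseteq> {..<n}" using ord by (auto simp: V_def)
  have "card V \<le> i" unfolding V_def using card_image_le[of "{..<i}" ord] by simp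
  then have "V \<noteq> {..<n}" using i by auto
  have "V \<noteq> {}" using i1 by (auto simp: V_def lessThan_empty_iff)
  have outgoing: "\<exists>h w. h div 2 = f \<and> h < 2 * m \<and> E h \<in> V \<and> w < n \<and> E (mate h) = w \<and> pos w = 0 \<and> best' w \<noteq> 0 \<and> ?c (best' w - 1) \<le> c f"
    if f: "f < m" "crosses E f V" for f
  proof -
    obtain h where h: "h div 2 = f" "E h \<in> V" "E (mate h) \<notin> V" using f by (auto elim: crosses_halfE)
    have hm: "h < 2 * m" using h(1) f by auto
    have w: "E (mate h) < n" using E mate_less[OF hm] by blast
    then have p0: "pos (E (mate h)) = 0" using V_iff h by blast
    have "amin ?c {k. k < 2 * m \<and> E k \<in> V \<and> E (mate k) = E (mate h)} (best' (E (mate h)))"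
      using best'[OF w] p0 by (simp add: V_def)
    moreover have "h \<in> {k. k < 2 * m \<and> E k \<in> V \<and> E (mate k) = E (mate h)}" using hm h by simp
    ultimately have "best' (E (mate h)) \<noteq> 0" "?c (best' (E (mate h)) - 1) \<le> ?c h"
      by (auto simp: amin_def split: if_splits)
    then show ?thesis using h hm w p0 by blast
  qed
  \<comment> \<open>Connectivity of the input provides a candidate, so the pointer \<open>x\<close>
    is not null.\<close>
  obtain f where "f < m" "crosses E f V" using spansD[OF sp Vn \<open>V \<noteq> {}\<close> \<open>V \<noteq> {..<n}\<close>] by auto
  then have "{w. w < n \<and> pos w = 0 \<and> best' w \<noteq> 0} \<noteq> {}" using outgoing by blast
  then have x0: "x \<noteq> 0" using x unfolding amin_def by presburger
  define w where "w = x - 1"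
  define b where "b = best' w - 1"
  have w: "w < n" "pos w = 0" "best' w \<noteq> 0"
    and wmin: "\<And>v. v < n \<Longrightarrow> pos v = 0 \<Longrightarrow> best' v \<noteq> 0 \<Longrightarrow> ?c b \<le> ?c (best' v - 1)"
    using x x0 by (simp_all add: amin_def w_def b_def)
  have "b \<in> {h. h < 2 * m \<and> E h \<in> V \<and> E (mate h) = w}"
    using best'[OF w(1)] w by (auto simp: amin_def b_def V_def)
  then have b: "b < 2 * m" "E b \<in> V" "E (mate b) = w" by auto
  have wV: "w \<notin> V" using V_iff w by blast
  have ordw: "ord k \<noteq> w" if "k < i" for k using that wV by (auto simp: V_def)
  define T where "T = {e. sel e = 1}"
  have T_iff: "t \<in> T \<longleftrightarrow> (\<exists>k. 0 < k \<and> k < i \<and> t = (best (ord k) - 1) div 2)" for t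
    using sel[of t] by (simp add: T_def)
  have T_cross: "crosses E ((best (ord k) - 1) div 2) S \<longleftrightarrow> (ord k \<in> S) \<noteq> (ord (par k) \<in> S)" if "0 < k" "k < i" for k S
    using bst[OF that] by (auto simp: crosses_half)
  have TV: "\<not> crosses E t V" if "t \<in> T" for t
  proof -
    obtain k where k: "0 < k" "k < i" "t = (best (ord k) - 1) div 2" using \<open>t \<in> T\<close> T_iff by blast
    then show ?thesis using T_cross[OF k(1,2), of V] par[OF k(1)] by (auto simp: V_def)
  qed
  \<comment> \<open>The tree found so far connects \<open>V\<close>: a cut that none of its edges
    crosses is constant along parents.\<close>
  have Vcut: "\<exists>t\<in>T. crosses E t S" if "\<exists>v\<in>V. v \<in> S" "\<exists>v\<in>V. v \<notin> S" for S
  proof (rule ccontr)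
    assume no: "\<not> ?thesis"
    have "(ord k \<in> S) = (ord 0 \<in> S)" if "k < i" for k
    proof (rule parent_constant[where par = par and i = i])
      fix k assume k: "0 < k" "k < i"
      then have "\<not> crosses E ((best (ord k) - 1) div 2) S" using no T_iff by blast
      then show "par k < k \<and> (ord k \<in> S) = (ord (par k) \<in> S)" using T_cross[OF k] par[OF k(1)] by blast
    qed fact
    then have "\<And>v. v \<in> V \<Longrightarrow> (v \<in> S) = (ord 0 \<in> S)" by (auto simp: V_def)
    then show False using that by blast
  qed
  have emin: "c (b div 2) \<le> c f" if f: "f < m" "crosses E f V" for f
    using outgoing[OF f] wmin order_trans by blast
  have ends_b: "pos (E b) - 1 < i" "ord (pos (E b) - 1) = E b"
    using pos[of "E b"] E[OF b(1)] b(2) V_iff[of "E b"] by (auto simp: less_eq_Suc_le)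
  have T': "{e. (sel(b div 2 := 1)) e = 1} = insert (b div 2) T" by (auto simp: T_def)
  have opt': "\<exists>F'. F' \<subseteq> {..<m} \<and> spans E n F' \<and> {e. (sel(b div 2 := 1)) e = 1} \<subseteq> F' \<and> sum c F' \<le> sum c F"
    if F: "F \<subseteq> {..<m}" "spans E n F" for F
  proof -
    obtain F' where F': "F' \<subseteq> {..<m}" "spans E n F'" "T \<subseteq> F'" "sum c F' \<le> sum c F"
      using opt[OF F] unfolding T_def by blast
    have "E (mate b) \<notin> V" using b wV by simp
    from prim_exchange[where V = V and T = T and c = c, OF F'(2,1,3) E Vcut TV b(1,2) this emin]
    show ?thesis unfolding T' using F'(4) by (meson order_trans)
  qed
  have bord: "best' (ord k) = best (ord k)" if "k < i" for k
    using best'[of "ord k"] ord[OF that] by simp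
  have sel': "(sel(b div 2 := 1)) e = of_bool (\<exists>k. 0 < k \<and> k < Suc i \<and> e = (best' ((ord(i := w)) k) - 1) div 2)" for e
  proof -
    have "(\<exists>k. 0 < k \<and> k < Suc i \<and> e = (best' ((ord(i := w)) k) - 1) div 2) \<longleftrightarrow>
        e = b div 2 \<or> (\<exists>k. 0 < k \<and> k < i \<and> e = (best (ord k) - 1) div 2)" (is "?L \<longleftrightarrow> ?R")
    proof
      assume ?L
      then obtain k where k: "0 < k" "k < Suc i" "e = (best' ((ord(i := w)) k) - 1) div 2" by blast
      then show ?R using bord[of k] by (cases "k = i") (auto simp: b_def)
    next
      assume ?R
      then show ?L
      proof
        assume "e = b div 2"
        then show ?L using i1 by (intro exI[of _ i]) (simp add: b_def)
      next
        assume "\<exists>k. 0 < k \<and> k < i \<and> e = (best (ord k) - 1) div 2"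
        then obtain k where "0 < k" "k < i" "e = (best (ord k) - 1) div 2" by blast
        then show ?L using bord[of k] by (intro exI[of _ k]) simp
      qed
    qed
    then show ?thesis using sel[of e] by simp
  qed
  have "prim_inv n m E c (Suc i) (pos(w := Suc i)) (ord(i := w)) best'
    (par(i := pos (E b) - 1)) (sel(b div 2 := 1))"
    unfolding prim_inv_def
  proof (intro conjI allI impI)
    fix k assume "k < Suc i"
    then show "(ord(i := w)) k < n" "(pos(w := Suc i)) ((ord(i := w)) k) = Suc k"
      using ord[of k] w ordw[of k] by (auto simp: less_Suc_eq)
  next
    fix v assume v: "v < n" "(pos(w := Suc i)) v \<noteq> 0"
    then show "(pos(w := Suc i)) v \<le> Suc i" "(ord(i := w)) ((pos(w := Suc i)) v - 1) = v"
      using pos[of v] by (auto split: if_splits)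
  next
    fix v assume v: "v < n"
    then show "best' v \<le> 2 * m" using best' by blast
    assume "(pos(w := Suc i)) v = 0"
    then have "pos v = 0" by (auto split: if_splits)
    moreover have "(ord(i := w)) ` {..<Suc i - 1} = ord ` {..<i}" by auto
    ultimately show "amin ?c {h. h < 2 * m \<and> E h \<in> (ord(i := w)) ` {..<Suc i - 1} \<and> E (mate h) = v} (best' v)"
      using best'[OF v] by simp
  next
    fix k :: nat assume "0 < k"
    then show "(par(i := pos (E b) - 1)) k < k" using par ends_b by auto
  next
    fix k assume k: "0 < k \<and> k < Suc i"
    show "best' ((ord(i := w)) k) \<noteq> 0" "E (mate (best' ((ord(i := w)) k) - 1)) = (ord(i := w)) k"
      using k w bst[of k] bord[of k] b(3) by (auto simp: less_Suc_eq b_def)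
    show "E (best' ((ord(i := w)) k) - 1) = (ord(i := w)) ((par(i := pos (E b) - 1)) k)"
      using k ends_b bst[of k] bord[of k] par[of k] by (cases "k = i") (auto simp: b_def)
  next
    show "1 \<le> Suc i" "Suc i \<le> n" using i by auto
  next
    fix e
    show "(sel(b div 2 := 1)) e = of_bool (\<exists>k. 0 < k \<and> k < Suc i \<and> e = (best' ((ord(i := w)) k) - 1) div 2)"
      by (rule sel')
  next
    fix F assume "F \<subseteq> {..<m} \<and> spans E n F"
    then show "\<exists>F'. F' \<subseteq> {..<m} \<and> spans E n F' \<and> {e. (sel(b div 2 := 1)) e = 1} \<subseteq> F' \<and> sum c F' \<le> sum c F"
      using opt' by blast
  qed
  then show ?thesis using x0 w by (auto simp: w_def b_def)
qed

context machine
begin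

definition listed :: "store \<Rightarrow> bool" where
  "listed st \<longleftrightarrow> (\<forall>h<2 * m. iv st Inp h < n) \<and> (\<forall>u. iv st Head u = prv (iv st Inp) u (2 * m)) \<and>
     (\<forall>h<2 * m. iv st Next h = prv (iv st Inp) (iv st Inp h) h)"

lemma listed_frame: "listed st \<Longrightarrow> frame A st st' \<Longrightarrow> Inp \<notin> A \<Longrightarrow> Head \<notin> A \<Longrightarrow> Next \<notin> A \<Longrightarrow> listed st'"
  by (simp add: listed_def frame_def)

text \<open>Includes the null pointer, for which strict tests read the cost of edge 0.\<close>

lemma pointer_div_less: "p \<le> 2 * m \<Longrightarrow> (p - Suc 0) div 2 < m"
  using m_pos by linarith

lemma run_basic': "pre p R st \<Longrightarrow> (\<And>st'. R st' \<Longrightarrow> R' st') \<Longrightarrow> cost p \<le> T \<Longrightarrow> run p st R' T"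
  using run_pre run_mono by blast

lemma deg_mono: "k \<le> l \<Longrightarrow> deg E u k \<le> deg E u l"
  unfolding deg_def by (rule card_mono) auto

lemma prim_scan:
  fixes st u H
  defines "E \<equiv> iv st Inp" and "c \<equiv> (\<lambda>h. rv st Cost (h div 2))"
  assumes L: "listed st" and P: "iv st P 0 = prv E u (2 * m)"
    and bound: "\<forall>w<n. iv st Best w \<le> 2 * m"
    and best: "\<forall>w<n. iv st Pos w = 0 \<longrightarrow> amin c {h. h \<in> H \<and> E (mate h) = w} (iv st Best w)"
  shows "run prim_scan st (\<lambda>st'. frame {Best, X, P} st st' \<and> rv st' = rv st \<and>
      (\<forall>w<n. iv st' Best w \<le> 2 * m \<and> (iv st Pos w \<noteq> 0 \<longrightarrow> iv st' Best w = iv st Best w) \<and>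
        (iv st Pos w = 0 \<longrightarrow> amin c {h. (h \<in> H \<or> h < 2 * m \<and> E h = u) \<and> E (mate h) = w} (iv st' Best w))))
     (6 * deg E u (2 * m) + 1)"
proof -
  \<comment> \<open>The part of the list of \<open>u\<close> that has been visited when the pointer
    is \<open>p\<close>.\<close>
  define N where "N p = {h. p \<le> h \<and> h < 2 * m \<and> E h = u}" for p
  let ?Inv = "\<lambda>st'. frame {Best, X, P} st st' \<and> rv st' = rv st \<and> iv st' P 0 \<le> 2 * m \<and>
    (iv st' P 0 \<noteq> 0 \<longrightarrow> E (iv st' P 0 - 1) = u) \<and>
    (\<forall>w<n. iv st' Best w \<le> 2 * m \<and> (iv st Pos w \<noteq> 0 \<longrightarrow> iv st' Best w = iv st Best w) \<and>
        (iv st Pos w = 0 \<longrightarrow> amin c {h. (h \<in> H \<or> h \<in> N (iv st' P 0)) \<and> E (mate h) = w} (iv st' Best w)))"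
  have E: "E h < n" if "h < 2 * m" for h using L that by (simp add: listed_def E_def)
  have N0: "N (prv E u (2 * m)) = {}" using prv_gap[of E u "2 * m"] by (auto simp: N_def)
  show ?thesis unfolding prim_scan_def
  proof (rule run_Loop[where Inv = ?Inv and \<Phi> = "\<lambda>st'. 6 * deg E u (iv st' P 0)" and T = "\<lambda>_. 5"], goal_cases)
    case 1
    show ?case using P N0 bound best prv_le[of E u "2 * m"] prv_end[of E u "2 * m"] by simp
  next
    case (3 st')
    define p where "p = iv st' P 0"
    have fr: "iv st' Inp = E" "iv st' Pos = iv st Pos" "iv st' Next = iv st Next" "rv st' = rv st"
      using 3(1) by (simp_all add: E_def frame_def)
    have p: "0 < p" "p \<le> 2 * m" "E (p - 1) = u" using 3 by (auto simp: p_def)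
    have pm: "mate (p - 1) < 2 * m" using mate_less p by simp
    have nx: "iv st Next (p - 1) = prv E u (p - 1)" using L p by (simp add: listed_def E_def)
    have Np: "N (prv E u (p - 1)) = insert (p - 1) (N p)" unfolding N_def by (rule prv_scan) (use p in auto)
    define v where "v = E (mate (p - 1))"
    have v: "v < n" using E[OF pm] by (simp add: v_def)
    define b where "b = (if iv st Pos v = 0 \<and> (iv st' Best v = 0 \<or> c (p - 1) < c (iv st' Best v - 1)) then p else iv st' Best v)"
    have new: "amin c {h. (h \<in> H \<or> h \<in> N (prv E u (p - 1))) \<and> E (mate h) = w} (if w = v then b else iv st' Best w)"
      if w: "w < n" "iv st Pos w = 0" for w
    proof -
      have old: "amin c {h. (h \<in> H \<or> h \<in> N p) \<and> E (mate h) = w} (iv st' Best w)" using 3(1) w by (simp add: p_def)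
      show ?thesis
      proof (cases "w = v")
        case True
        have "{h. (h \<in> H \<or> h \<in> N (prv E u (p - 1))) \<and> E (mate h) = w} = insert (p - 1) {h. (h \<in> H \<or> h \<in> N p) \<and> E (mate h) = w}"
          unfolding Np using True by (auto simp: v_def)
        then show ?thesis using amin_insert[OF old, of "p - 1"] True w p by (auto simp: b_def split: if_splits)
      next
        case False
        then have "{h. (h \<in> H \<or> h \<in> N (prv E u (p - 1))) \<and> E (mate h) = w} = {h. (h \<in> H \<or> h \<in> N p) \<and> E (mate h) = w}"
          unfolding Np by (auto simp: v_def)
        then show ?thesis using old False by simp
      qed
    qed
    have bb: "\<forall>w<n. iv st' Best w \<le> 2 * m" "\<forall>w<n. iv st Pos w \<noteq> 0 \<longrightarrow> iv st' Best w = iv st Best w" using 3(1) by blast+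
    have dg: "Suc (deg E u (prv E u (p - 1))) = deg E u p" using deg_prv[of E p u] p by simp
    have bnew: "b \<le> 2 * m" "iv st Pos v \<noteq> 0 \<Longrightarrow> b = iv st Best v" using bb v p by (auto simp: b_def)
    have R: "?Inv (put (put (put st' X 0 v) Best v b) P 0 (prv E u (p - 1))) \<and> 5 + 1 + 6 * deg E u (prv E u (p - 1)) \<le> 6 * deg E u p"
    proof (intro conjI allI impI)
      fix w assume w: "w < n"
      show "iv (put (put (put st' X 0 v) Best v b) P 0 (prv E u (p - 1))) Best w \<le> 2 * m"
        using bb(1) bnew w by simp
      show "iv st Pos w \<noteq> 0 \<Longrightarrow> iv (put (put (put st' X 0 v) Best v b) P 0 (prv E u (p - 1))) Best w = iv st Best w"
        using bb(2) bnew w by auto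
      assume "iv st Pos w = 0"
      then show "amin c {h. (h \<in> H \<or> h \<in> N (iv (put (put (put st' X 0 v) Best v b) P 0 (prv E u (p - 1))) P 0)) \<and> E (mate h) = w}
         (iv (put (put (put st' X 0 v) Best v b) P 0 (prv E u (p - 1))) Best w)"
        using new[of w] w by (cases "w = v") simp_all
    qed (use 3(1) dg p prv_le[of E u "p - 1"] prv_end[of E u "p - 1"] in simp_all)
    \<comment> \<open>The program leaves \<open>Best\<close> alone when the test fails, whereas
      \<open>b\<close> describes an unconditional write. Writing back the old value is no change, so
      the case distinction can move from the value to the store.\<close>
    have same: "put (put st' X 0 v) Best v (iv st' Best v) = put st' X 0 v" by (simp add: put_def fun_upd_idem)
    define R where "R st'' \<longleftrightarrow> ?Inv st'' \<and> 5 + 1 + 6 * deg E u (iv st'' P 0) \<le> 6 * deg E u (iv st' P 0)" for st''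
    have "R (put (put (put st' X 0 v) Best v b) P 0 (prv E u (p - 1)))" using R unfolding R_def by (simp add: p_def)
    then have R': "R (if iv st Pos v = 0 \<and> (iv st' Best v = 0 \<or> c (p - 1) < c (iv st' Best v - 1))
        then put (put (put st' X 0 v) Best v p) P 0 (prv E u (p - 1)) else put (put st' X 0 v) P 0 (prv E u (p - 1)))"
      using same by (auto simp: b_def split: if_splits)
    have ps: "p - Suc 0 < Suc (2 * m)" "v < Suc (2 * m)" using p v n_le_m by simp_all
    have bv: "iv st' Best v \<le> 2 * m" using bb v by simp
    show ?case
    proof (rule run_basic'[where R = R], goal_cases)
      case 1
      show ?case
        using R' fr p pm v nx ps n_le_m m_pos pointer_div_less[OF bv] pointer_div_less[OF p(2)]
        by (cases "iv st Pos v = 0"; cases "iv st' Best v = 0"; cases "c (p - 1) < c (iv st' Best v - 1)")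
          (simp_all add: p_def[symmetric] v_def[symmetric, unfolded One_nat_def] c_def)
    qed (simp_all add: R_def)
  qed (use P in \<open>auto simp: N_def intro: deg_mono prv_le\<close>)
qed

lemma prim_min:
  assumes 0: "iv st J 0 = 0" "iv st X 0 = 0" and bound: "\<forall>w<n. iv st Best w \<le> 2 * m"
  shows "run prim_min st (\<lambda>st'. frame {X, J} st st' \<and> rv st' = rv st \<and>
      amin (\<lambda>w. rv st Cost ((iv st Best w - 1) div 2)) {w. w < n \<and> iv st Pos w = 0 \<and> iv st Best w \<noteq> 0} (iv st' X 0))
     (5 * n + 1)"
proof -
  define f where "f = (\<lambda>w. rv st Cost ((iv st Best w - 1) div 2))"
  define A where "A j = {w. w < j \<and> iv st Pos w = 0 \<and> iv st Best w \<noteq> 0}" for j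
  let ?Inv = "\<lambda>st'. frame {X, J} st st' \<and> rv st' = rv st \<and> iv st' J 0 \<le> n \<and> iv st' X 0 \<le> iv st' J 0 \<and>
    amin f (A (iv st' J 0)) (iv st' X 0)"
  show ?thesis unfolding prim_min_def f_def[symmetric] A_def[symmetric]
  proof (rule run_Loop[where Inv = ?Inv and \<Phi> = "\<lambda>st'. 5 * (n - iv st' J 0)" and T = "\<lambda>_. 4"], goal_cases)
    case 1
    show ?case using 0 by (simp add: A_def)
  next
    case (3 st')
    define j where "j = iv st' J 0"
    define x where "x = iv st' X 0"
    have fr: "iv st' Best = iv st Best" "iv st' Pos = iv st Pos" "rv st' = rv st" "frame {X, J} st st'"
      using 3(1) by (simp_all add: frame_def)
    have j: "j < n" "x \<le> j" "amin f (A j) x" using 3 by (simp_all add: j_def x_def)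
    have A: "A (Suc j) = (if iv st Pos j = 0 \<and> iv st Best j \<noteq> 0 then insert j (A j) else A j)"
      by (auto simp: A_def less_Suc_eq)
    have am: "amin f (A (Suc j)) (if (iv st Pos j = 0 \<and> iv st Best j \<noteq> 0) \<and> (x = 0 \<or> f j < f (x - 1)) then Suc j else x)"
      using j(3) amin_insert[OF j(3), of j] A by (auto split: if_splits)
    have b: "iv st Best j \<le> 2 * m" "iv st Best (x - 1) \<le> 2 * m" using bound j by auto
    have xs: "x - Suc 0 < Suc (2 * m)" using j n_le_m by simp
    define R where "R st'' \<longleftrightarrow> ?Inv st'' \<and> 4 + 1 + 5 * (n - iv st'' J 0) \<le> 5 * (n - iv st' J 0)" for st''
    have R: "R (put (if (iv st Pos j = 0 \<and> iv st Best j \<noteq> 0) \<and> (x = 0 \<or> f j < f (x - 1)) then put st' X 0 (Suc j) else st') J 0 (Suc j))"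
      using am j fr by (auto simp: R_def j_def[symmetric] x_def[symmetric] split: if_splits)
    show ?case
    proof (rule run_basic'[where R = R], goal_cases)
      case 1
      show ?case
        using R j b[THEN pointer_div_less] fr n_le_m m_pos xs
        by (cases "iv st Pos j = 0"; cases "iv st Best j = 0"; cases "x = 0"; cases "f j < f (x - 1)")
          (simp_all add: j_def[symmetric] x_def[symmetric] f_def)
    qed (simp_all add: R_def)
  next
    case (4 st')
    then show ?case by (auto simp: A_def)
  qed (use 0 in auto)
qed

lemma prim_loop:
  fixes st
  defines "E \<equiv> iv st Inp" and "c \<equiv> rv st Cost"
  defines "pinv \<equiv> \<lambda>i st'. prim_inv n m E c i (iv st' Pos) (iv st' Ord) (iv st' Best) (iv st' Par) (iv st' Sel)"
  assumes L: "listed st" and inv: "pinv (iv st I 0) st" and sp: "spans E n {..<m}"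
  shows "run prim_loop st (\<lambda>st'. frame {Pos, Ord, Best, Par, Sel, I, J, P, X} st st' \<and> rv st' = rv st \<and> pinv n st')
     (12 * m + (5 * n + 11) * n + 1)"
proof -
  \<comment> \<open>Half-edges at vertices that are not among the first \<open>k\<close> in Prim's
    order. Each pays 6 steps when its list is scanned, so all scans together take
    \<open>12 * m\<close> steps although a single one may be long.\<close>
  define free where "free k st' = card {h. h < 2 * m \<and> E h \<notin> iv st' Ord ` {..<k}}" for k and st' :: store
  let ?F = "{Pos, Ord, Best, Par, Sel, I, J, P, X}"
  let ?Inv = "\<lambda>st'. frame ?F st st' \<and> rv st' = rv st \<and> pinv (iv st' I 0) st'"
  let ?T = "\<lambda>st' :: store. 6 * deg E (iv st' Ord (iv st' I 0 - 1)) (2 * m) + 5 * n + 10"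
  let ?\<Phi> = "\<lambda>st' :: store. 6 * free (iv st' I 0 - 1) st' + (5 * n + 11) * (n - iv st' I 0)"
  have E: "E h < n" if "h < 2 * m" for h using L that by (simp add: listed_def E_def)
  show ?thesis unfolding prim_loop_def
  proof (rule run_Loop[where Inv = ?Inv and \<Phi> = ?\<Phi> and T = ?T], goal_cases)
    case (3 st1)
    define i where "i = iv st1 I 0"
    define u where "u = iv st1 Ord (i - 1)"
    have fr1: "frame ?F st st1" "rv st1 = rv st" and E1: "iv st1 Inp = E" and L1: "listed st1"
      using 3(1) L by (auto simp: E_def frame_def listed_def)
    have inv1: "prim_inv n m E c i (iv st1 Pos) (iv st1 Ord) (iv st1 Best) (iv st1 Par) (iv st1 Sel)"
      using 3(1) by (simp add: pinv_def i_def)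
    note inv1' = inv1[unfolded prim_inv_def]
    have i: "1 \<le> i" "i < n" using 3(2) inv1' by (simp_all add: i_def)
    have ord: "\<And>k. k < i \<Longrightarrow> iv st1 Ord k < n \<and> iv st1 Pos (iv st1 Ord k) = Suc k"
      and bound: "\<forall>w<n. iv st1 Best w \<le> 2 * m"
      and best: "\<forall>w<n. iv st1 Pos w = 0 \<longrightarrow>
        amin (\<lambda>h. c (h div 2)) {h. h < 2 * m \<and> E h \<in> iv st1 Ord ` {..<i - 1} \<and> E (mate h) = w} (iv st1 Best w)"
      using inv1' by (elim conjE; simp)+
    have u: "u < n" using ord[of "i - 1"] i by (simp add: u_def)
    have img: "iv st1 Ord ` {..<i} = insert u (iv st1 Ord ` {..<i - 1})"
      using i lessThan_Suc[of "i - 1"] by (simp add: u_def)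
    have un: "u \<notin> iv st1 Ord ` {..<i - 1}"
    proof
      assume "u \<in> iv st1 Ord ` {..<i - 1}"
      then obtain k where "k < i - 1" "u = iv st1 Ord k" by auto
      then show False using ord[of k] ord[of "i - 1"] i by (simp add: u_def)
    qed
    have free: "free (i - 1) st1 = deg E u (2 * m) + free i st1"
    proof -
      have "{h. h < 2 * m \<and> E h \<notin> iv st1 Ord ` {..<i - 1}} =
          {h. h < 2 * m \<and> E h = u} \<union> {h. h < 2 * m \<and> E h \<notin> iv st1 Ord ` {..<i}}"
        unfolding img using un by blast
      moreover have "{h. h < 2 * m \<and> E h = u} \<inter> {h. h < 2 * m \<and> E h \<notin> iv st1 Ord ` {..<i}} = {}"
        unfolding img by blast
      ultimately show ?thesis unfolding free_def deg_def by (simp add: card_Un_disjoint)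
    qed
    have free_cong: "free i st' = free i st1" if "\<forall>k<i. iv st' Ord k = iv st1 Ord k" for st'
    proof -
      have "iv st' Ord ` {..<i} = iv st1 Ord ` {..<i}" by (rule image_cong) (use that in auto)
      then show ?thesis by (simp add: free_def)
    qed
    let ?R = "\<lambda>st'. ?Inv st' \<and> ?T st1 + 1 + ?\<Phi> st' \<le> ?\<Phi> st1"
    show ?case
    proof (rule run_pre_seq[where T' = "6 * deg E u (2 * m) + 5 * n + 9"])
      let ?st2 = "put st1 P 0 (iv st1 Head u)"
      have P2: "iv ?st2 P 0 = prv (iv ?st2 Inp) u (2 * m)" using L1 E1 by (simp add: listed_def)
      have L2: "listed ?st2" using L1 by (simp add: listed_def)
      have best2: "\<forall>w<n. iv ?st2 Pos w = 0 \<longrightarrow>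
        amin (\<lambda>h. rv ?st2 Cost (h div 2)) {h. h \<in> {h. h < 2 * m \<and> E h \<in> iv st1 Ord ` {..<i - 1}} \<and> iv ?st2 Inp (mate h) = w} (iv ?st2 Best w)"
        using best E1 fr1 by (simp add: c_def conj_assoc)
      have "run (prim_scan ;; (set_reg X (C 0) ;; set_reg J (C 0)) ;; prim_min ;; prim_extend) ?st2 ?R
         (6 * deg E u (2 * m) + 5 * n + 9)"
      proof (rule run_seq[where ?T2.0 = "5 * n + 8", OF prim_scan[OF L2 P2 _ best2]], goal_cases)
        case 1
        show ?case using bound by simp
      next
        case (2 st3)
        have fr3: "frame ?F st st3" "rv st3 = rv st" "iv st3 Inp = E"
            "iv st3 Pos = iv st1 Pos" "iv st3 Ord = iv st1 Ord" "iv st3 Par = iv st1 Par" "iv st3 Sel = iv st1 Sel" "iv st3 I 0 = i"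
          using 2 fr1 E1 by (auto simp: frame_def i_def)
        have set_eq: "{h. (h \<in> {h. h < 2 * m \<and> E h \<in> iv st1 Ord ` {..<i - 1}} \<or> h < 2 * m \<and> iv ?st2 Inp h = u) \<and> iv ?st2 Inp (mate h) = w} =
           {h. h < 2 * m \<and> E h \<in> iv st1 Ord ` {..<i} \<and> E (mate h) = w}" for w
          unfolding img using E1 by auto
        have best3: "iv st3 Best w \<le> 2 * m \<and> (iv st1 Pos w \<noteq> 0 \<longrightarrow> iv st3 Best w = iv st1 Best w) \<and>
           (iv st1 Pos w = 0 \<longrightarrow> amin (\<lambda>h. c (h div 2)) {h. h < 2 * m \<and> E h \<in> iv st1 Ord ` {..<i} \<and> E (mate h) = w} (iv st3 Best w))"
          if "w < n" for w
          using 2 that fr1(2) unfolding set_eq by (simp add: c_def)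
        show ?case
        proof (rule run_pre_seq[where T' = "5 * n + 6"])
          let ?st4 = "put (put st3 X 0 0) J 0 0"
          have "run (prim_min ;; prim_extend) ?st4 ?R (5 * n + 6)"
          proof (rule run_seq[where ?T2.0 = 5, OF prim_min], goal_cases)
            case 3
            then show ?case using best3 by simp
          next
            case (4 st5)
            define x where "x = iv st5 X 0"
            have fr5: "frame ?F st st5" "rv st5 = rv st" "iv st5 Inp = E" "iv st5 Best = iv st3 Best"
                "iv st5 Pos = iv st1 Pos" "iv st5 Ord = iv st1 Ord" "iv st5 Par = iv st1 Par" "iv st5 Sel = iv st1 Sel" "iv st5 I 0 = i"
              using 4 fr3 by (auto simp: frame_def)
            have x: "amin (\<lambda>w. c ((iv st3 Best w - 1) div 2)) {w. w < n \<and> iv st1 Pos w = 0 \<and> iv st3 Best w \<noteq> 0} x"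
              using 4 fr3 by (simp add: x_def c_def)
            note ext = prim_inv_step[OF inv1 i(2) E sp best3 x]
            have b: "iv st3 Best (x - 1) \<le> 2 * m" "x - 1 < n" using best3[of "x - 1"] ext by auto
            have eb: "E (iv st3 Best (x - 1) - 1) < n" using E[of "iv st3 Best (x - 1) - 1"] b m_pos by simp
            let ?st6 = "put (put (put (put (put st5 Ord i (x - 1)) Par i (iv st1 Pos (E (iv st3 Best (x - 1) - 1)) - 1))
               Sel ((iv st3 Best (x - 1) - 1) div 2) 1) Pos (x - 1) (Suc i)) I 0 (Suc i)"
            have "free i ?st6 = free i st1" by (rule free_cong) (simp add: fr5)
            moreover have "n - i = Suc (n - Suc i)" using i by simp
            ultimately have R: "?R ?st6"
              using ext fr5 free by (simp add: pinv_def i_def[symmetric] u_def[symmetric, unfolded One_nat_def])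
            show ?case unfolding prim_extend_def
              using R fr5 b eb i n_le_m pointer_div_less[OF b(1)]
              by (intro run_basic) (auto simp: x_def[symmetric])
          qed (use m_pos in auto)
          then show "pre (set_reg X (C 0) ;; set_reg J (C 0)) (\<lambda>st'. run (prim_min ;; prim_extend) st' ?R (5 * n + 6)) st3"
            by simp
        qed simp
      qed (use E1 in simp)
      moreover have "i - 1 < 2 * m + 1" "u < 2 * m + 1" using i u n_le_m by auto
      ultimately show "pre (set_reg P (Get Head (Get Ord (dec (reg I)))))
         (\<lambda>st'. run (prim_scan ;; (set_reg X (C 0) ;; set_reg J (C 0)) ;; prim_min ;; prim_extend) st' ?R
           (6 * deg E u (2 * m) + 5 * n + 9)) st1"
        by (simp add: i_def[symmetric] u_def[symmetric, unfolded One_nat_def])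
    qed (simp add: i_def[symmetric] u_def[symmetric, unfolded One_nat_def])
  next
    case (4 st')
    then have "iv st' I 0 = n" by (simp add: pinv_def prim_inv_def)
    then show ?case using 4 by simp
  next
    case 5
    have "free (iv st I 0 - 1) st \<le> card {..<2 * m}" unfolding free_def by (rule card_mono) auto
    then have "6 * free (iv st I 0 - 1) st \<le> 12 * m" by simp
    from add_mono[OF this mult_le_mono2[of "n - iv st I 0" n "5 * n + 11"]] show ?case by simp
  qed (use inv in auto)
qed

end

subsection \<open>Cheapest links\<close>

definition relabel_loop :: cmd where
  "relabel_loop =
     Loop (Lt (reg I) (Bin Times (C 2) VM))
      (Asg Q (reg I) (dec (Get Pos (Get Inp (reg I)))) ;;
       set_reg I (inc (reg I)))"

text \<open>Ancestors decrease along the root path, so one downward sweep meets them in order: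
  \<open>X\<close> is the next ancestor due. The sweep also clears marks left by the previous
  vertex.\<close>

definition mark_loop :: cmd where
  "mark_loop =
     Loop (Lt (C 0) (reg J))
      (set_reg J (dec (reg J)) ;;
       If (Eq (reg J) (reg X))
         (Asg Mark (reg J) (C 1) ;; set_reg X (Get Par (reg X)))
         (Asg Mark (reg J) (C 0)))"

text \<open>An upward sweep: the entry of the parent is complete before that of the child.\<close>

definition lca_loop :: cmd where
  "lca_loop =
     Loop (Lt (reg J) VN)
      (Asg Bst (reg J) (C 0) ;;
       If (Eq (Get Mark (reg J)) (C 1)) (Asg Lca (reg J) (reg J)) (Asg Lca (reg J) (Get Lca (Get Par (reg J)))) ;;
       set_reg J (inc (reg J)))"

definition link_scan :: cmd where
  "link_scan =
     Loop (Lt (C 0) (reg P))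
      (If (Eq (Get Sel (Bin Div (dec (reg P)) (C 2))) (C 0))
         (set_reg X (Get Lca (Get Q (mate_of (dec (reg P))))) ;;
          If (Disj (Eq (Get Bst (reg X)) (C 0)) (RLt (link_cost (reg P)) (link_cost (Get Bst (reg X)))))
            (Asg Bst (reg X) (reg P)) Nop)
         Nop ;;
       set_reg P (Get Next (dec (reg P))))"

text \<open>Upper ends are tried in increasing order. A link becomes the new head only if it is
  cheaper than the old one, which is a cheapest link with a smaller upper end. From the head on,
  upper ends decrease and costs increase.\<close>

definition pareto_loop :: cmd where
  "pareto_loop =
     Loop (Lt (reg J) VN)
      (If (Conj (Not (Eq (Get Bst (reg J)) (C 0)))
            (Disj (Eq (Get Cur (reg I)) (C 0)) (RLt (link_cost (Get Bst (reg J))) (link_cost (Get Cur (reg I))))))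
         (Asg Nxt (dec (Get Bst (reg J))) (Get Cur (reg I)) ;;
          Asg Top (dec (Get Bst (reg J))) (reg J) ;;
          Asg Cur (reg I) (Get Bst (reg J)))
         Nop ;;
       set_reg J (inc (reg J)))"

definition link_loop :: cmd where
  "link_loop =
     Loop (Lt (reg I) VN)
      ((set_reg X (reg I) ;; set_reg J VN) ;;
       mark_loop ;;
       set_reg J (C 0) ;;
       lca_loop ;;
       set_reg P (Get Head (Get Ord (reg I))) ;;
       link_scan ;;
       (Asg Cur (reg I) (C 0) ;; set_reg J (C 0)) ;;
       pareto_loop ;;
       set_reg I (inc (reg I)))"

lemma (in machine) relabel_loop:
  assumes E: "\<And>h. h < 2 * m \<Longrightarrow> iv st Inp h < n" and 0: "iv st I 0 = 0"
  shows "run relabel_loop st (\<lambda>st'. frame {Q, I} st st' \<and> rv st' = rv st \<and>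
      (\<forall>h<2 * m. iv st' Q h = iv st Pos (iv st Inp h) - 1)) (6 * m + 1)"
proof -
  let ?Inv = "\<lambda>st'. frame {Q, I} st st' \<and> rv st' = rv st \<and> iv st' I 0 \<le> 2 * m \<and>
      (\<forall>h<iv st' I 0. iv st' Q h = iv st Pos (iv st Inp h) - 1)"
  show ?thesis unfolding relabel_loop_def
  proof (rule run_Loop[where Inv = ?Inv and \<Phi> = "\<lambda>st'. 3 * (2 * m - iv st' I 0)" and T = "\<lambda>_. 2"], goal_cases)
    case (3 st')
    then have "iv st' Inp = iv st Inp" "iv st' Pos = iv st Pos" by (simp_all add: frame_def)
    with 3 E[of "iv st' I 0"] n_le_m show ?case
      by (intro run_basic) (auto simp: less_Suc_eq)
  qed (use 0 m_pos in auto)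
qed

section \<open>Lowest common ancestors and vertical links\<close>

context rooted_tree
begin

text \<open>Common ancestors form a chain ordered by number, so the maximum is the lowest
  one.\<close>

definition lca :: "nat \<Rightarrow> nat \<Rightarrow> nat" where
  "lca u j = Max {x. anc x u \<and> anc x j}"

definition links :: "nat \<Rightarrow> nat set" where
  "links u = {h. h < 2 * m \<and> h div 2 \<notin> tree \<and> q h = u}"

definition apex :: "nat \<Rightarrow> nat" where
  "apex h = lca (q h) (q (mate h))"

lemma lca_anc: "anc (lca u j) u" "anc (lca u j) j"
proof -
  have "finite {x. anc x u \<and> anc x j}" by (rule finite_subset[of _ "{..u}"]) (auto dest: anc_le)
  moreover have "{x. anc x u \<and> anc x j} \<noteq> {}" using anc_0 by blast
  ultimately have "lca u j \<in> {x. anc x u \<and> anc x j}" unfolding lca_def by (rule Max_in)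
  then show "anc (lca u j) u" "anc (lca u j) j" by auto
qed

lemma anc_iff_le_lca: assumes "anc x u" shows "anc x j \<longleftrightarrow> x \<le> lca u j"
proof
  have "finite {x. anc x u \<and> anc x j}" by (rule finite_subset[of _ "{..u}"]) (auto dest: anc_le)
  then show "anc x j \<Longrightarrow> x \<le> lca u j" unfolding lca_def using assms by (intro Max_ge) auto
  show "x \<le> lca u j \<Longrightarrow> anc x j"
    using anc_chain[OF lca_anc(1) assms] anc_trans[OF lca_anc(2)] by blast
qed

lemma lca_self: "anc j u \<Longrightarrow> lca u j = j"
  using anc_iff_le_lca[of j u j] anc_le[OF lca_anc(2)] by (auto intro: antisym)

text \<open>If \<open>j\<close> is not an ancestor of \<open>u\<close>, it is no common ancestor,
  and its other ancestors are those of its parent. This is the recursion behind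
  \<open>lca_loop\<close>.\<close>

lemma lca_par: assumes "\<not> anc j u" shows "0 < j" "lca u j = lca u (par j)"
proof -
  show "0 < j" using assms anc_0 by (cases "j = 0") auto
  then have "anc x u \<and> anc x j \<longleftrightarrow> anc x u \<and> anc x (par j)" for x
    using anc_par_iff[of x j] assms by (cases "x = j") auto
  then show "lca u j = lca u (par j)" by (simp add: lca_def)
qed

lemma lca_less: "u < n \<Longrightarrow> lca u j < n"
  using anc_le[OF lca_anc(1)] by (rule le_less_trans)

text \<open>Turns covering into one comparison on the root path of the lower end, which is all that
  the programs ever test.\<close>

lemma covers_iff_apex: "covers h x \<longleftrightarrow> anc x (q h) \<and> apex h < x"
  unfolding covers_def apex_def using anc_iff_le_lca[of x "q h" "q (mate h)"] by auto

end

section \<open>Construction of the sorted link lists\<close>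

locale tree_machine = machine n m S W + rooted_tree n m q par te c
  for n m S W q par te c
begin

text \<open>The adjacency lists were built for the original vertex names, so the list of
  \<open>u\<close> starts at \<open>Head (Ord u)\<close>. Half-edges keep their names, so
  \<open>Next\<close> needs no translation.\<close>

definition agrees :: "store \<Rightarrow> bool" where
  "agrees st \<longleftrightarrow> iv st Par = par \<and> (\<forall>h<2 * m. iv st Q h = q h) \<and> rv st Cost = c \<and> (\<forall>e. iv st Sel e = of_bool (e \<in> tree)) \<and>
     (\<forall>u<n. iv st Ord u < n \<and> iv st Head (iv st Ord u) = prv q u (2 * m)) \<and>
     (\<forall>h<2 * m. iv st Next h = prv q (q h) h)"

lemma agrees_frame:
  "agrees st \<Longrightarrow> frame A st st' \<Longrightarrow> rv st' Cost = rv st Cost \<Longrightarrow> A \<inter> {Par, Q, Sel, Ord, Head, Next} = {} \<Longrightarrow> agrees st'"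
  by (simp add: agrees_def frame_def)

lemma mark_loop:
  assumes par: "iv st Par = par" and u: "u < n" and 0: "iv st J 0 = n" "iv st X 0 = u"
  shows "run mark_loop st (\<lambda>st'. frame {Mark, J, X} st st' \<and> rv st' = rv st \<and>
      (\<forall>j<n. iv st' Mark j = of_bool (anc j u))) (6 * n + 1)"
proof -
  let ?Inv = "\<lambda>st'. frame {Mark, J, X} st st' \<and> rv st' = rv st \<and> iv st' J 0 \<le> n \<and>
      (\<forall>j<n. iv st' J 0 \<le> j \<longrightarrow> iv st' Mark j = of_bool (anc j u)) \<and>
      (0 < iv st' J 0 \<longrightarrow> anc (iv st' X 0) u \<and> iv st' X 0 < iv st' J 0 \<and> (\<forall>y. anc y u \<and> y < iv st' J 0 \<longrightarrow> y \<le> iv st' X 0))"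
  show ?thesis unfolding mark_loop_def
  proof (rule run_Loop[where Inv = ?Inv and \<Phi> = "\<lambda>st'. 6 * iv st' J 0" and T = "\<lambda>_. 5"], goal_cases)
    case 1
    show ?case using 0 u n_pos anc_le by auto
  next
    case (3 st')
    define j where "j = iv st' J 0 - 1"
    define x where "x = iv st' X 0"
    have J: "iv st' J 0 = Suc j" using 3(2) by (simp add: j_def)
    have fr: "frame {Mark, J, X} st st'" "rv st' = rv st" "iv st' Par = par" using 3(1) par by (simp_all add: frame_def)
    have j: "j < n" "x \<le> j" "anc x u" and mx: "\<And>y. anc y u \<Longrightarrow> y < Suc j \<Longrightarrow> y \<le> x"
      and mk: "\<And>k. k < n \<Longrightarrow> Suc j \<le> k \<Longrightarrow> iv st' Mark k = of_bool (anc k u)"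
      using 3(1) J by (simp_all add: x_def)
    define R where "R st'' \<longleftrightarrow> ?Inv st'' \<and> 5 + 1 + 6 * iv st'' J 0 \<le> 6 * iv st' J 0" for st''
    have R1: "R (put (put (put st' J 0 j) Mark j 1) X 0 (par x))" if x: "x = j"
    proof -
      have "iv (put (put (put st' J 0 j) Mark j 1) X 0 (par x)) Mark k = of_bool (anc k u)" if "k < n" "j \<le> k" for k
        using that mk[of k] j(3) x by (cases "k = j") auto
      moreover have "anc (par x) u \<and> par x < j \<and> (\<forall>y. anc y u \<and> y < j \<longrightarrow> y \<le> par x)" if j0: "0 < j"
      proof (intro conjI allI impI)
        show "anc (par x) u" using anc_trans[OF j(3), of "par x"] desc.step[of x par "par x"] x j0 by blast
        show "par x < j" using par_less x j0 by blast
        fix y assume y: "anc y u \<and> y < j"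
        then have "anc y x" using anc_chain[OF j(3), of y] x by auto
        then show "y \<le> par x" using anc_par_iff[of y x] y x anc_le by auto
      qed
      ultimately show ?thesis using fr J j by (simp add: R_def)
    qed
    have R2: "R (put (put st' J 0 j) Mark j 0)" if x: "x \<noteq> j"
    proof -
      have "\<not> anc j u" using mx[of j] j x by auto
      then have "iv (put (put st' J 0 j) Mark j 0) Mark k = of_bool (anc k u)" if "k < n" "j \<le> k" for k
        using that mk[of k] by (cases "k = j") auto
      then show ?thesis using fr J j x mx by (simp add: R_def x_def[symmetric])
    qed
    show ?case
    proof (rule run_basic'[where R = R], goal_cases)
      case 1
      show ?case using R1 R2 J j n_le_m fr by (cases "x = j") (simp_all add: x_def[symmetric])
    qed (simp_all add: R_def)
  qed (use 0 in auto)
qed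

lemma lca_loop:
  assumes par: "iv st Par = par" and 0: "iv st J 0 = 0" and mark: "\<forall>j<n. iv st Mark j = of_bool (anc j u)"
  shows "run lca_loop st (\<lambda>st'. frame {Lca, Bst, J} st st' \<and> rv st' = rv st \<and>
      (\<forall>j<n. iv st' Lca j = lca u j \<and> iv st' Bst j = 0)) (6 * n + 1)"
proof -
  let ?Inv = "\<lambda>st'. frame {Lca, Bst, J} st st' \<and> rv st' = rv st \<and> iv st' J 0 \<le> n \<and>
      (\<forall>j<iv st' J 0. iv st' Lca j = lca u j \<and> iv st' Bst j = 0)"
  show ?thesis unfolding lca_loop_def
  proof (rule run_Loop[where Inv = ?Inv and \<Phi> = "\<lambda>st'. 6 * (n - iv st' J 0)" and T = "\<lambda>_. 5"], goal_cases)
    case (3 st')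
    define j where "j = iv st' J 0"
    have fr: "frame {Lca, Bst, J} st st'" "rv st' = rv st" "iv st' Par = par" "iv st' Mark = iv st Mark"
      using 3(1) par by (simp_all add: frame_def)
    have j: "j < n" and old: "\<And>k. k < j \<Longrightarrow> iv st' Lca k = lca u k \<and> iv st' Bst k = 0" using 3 by (simp_all add: j_def)
    define R where "R st'' \<longleftrightarrow> ?Inv st'' \<and> 5 + 1 + 6 * (n - iv st'' J 0) \<le> 6 * (n - iv st' J 0)" for st''
    have R: "R (put (put (put st' Bst j 0) Lca j (lca u j)) J 0 (Suc j))"
      using fr j old unfolding R_def by (auto simp: j_def[symmetric] less_Suc_eq)
    show ?case
    proof (rule run_basic'[where R = R], goal_cases)
      case 1
      show ?case
      proof (cases "anc j u")
        case True
        then show ?thesis using R lca_self[OF True] j n_le_m fr mark by (simp add: j_def[symmetric])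
      next
        case False
        then have "iv st' Lca (par j) = lca u j" "par j < n" using lca_par[OF False] old par_less[of j] j by auto
        then show ?thesis using False R j n_le_m fr mark by (simp add: j_def[symmetric])
      qed
    qed (simp_all add: R_def)
  qed (use 0 in auto)
qed

abbreviation cc :: "nat \<Rightarrow> real" where
  "cc h \<equiv> c (h div 2)"

lemma amin_links_le:
  assumes "amin f {h. h \<in> links u \<and> B h} p"
  shows "p \<le> 2 * m"
  using assms by (auto simp: amin_def links_def split: if_splits)

lemma link_scan:
  assumes ag: "agrees st" and u: "u < n" and P: "iv st P 0 = prv q u (2 * m)"
    and L: "\<forall>j<n. iv st Lca j = lca u j" and 0: "\<forall>a<n. iv st Bst a = 0"
  shows "run link_scan st (\<lambda>st'. frame {Bst, X, P} st st' \<and> rv st' = rv st \<and>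
      (\<forall>a<n. amin cc {h. h \<in> links u \<and> apex h = a} (iv st' Bst a))) (8 * deg q u (2 * m) + 1)"
proof -
  let ?Inv = "\<lambda>st'. frame {Bst, X, P} st st' \<and> rv st' = rv st \<and> iv st' P 0 \<le> 2 * m \<and>
    (iv st' P 0 \<noteq> 0 \<longrightarrow> q (iv st' P 0 - 1) = u) \<and>
    (\<forall>a<n. amin cc {h. h \<in> links u \<and> apex h = a \<and> iv st' P 0 \<le> h} (iv st' Bst a))"
  show ?thesis unfolding link_scan_def
  proof (rule run_Loop[where Inv = ?Inv and \<Phi> = "\<lambda>st'. 8 * deg q u (iv st' P 0)" and T = "\<lambda>_. 7"], goal_cases)
    case 1
    have "amin cc {h. h \<in> links u \<and> apex h = a \<and> prv q u (2 * m) \<le> h} 0" for a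
      using prv_gap[of q u "2 * m"] by (auto simp: links_def amin_def)
    then show ?case using P 0 prv_le[of q u "2 * m"] prv_end[of q u "2 * m"] by simp
  next
    case (3 st')
    define p where "p = iv st' P 0"
    define p' where "p' = prv q u (p - 1)"
    have p: "0 < p" "p \<le> 2 * m" "q (p - 1) = u" using 3 by (simp_all add: p_def)
    have pm: "p - Suc 0 < 2 * m" "mate (p - Suc 0) < 2 * m" "(p - Suc 0) div 2 < m" using mate_less p by simp_all
    have fr: "frame {Bst, X, P} st st'" "rv st' = rv st" "rv st Cost = c"
      "iv st' Sel ((p - Suc 0) div 2) = of_bool ((p - Suc 0) div 2 \<in> tree)" "iv st' Q (mate (p - Suc 0)) = q (mate (p - Suc 0))"
      "iv st' Next (p - Suc 0) = p'" "iv st' Lca = iv st Lca"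
      using 3(1) ag pm p by (simp_all add: frame_def agrees_def p'_def)
    define v where "v = apex (p - Suc 0)"
    have lv: "iv st' Lca (q (mate (p - Suc 0))) = v" using L fr q_less[OF pm(2)] p by (simp add: v_def apex_def)
    have v: "v < n" using lca_less[OF u] p by (simp add: v_def apex_def)
    have bounds: "p - Suc 0 < Suc (2 * m)" "v < Suc (2 * m)" "q (mate (p - Suc 0)) < Suc (2 * m)"
      "p - Suc 0 < Suc (2 * m)" "(p - Suc 0) div 2 < Suc (2 * m)"
      using p v q_less[OF pm(2)] n_le_m by simp_all
    have old: "\<And>a. a < n \<Longrightarrow> amin cc {h. h \<in> links u \<and> apex h = a \<and> p \<le> h} (iv st' Bst a)" using 3(1) by (simp add: p_def)
    have bs: "(iv st' Bst v - Suc 0) div 2 < m" using amin_links_le[OF old[OF v]] by (rule pointer_div_less)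
    have scan: "h \<in> links u \<and> p' \<le> h \<longleftrightarrow> h \<in> links u \<and> (h = p - 1 \<or> p \<le> h)" for h
      using prv_scan[of q p u "2 * m"] p unfolding p'_def links_def by blast
    have p': "p' \<le> 2 * m" "p' \<noteq> 0 \<Longrightarrow> q (p' - 1) = u"
      using prv_le[of q u "p - 1"] prv_end[of q u "p - 1"] p by (simp_all add: p'_def)
    have dg: "Suc (deg q u p') = deg q u p" using deg_prv[of q p u] p by (simp add: p'_def)
    define R where "R st'' \<longleftrightarrow> ?Inv st'' \<and> 7 + 1 + 8 * deg q u (iv st'' P 0) \<le> 8 * deg q u (iv st' P 0)" for st''
    have Rt: "R (put st' P 0 p')" if t: "(p - Suc 0) div 2 \<in> tree"
    proof -
      have "p - 1 \<notin> links u" using t by (simp add: links_def)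
      then have "h \<in> links u \<and> apex h = a \<and> p' \<le> h \<longleftrightarrow> h \<in> links u \<and> apex h = a \<and> p \<le> h" for a h
        using scan[of h] by (cases "h = p - 1") auto
      then show ?thesis using old fr p' dg by (simp add: R_def p_def[symmetric])
    qed
    have Rl: "R (put (if iv st' Bst v = 0 \<or> cc (p - Suc 0) < cc (iv st' Bst v - Suc 0) then put (put st' X 0 v) Bst v p else put st' X 0 v) P 0 p')"
      (is "R (put ?st1 P 0 p')") if t: "(p - Suc 0) div 2 \<notin> tree"
    proof -
      have l: "p - 1 \<in> links u" using t p by (simp add: links_def)
      have "amin cc {h. h \<in> links u \<and> apex h = a \<and> p' \<le> h} (iv ?st1 Bst a)" if a: "a < n" for a
      proof (cases "a = v")
        case True
        have "{h. h \<in> links u \<and> apex h = a \<and> p' \<le> h} = insert (p - 1) {h. h \<in> links u \<and> apex h = a \<and> p \<le> h}"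
          using l scan True by (auto simp: v_def)
        then show ?thesis using amin_insert[OF old[OF a], of "p - 1"] True p by (auto split: if_splits)
      next
        case False
        then have "h \<in> links u \<and> apex h = a \<and> p' \<le> h \<longleftrightarrow> h \<in> links u \<and> apex h = a \<and> p \<le> h" for h
          using scan[of h] by (cases "h = p - 1") (auto simp: v_def)
        then show ?thesis using old[OF a] False by simp
      qed
      then show ?thesis using fr p' dg by (simp add: R_def p_def[symmetric])
    qed
    show ?case
    proof (rule run_basic'[where R = R], goal_cases)
      case 1
      show ?case
      proof (cases "(p - Suc 0) div 2 \<in> tree")
        case True
        then show ?thesis using Rt fr pm bounds p by (simp add: p_def[symmetric])
      next
        case False
        then show ?thesis using Rl[OF False] fr pm bounds p lv bs
          by (cases "iv st' Bst v = 0"; cases "cc (p - Suc 0) < cc (iv st' Bst v - Suc 0)") (simp_all add: p_def[symmetric])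
      qed
    qed (simp_all add: R_def)
  qed (use P in \<open>auto intro: deg_mono prv_le\<close>)
qed

text \<open>
  \<open>L\<close> contains the elements of all lists. The rest of a list is the list that remains if only
  the links with an upper end above that of its head are considered.
\<close>

definition chain :: "(nat \<Rightarrow> nat) \<Rightarrow> (nat \<Rightarrow> nat) \<Rightarrow> nat set \<Rightarrow> bool" where
  "chain nxt tp L \<longleftrightarrow> (\<forall>h\<in>L. h < 2 * m \<and> tp h = apex h \<and>
     amin cc {k. k \<in> links (q h) \<and> apex k < apex h} (nxt h) \<and> (nxt h \<noteq> 0 \<longrightarrow> nxt h - 1 \<in> L))"

lemma amin_union:
  assumes "amin f A p" "amin f B b"
  shows "amin f (A \<union> B) (if b \<noteq> 0 \<and> (p = 0 \<or> f (b - 1) < f (p - 1)) then b else p)"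
  using assms by (fastforce simp: amin_def split: if_splits)

lemma pareto_loop:
  assumes cost: "rv st Cost = c" and u: "u < n" and 0: "iv st I 0 = u" "iv st J 0 = 0" "iv st Cur u = 0"
    and ch: "chain (iv st Nxt) (iv st Top) L" "\<forall>h\<in>L. q h < u"
    and bst: "\<forall>a<n. amin cc {h. h \<in> links u \<and> apex h = a} (iv st Bst a)"
  shows "run pareto_loop st (\<lambda>st'. frame {Nxt, Top, Cur, J} st st' \<and> rv st' = rv st \<and>
     (\<forall>w. w \<noteq> u \<longrightarrow> iv st' Cur w = iv st Cur w) \<and>
     (\<exists>L'. L \<subseteq> L' \<and> chain (iv st' Nxt) (iv st' Top) L' \<and> (\<forall>h\<in>L'. q h \<le> u) \<and> amin cc (links u) (iv st' Cur u) \<and>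
        (iv st' Cur u \<noteq> 0 \<longrightarrow> iv st' Cur u - 1 \<in> L'))) (7 * n + 1)"
proof -
  define G where "G L' st' \<longleftrightarrow> L \<subseteq> L' \<and> chain (iv st' Nxt) (iv st' Top) L' \<and> (\<forall>h\<in>L'. q h \<le> u \<and> (q h = u \<longrightarrow> apex h < iv st' J 0)) \<and>
        (iv st' Cur u \<noteq> 0 \<longrightarrow> iv st' Cur u - 1 \<in> L')" for L' and st' :: store
  let ?Inv = "\<lambda>st'. frame {Nxt, Top, Cur, J} st st' \<and> rv st' = rv st \<and> iv st' J 0 \<le> n \<and>
     (\<forall>w. w \<noteq> u \<longrightarrow> iv st' Cur w = iv st Cur w) \<and> amin cc {h. h \<in> links u \<and> apex h < iv st' J 0} (iv st' Cur u) \<and> (\<exists>L'. G L' st')"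
  show ?thesis unfolding pareto_loop_def
  proof (rule run_Loop[where Inv = ?Inv and \<Phi> = "\<lambda>st'. 7 * (n - iv st' J 0)" and T = "\<lambda>_. 6"], goal_cases)
    case 1
    have "G L st" using ch 0 by (fastforce simp: G_def)
    then show ?case using 0 by auto
  next
    case (3 st')
    define j where "j = iv st' J 0"
    define b where "b = iv st Bst j"
    define p where "p = iv st' Cur u"
    have fr: "frame {Nxt, Top, Cur, J} st st'" "rv st' = rv st" "iv st' Bst j = b" "iv st' I 0 = u"
      using 3(1) 0 by (simp_all add: frame_def b_def)
    have j: "j < n" using 3(2) by (simp add: j_def)
    have am: "amin cc {h. h \<in> links u \<and> apex h < j} p" using 3(1) by (simp add: j_def p_def)
    have ab: "amin cc {h. h \<in> links u \<and> apex h = j} b" using bst j by (simp add: b_def)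
    have pb: "p \<le> 2 * m" "b \<le> 2 * m" using amin_links_le[OF am] amin_links_le[OF ab] .
    have bounds: "b - Suc 0 < Suc (2 * m)" "u < Suc (2 * m)" "j < Suc (2 * m)" "(p - Suc 0) div 2 < m" "(b - Suc 0) div 2 < m"
      using pb[THEN pointer_div_less] u j n_le_m pb by simp_all
    obtain L' where G: "G L' st'" using 3(1) by blast
    have un: "{h. h \<in> links u \<and> apex h < Suc j} = {h. h \<in> links u \<and> apex h < j} \<union> {h. h \<in> links u \<and> apex h = j}" by auto
    note am' = amin_union[OF am ab, folded un]
    define R where "R st'' \<longleftrightarrow> ?Inv st'' \<and> 6 + 1 + 7 * (n - iv st'' J 0) \<le> 7 * (n - iv st' J 0)" for st''
    have R1: "R (put (put (put (put st' Nxt (b - Suc 0) p) Top (b - Suc 0) j) Cur u b) J 0 (Suc j))"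
      (is "R ?st1") if b: "b \<noteq> 0" "p = 0 \<or> cc (b - Suc 0) < cc (p - Suc 0)"
    proof -
      have bl: "b - Suc 0 \<in> links u" "apex (b - Suc 0) = j" using ab b by (simp_all add: amin_def)
      \<comment> \<open>The cells of the new link are fresh: listed links that start in
        \<open>u\<close> have upper ends below \<open>j\<close>. So the existing lists stay
        intact.\<close>
      then have bn: "b - Suc 0 \<notin> L'" using G by (auto simp: G_def links_def j_def)
      have "chain (iv ?st1 Nxt) (iv ?st1 Top) (insert (b - Suc 0) L')"
        unfolding chain_def
      proof (rule ballI)
        fix h assume h: "h \<in> insert (b - Suc 0) L'"
        show "h < 2 * m \<and> iv ?st1 Top h = apex h \<and> amin cc {k. k \<in> links (q h) \<and> apex k < apex h} (iv ?st1 Nxt h) \<and>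
          (iv ?st1 Nxt h \<noteq> 0 \<longrightarrow> iv ?st1 Nxt h - 1 \<in> insert (b - Suc 0) L')"
        proof (cases "h = b - Suc 0")
          case True
          then show ?thesis using bl am G by (auto simp: G_def links_def p_def)
        next
          case False
          then have "h \<in> L'" using h by simp
          moreover have "chain (iv st' Nxt) (iv st' Top) L'" using G by (simp add: G_def)
          ultimately show ?thesis using False by (simp add: chain_def)
        qed
      qed
      then have "G (insert (b - Suc 0) L') ?st1"
        using G bl by (auto simp: G_def links_def j_def[symmetric] less_Suc_eq)
      then have "\<exists>L'. G L' ?st1" by blast
      moreover have "amin cc {h. h \<in> links u \<and> apex h < Suc j} b" using am' b by simp
      ultimately show ?thesis using fr j 3(1) by (simp add: R_def j_def[symmetric])
    qed
    have R2: "R (put st' J 0 (Suc j))" if b: "\<not> (b \<noteq> 0 \<and> (p = 0 \<or> cc (b - Suc 0) < cc (p - Suc 0)))"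
    proof -
      have "G L' (put st' J 0 (Suc j))" using G by (auto simp: G_def j_def[symmetric] less_Suc_eq)
      then have "\<exists>L'. G L' (put st' J 0 (Suc j))" by blast
      moreover have "amin cc {h. h \<in> links u \<and> apex h < Suc j} p" using am' b by (simp split: if_splits)
      ultimately show ?thesis using fr j 3(1) by (simp add: R_def j_def[symmetric] p_def[symmetric])
    qed
    show ?case
    proof (rule run_basic'[where R = R], goal_cases)
      case 1
      show ?case using R1 R2 fr bounds j cost
        by (cases "b = 0"; cases "p = 0"; cases "cc (b - Suc 0) < cc (p - Suc 0)")
          (simp_all add: j_def[symmetric] p_def[symmetric])
    qed (simp_all add: R_def)
  next
    case (4 st')
    then have J: "iv st' J 0 = n" by simp
    have "{h. h \<in> links u \<and> apex h < n} = links u" using lca_less[OF u] by (auto simp: links_def apex_def)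
    then show ?case using 4(1) J by (auto simp: G_def)
  qed (use 0 in auto)
qed

lemma link_loop:
  assumes ag: "agrees st" and 0: "iv st I 0 = 0"
  shows "run link_loop st (\<lambda>st'. frame {Mark, Lca, Bst, Cur, Nxt, Top, I, J, P, X} st st' \<and> rv st' = rv st \<and>
     (\<exists>L. chain (iv st' Nxt) (iv st' Top) L \<and>
       (\<forall>u<n. amin cc (links u) (iv st' Cur u) \<and> (iv st' Cur u \<noteq> 0 \<longrightarrow> iv st' Cur u - 1 \<in> L))))
     (16 * m + (19 * n + 12) * n + 1)"
proof -
  let ?F = "{Mark, Lca, Bst, Cur, Nxt, Top, I, J, P, X}"
  define G where "G L st' \<longleftrightarrow> chain (iv st' Nxt) (iv st' Top) L \<and> (\<forall>h\<in>L. q h < iv st' I 0) \<and>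
       (\<forall>u<iv st' I 0. amin cc (links u) (iv st' Cur u) \<and> (iv st' Cur u \<noteq> 0 \<longrightarrow> iv st' Cur u - 1 \<in> L))" for L and st' :: store
  \<comment> \<open>Amortizes the scans over the iterations; every half-edge pays 8 steps
    once.\<close>
  define free where "free k = card {h. h < 2 * m \<and> k \<le> q h}" for k
  let ?Inv = "\<lambda>st'. frame ?F st st' \<and> rv st' = rv st \<and> iv st' I 0 \<le> n \<and> (\<exists>L. G L st')"
  let ?T = "\<lambda>st' :: store. 8 * deg q (iv st' I 0) (2 * m) + 19 * n + 11"
  let ?\<Phi> = "\<lambda>st' :: store. 8 * free (iv st' I 0) + (19 * n + 12) * (n - iv st' I 0)"
  show ?thesis unfolding link_loop_def
  proof (rule run_Loop[where Inv = ?Inv and \<Phi> = ?\<Phi> and T = ?T], goal_cases)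
    case 1
    have "G {} st" using 0 by (simp add: G_def chain_def)
    then show ?case using 0 by auto
  next
    case (3 st1)
    define u where "u = iv st1 I 0"
    obtain L where L: "G L st1" using 3(1) by blast
    have u: "u < n" "u < Suc (2 * m)" using 3(2) n_le_m by (simp_all add: u_def)
    have fr1: "frame ?F st st1" "rv st1 = rv st" using 3(1) by simp_all
    have free: "free u = deg q u (2 * m) + free (Suc u)"
    proof -
      have "{h. h < 2 * m \<and> u \<le> q h} = {h. h < 2 * m \<and> q h = u} \<union> {h. h < 2 * m \<and> Suc u \<le> q h}" by auto
      moreover have "{h. h < 2 * m \<and> q h = u} \<inter> {h. h < 2 * m \<and> Suc u \<le> q h} = {}" by auto
      ultimately show ?thesis unfolding free_def deg_def by (simp add: card_Un_disjoint)
    qed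
    define R where "R st' \<longleftrightarrow> ?Inv st' \<and> ?T st1 + 1 + ?\<Phi> st' \<le> ?\<Phi> st1" for st'
    \<comment> \<open>Holds up to the pareto loop of an iteration: only scratch arrays differ from
      \<open>st1\<close>, so the lists of earlier vertices are still valid.\<close>
    define M where "M st' \<longleftrightarrow> frame ?F st st' \<and> frame {Mark, Lca, Bst, J, P, X} st1 st' \<and> rv st' = rv st" for st'
    have M: "agrees st'" "iv st' I 0 = u" "iv st' Cur = iv st1 Cur" "iv st' Nxt = iv st1 Nxt" "iv st' Top = iv st1 Top" if "M st'" for st'
      using that agrees_frame[OF ag, of ?F st'] by (simp_all add: M_def frame_def u_def)
    have M1: "M st1" using fr1 by (simp add: M_def)
    have M_put: "M (put st' a i x)" if "M st'" "a \<in> {Mark, Lca, Bst, J, P, X}" for st' a i x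
      using that by (auto simp: M_def)
    have M_frame: "M st''" if "M st'" "frame A st' st''" "rv st'' = rv st'" "A \<subseteq> {Mark, Lca, Bst, J, P, X}" for A st' st''
      using that by (auto simp: M_def frame_def subset_iff)
    \<comment> \<open>The iteration is verified backwards; each of the four facts is the
      continuation that the next one needs.\<close>
    have step4: "run (pareto_loop ;; set_reg I (inc (reg I))) (put (put st' Cur u 0) J 0 0) R (7 * n + 2)"
      if "M st'" and bst: "\<forall>a<n. amin cc {h. h \<in> links u \<and> apex h = a} (iv st' Bst a)" for st'
    proof (rule run_seq[where ?T2.0 = 1, OF pareto_loop[where u = u and L = L]], goal_cases)
      case (9 st2)
      then have fr2: "frame {Nxt, Top, Cur, J} (put (put st' Cur u 0) J 0 0) st2" "rv st2 = rv st"
        using that by (simp_all add: M_def)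
      have fr3: "frame ?F st st2" "iv st2 I 0 = u"
        using fr2 that M(2)[OF that(1)] by (auto simp: M_def frame_def)
      from 9 obtain L' where L': "L \<subseteq> L'" "chain (iv st2 Nxt) (iv st2 Top) L'" "\<forall>h\<in>L'. q h \<le> u"
         "amin cc (links u) (iv st2 Cur u)" "iv st2 Cur u \<noteq> 0 \<longrightarrow> iv st2 Cur u - 1 \<in> L'" by blast
      have cur: "iv st2 Cur w = iv st1 Cur w" if "w \<noteq> u" for w
        using 9 that M(3)[OF \<open>M st'\<close>] by simp
      have "amin cc (links w) (iv st2 Cur w) \<and> (iv st2 Cur w \<noteq> 0 \<longrightarrow> iv st2 Cur w - 1 \<in> L')" if "w < Suc u" for w
      proof (cases "w = u")
        case False
        then show ?thesis using cur[of w] that L L'(1) by (auto simp: G_def u_def)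
      qed (use L' in simp)
      then have "G L' (put st2 I 0 (Suc u))" using L' by (auto simp: G_def less_Suc_eq_le)
      then have "\<exists>L. G L (put st2 I 0 (Suc u))" by blast
      moreover have "n - u = Suc (n - Suc u)" using u by simp
      ultimately have "R (put st2 I 0 (Suc u))"
        using fr2 fr3 u free by (simp add: R_def u_def[symmetric])
      then show ?case using fr3 u n_le_m by (intro run_basic) simp_all
    qed (use M[OF that(1)] u L bst in \<open>simp_all add: G_def agrees_def u_def\<close>)
    have step3: "run (link_scan ;; (Asg Cur (reg I) (C 0) ;; set_reg J (C 0)) ;; pareto_loop ;; set_reg I (inc (reg I)))
        (put st' P 0 (prv q u (2 * m))) R (8 * deg q u (2 * m) + 7 * n + 5)"
      if "M st'" and "\<forall>j<n. iv st' Lca j = lca u j \<and> iv st' Bst j = 0" for st'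
    proof (rule run_seq[where ?T2.0 = "7 * n + 4", OF link_scan[where u = u]], goal_cases)
      case (6 st2)
      then have "M st2" using that M_frame[OF M_put[OF that(1), of P 0 "prv q u (2 * m)"], where A = "{Bst, X, P}"] by simp
      then show ?case
        using step4[of st2] 6 M(2)[of st2] u by (intro run_pre_seq[where T' = "7 * n + 2"]) simp_all
    qed (use M(1)[OF M_put[OF that(1), of P]] that u in simp_all)
    have step2: "run (lca_loop ;; set_reg P (Get Head (Get Ord (reg I))) ;; link_scan ;;
        (Asg Cur (reg I) (C 0) ;; set_reg J (C 0)) ;; pareto_loop ;; set_reg I (inc (reg I)))
        (put st' J 0 0) R (8 * deg q u (2 * m) + 13 * n + 7)"
      if "M st'" and "\<forall>j<n. iv st' Mark j = of_bool (anc j u)" for st'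
    proof (rule run_seq[where ?T2.0 = "8 * deg q u (2 * m) + 7 * n + 6", OF lca_loop[where u = u]], goal_cases)
      case (4 st2)
      then have M2: "M st2" using that M_frame[OF M_put[OF that(1), of J 0 0], where A = "{Lca, Bst, J}"] by simp
      then have "iv st2 Head (iv st2 Ord u) = prv q u (2 * m)" "iv st2 Ord u < Suc (2 * m)"
        using M(1)[OF M2] u n_le_m by (auto simp: agrees_def intro: less_le_trans)
      then show ?case
        using step3[OF M2] 4 M(2)[OF M2] u
        by (intro run_pre_seq[where T' = "8 * deg q u (2 * m) + 7 * n + 5"]) simp_all
    qed (use M(1)[OF M_put[OF that(1), of J]] that u in \<open>simp_all add: agrees_def\<close>)
    have step1: "run (mark_loop ;; set_reg J (C 0) ;; lca_loop ;; set_reg P (Get Head (Get Ord (reg I))) ;; link_scan ;;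
        (Asg Cur (reg I) (C 0) ;; set_reg J (C 0)) ;; pareto_loop ;; set_reg I (inc (reg I)))
        (put (put st1 X 0 u) J 0 n) R (8 * deg q u (2 * m) + 19 * n + 9)"
    proof (rule run_seq[where ?T2.0 = "8 * deg q u (2 * m) + 13 * n + 8", OF mark_loop[where u = u]], goal_cases)
      case (5 st2)
      then have M2: "M st2" using M_frame[OF M_put[OF M_put[OF M1, of X 0 u], of J 0 n], where A = "{Mark, J, X}"] by simp
      show ?case
        using step2[OF M2] 5 by (intro run_pre_seq[where T' = "8 * deg q u (2 * m) + 13 * n + 7"]) simp_all
    qed (use M(1)[OF M1] u in \<open>simp_all add: agrees_def\<close>)
    show ?case
      by (rule run_mono[where R = R and T = "8 * deg q u (2 * m) + 19 * n + 11"], rule run_pre_seq[where T' = "8 * deg q u (2 * m) + 19 * n + 9"])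
        (use step1 u in \<open>simp_all add: R_def u_def[symmetric]\<close>)
  next
    case (4 st')
    then have "iv st' I 0 = n" by simp
    then show ?case using 4(1) by (auto simp: G_def)
  next
    case 5
    have "free 0 \<le> card {..<2 * m}" unfolding free_def by (rule card_mono) auto
    then show ?case using 0 by simp
  qed auto
qed

end

subsection \<open>The bottom-up phase\<close>

definition mark_path :: "ivar \<Rightarrow> cmd" where
  "mark_path a =
     Loop (Lt (Get Top (dec (Get Ch (reg I)))) (reg X))
      (Asg a (reg X) (C 1) ;; set_reg X (Get Par (reg X)))"

text \<open>Started with \<open>J\<close> equal to \<open>I\<close>: descendants have larger
  numbers, and the entries below \<open>I\<close> are still 0 because \<open>I\<close> only
  decreases.\<close>

definition sub_loop :: cmd where
  "sub_loop =
     Loop (Lt (reg J) VN)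
      (If (Eq (reg J) (reg I)) (Asg Sub (reg J) (C 1)) (Asg Sub (reg J) (Get Sub (Get Par (reg J)))) ;;
       set_reg J (inc (reg J)))"

definition advance_loop :: cmd where
  "advance_loop =
     Loop (Lt (reg J) VN)
      (If (Conj (Eq (Get Sub (reg J)) (C 1))
            (Conj (Not (Eq (Get Cur (reg J)) (C 0))) (Eq (Get Top (dec (Get Cur (reg J)))) (reg I))))
         (Asg Cur (reg J) (Get Nxt (dec (Get Cur (reg J))))) Nop ;;
       set_reg J (inc (reg J)))"

abbreviation "slack u \<equiv> RSub (link_cost (Get Cur u)) (RGet Ysum u)"

definition choose_loop :: cmd where
  "choose_loop =
     Loop (Lt (reg J) VN)
      (If (Conj (Eq (Get Sub (reg J)) (C 1))
            (Conj (Not (Eq (Get Cur (reg J)) (C 0)))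
              (Disj (Eq (reg X) (C 0)) (RLt (slack (reg J)) (slack (dec (reg X)))))))
         (set_reg X (inc (reg J))) Nop ;;
       set_reg J (inc (reg J)))"

definition raise_loop :: cmd where
  "raise_loop =
     Loop (Lt (reg J) VN)
      (If (Eq (Get Sub (reg J)) (C 1))
         (RAsg Ysum (reg J) (RAdd (RGet Ysum (reg J)) (RGet Dual (reg I)))) Nop ;;
       set_reg J (inc (reg J)))"

definition dual_loop :: cmd where
  "dual_loop =
     Loop (Lt (C 1) (reg I))
      ((set_reg I (dec (reg I)) ;; set_reg J (reg I)) ;;
       sub_loop ;;
       set_reg J (reg I) ;;
       advance_loop ;;
       (set_reg J (reg I) ;; set_reg X (C 0)) ;;
       choose_loop ;;
       If (Eq (Get Cov (reg I)) (C 0))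
         ((Asg Ch (reg I) (Get Cur (dec (reg X))) ;;
           RAsg Dual (reg I) (slack (dec (reg X))) ;;
           set_reg J (reg I)) ;;
          raise_loop ;;
          set_reg X (Get Q (dec (Get Ch (reg I)))) ;;
          mark_path Cov)
         Nop)"

context rooted_tree
begin

text \<open>For an ancestor \<open>b\<close> of \<open>u\<close> these are the links from
  \<open>u\<close> that cover \<open>b\<close>. The form with all \<open>x \<ge> b\<close> also
  makes sense for other \<open>b\<close>, and then nothing changes when \<open>b\<close> is
  passed.\<close>

definition avail :: "nat \<Rightarrow> nat \<Rightarrow> nat set" where
  "avail u b = {h. h \<in> links u \<and> (\<forall>x\<ge>b. anc x u \<longrightarrow> covers h x)}"

lemma not_anc_less: "u < v \<Longrightarrow> \<not> anc v u"
  using anc_le by (auto simp: not_le[symmetric])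

lemma avail_anc:
  assumes "anc v u"
  shows "avail u v = {h. h \<in> links u \<and> covers h v}"
  using assms covers_up by (auto simp: avail_def links_def)

lemma avail_not_anc:
  assumes "\<not> anc v u"
  shows "avail u v = avail u (Suc v)"
proof -
  have "v \<le> x \<longleftrightarrow> x = v \<or> Suc v \<le> x" for x by auto
  then show ?thesis using assms by (auto simp: avail_def)
qed

lemma sum_update:
  fixes y :: "nat \<Rightarrow> real"
  assumes "v < n" "y v = 0"
  shows "(\<Sum>x | x < n \<and> A x. (y(v := d)) x) = (\<Sum>x | x < n \<and> A x. y x) + (if A v then d else 0)"
proof -
  have "(\<Sum>x | x < n \<and> A x. (y(v := d)) x) = (\<Sum>x | x < n \<and> A x. y x + (if x = v then d else 0))"
    by (rule sum.cong) (use assms in auto)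
  also have "\<dots> = (\<Sum>x | x < n \<and> A x. y x) + (\<Sum>x | x < n \<and> A x. if x = v then d else 0)"
    by (rule sum.distrib)
  also have "(\<Sum>x | x < n \<and> A x. if x = v then d else 0) = (if A v then d else 0)"
    using assms by (subst sum.delta) auto
  finally show ?thesis .
qed

end

text \<open>The state of the bottom-up phase when exactly the vertices from \<open>b\<close> on have been processed.\<close>

locale dual_state = rooted_tree n m q par te c
  for n m q par te c +
  fixes b :: nat and ch :: "nat \<Rightarrow> nat" and y ys :: "nat \<Rightarrow> real" and cov :: "nat \<Rightarrow> nat"
  assumes y_nonneg: "\<And>x. 0 \<le> y x"
    and unprocessed: "\<And>x. x < b \<Longrightarrow> y x = 0 \<and> ch x = 0"
    and y_feasible: "\<And>h. h < 2 * m \<Longrightarrow> h div 2 \<notin> tree \<Longrightarrow> (\<Sum>x | x < n \<and> covers h x. y x) \<le> c (h div 2)"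
    and ys_sum: "\<And>u. u < n \<Longrightarrow> ys u = (\<Sum>x | x < n \<and> anc x u. y x)"
    and ch_link: "\<And>v. v < n \<Longrightarrow> ch v \<noteq> 0 \<Longrightarrow> ch v - 1 < 2 * m \<and> (ch v - 1) div 2 \<notin> tree \<and>
      covers (ch v - 1) v \<and> c ((ch v - 1) div 2) = (\<Sum>x | x < n \<and> covers (ch v - 1) x. y x)"
    and ch_uncovered: "\<And>v w. v < w \<Longrightarrow> w < n \<Longrightarrow> ch v \<noteq> 0 \<Longrightarrow> ch w \<noteq> 0 \<Longrightarrow> \<not> covers (ch w - 1) v"
    and ch_0: "\<And>v. b \<le> v \<Longrightarrow> v < n \<Longrightarrow> ch v = 0 \<Longrightarrow> y v = 0 \<and> (\<exists>w. v < w \<and> w < n \<and> ch w \<noteq> 0 \<and> covers (ch w - 1) v)"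
    and cov_iff: "\<And>x. x < n \<Longrightarrow> cov x = of_bool (\<exists>w<n. ch w \<noteq> 0 \<and> covers (ch w - 1) x)"
begin

lemma chosen_links: "b \<le> 1 \<Longrightarrow> chosen_links n m q par te c ch y"
  by unfold_locales (use y_nonneg y_feasible ch_link ch_uncovered ch_0 in simp_all)

text \<open>The dual variable of \<open>v\<close> stays 0. Its covering link was chosen for some
  \<open>w > v\<close>, as no unprocessed vertex has a chosen link.\<close>

lemma covered:
  assumes b: "b = Suc v" and v: "v < n" and cov: "cov v \<noteq> 0"
  shows "dual_state n m q par te c v ch y ys cov"
proof unfold_locales
  fix k assume k: "v \<le> k" "k < n" "ch k = 0"
  show "y k = 0 \<and> (\<exists>w. k < w \<and> w < n \<and> ch w \<noteq> 0 \<and> covers (ch w - 1) k)"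
  proof (cases "k = v")
    case True
    obtain w where w: "w < n" "ch w \<noteq> 0" "covers (ch w - 1) v"
      using cov_iff[OF v] cov by (auto split: if_splits)
    moreover have "v < w" using unprocessed[of w] w b by (cases "v < w") auto
    ultimately show ?thesis using unprocessed[of v] b True by auto
  next
    case False
    then show ?thesis using ch_0[of k] k b by simp
  qed
qed (use y_nonneg unprocessed y_feasible ys_sum ch_link ch_uncovered cov_iff b in \<open>simp_all add: less_SucI\<close>)

context
  fixes v x :: nat and cur :: "nat \<Rightarrow> nat"
  assumes b: "b = Suc v" and v: "0 < v" "v < n" and cov: "cov v = 0"
    and cur: "\<And>u. u < n \<Longrightarrow> amin (\<lambda>h. c (h div 2)) (avail u v) (cur u)"
    and sp: "spans2 q n {..<m}"
    and x: "amin (\<lambda>u. c ((cur u - 1) div 2) - ys u) {u. u < n \<and> anc v u \<and> cur u \<noteq> 0} x"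
begin

text \<open>Ancestors of \<open>q h\<close> that the link does not cover lie above \<open>v\<close>,
  where \<open>y\<close> is still 0. So the load of the link is the sum over the whole root
  path.\<close>

lemma link_sum:
  assumes "h < 2 * m" "covers h v"
  shows "(\<Sum>x | x < n \<and> covers h x. y x) = ys (q h)"
proof -
  have "(\<Sum>x | x < n \<and> covers h x. y x) = (\<Sum>x | x < n \<and> anc x (q h). y x)"
  proof (rule sum.mono_neutral_left)
    show "\<forall>x\<in>{x. x < n \<and> anc x (q h)} - {x. x < n \<and> covers h x}. y x = 0"
    proof
      fix x assume "x \<in> {x. x < n \<and> anc x (q h)} - {x. x < n \<and> covers h x}"
      then have "x < v" using covers_up[OF assms(2), of x] by (cases "x < v") auto
      then show "y x = 0" using unprocessed[of x] b by simp
    qed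
  qed (auto simp: covers_def)
  then show ?thesis using ys_sum q_less[OF assms(1)] by simp
qed

lemma cheapest:
  assumes "h < 2 * m" "h div 2 \<notin> tree" "covers h v"
  shows "cur (q h) \<noteq> 0 \<and> c ((cur (q h) - 1) div 2) \<le> c (h div 2)"
proof -
  have "anc v (q h)" using assms by (simp add: covers_def)
  then have "h \<in> avail (q h) v" using assms by (simp add: avail_anc links_def)
  then show ?thesis using cur[OF q_less[OF assms(1)]] by (auto simp: amin_def split: if_splits)
qed

lemma chosen_link:
  "x \<noteq> 0" "x - 1 < n" "anc v (x - 1)" "cur (x - 1) \<noteq> 0" "cur (x - 1) - 1 < 2 * m" "(cur (x - 1) - 1) div 2 \<notin> tree"
  "q (cur (x - 1) - 1) = x - 1" "covers (cur (x - 1) - 1) v"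
proof -
  \<comment> \<open>The input graph is 2-edge-connected, so some link covers \<open>v\<close> and
    the minimum \<open>x\<close> exists.\<close>
  obtain h where h: "h < 2 * m" "h div 2 \<notin> tree" "covers h v"
    using spans2_covers[OF sp _ v] by auto
  have "q h \<in> {u. u < n \<and> anc v u \<and> cur u \<noteq> 0}" using cheapest[OF h] q_less[OF h(1)] h(3) by (simp add: covers_def)
  then show "x \<noteq> 0" using x by (auto simp: amin_def split: if_splits)
  then show u: "x - 1 < n" "anc v (x - 1)" "cur (x - 1) \<noteq> 0" using x by (simp_all add: amin_def)
  have "cur (x - 1) - 1 \<in> avail (x - 1) v" using cur[OF u(1)] u(3) by (simp add: amin_def)
  then show "cur (x - 1) - 1 < 2 * m" "(cur (x - 1) - 1) div 2 \<notin> tree"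
    "q (cur (x - 1) - 1) = x - 1" "covers (cur (x - 1) - 1) v" unfolding avail_anc[OF u(2)] links_def by simp_all
qed

text \<open>\<open>d\<close> is the least slack among the links that cover \<open>v\<close>, so
  raising \<open>y v\<close> by \<open>d\<close> keeps these feasible and makes the chosen one
  tight. It is nonnegative by the feasibility reached before. Links chosen earlier do not cover the
  uncovered \<open>v\<close> and stay tight.\<close>

lemma choose:
  assumes d: "d = c ((cur (x - 1) - 1) div 2) - ys (x - 1)"
    and ys': "\<And>u. u < n \<Longrightarrow> ys' u = ys u + (if anc v u then d else 0)"
    and cov': "\<And>k. k < n \<Longrightarrow> cov' k = (if covers (cur (x - 1) - 1) k then 1 else cov k)"
  shows "dual_state n m q par te c v (ch(v := cur (x - 1))) (y(v := d)) ys' cov'"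
proof -
  define u where "u = x - 1"
  define h where "h = cur u - 1"
  have h: "h < 2 * m" "h div 2 \<notin> tree" "q h = u" "covers h v" and ch': "cur (x - 1) = Suc h"
    using chosen_link by (simp_all add: u_def h_def)
  have umin: "d \<le> c ((cur w - 1) div 2) - ys w" if "w < n" "anc v w" "cur w \<noteq> 0" for w
    using x chosen_link(1) d that by (simp add: amin_def)
  have yv: "y v = 0" "ch v = 0" using unprocessed[of v] b by simp_all
  have nocov: "\<not> covers (ch w - 1) v" if "w < n" "ch w \<noteq> 0" for w
    using cov_iff[OF v(2)] cov that by auto
  have d': "d = c (h div 2) - ys u" using d by (simp add: u_def h_def)
  have d0: "0 \<le> d" using y_feasible[OF h(1,2)] link_sum[OF h(1,4)] h(3) d' by simp
  note upd = sum_update[where y = y and d = d, OF v(2) yv(1)]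
  show ?thesis unfolding ch'
  proof unfold_locales
    fix k
    show "0 \<le> (y(v := d)) k" using y_nonneg d0 by simp
    assume "k < v"
    then show "(y(v := d)) k = 0 \<and> (ch(v := Suc h)) k = 0" using unprocessed[of k] b by simp
  next
    fix k assume k: "k < 2 * m" "k div 2 \<notin> tree"
    show "(\<Sum>x | x < n \<and> covers k x. (y(v := d)) x) \<le> c (k div 2)"
    proof (cases "covers k v")
      case True
      then have "anc v (q k)" by (simp add: covers_def)
      then have "d \<le> c ((cur (q k) - 1) div 2) - ys (q k)" "c ((cur (q k) - 1) div 2) \<le> c (k div 2)"
        using umin[of "q k"] cheapest[of k] k True q_less[of k] by simp_all
      then show ?thesis using upd[of "covers k"] True link_sum[of k] k by simp
    next
      case False
      then show ?thesis using upd[of "covers k"] y_feasible[of k] k by simp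
    qed
  next
    fix w assume "w < n"
    then show "ys' w = (\<Sum>x | x < n \<and> anc x w. (y(v := d)) x)" using upd[of "\<lambda>x. anc x w"] ys_sum[of w] ys'[of w] by simp
  next
    fix w assume w: "w < n" "(ch(v := Suc h)) w \<noteq> 0"
    show "(ch(v := Suc h)) w - 1 < 2 * m \<and> ((ch(v := Suc h)) w - 1) div 2 \<notin> tree \<and> covers ((ch(v := Suc h)) w - 1) w \<and>
      c (((ch(v := Suc h)) w - 1) div 2) = (\<Sum>x | x < n \<and> covers ((ch(v := Suc h)) w - 1) x. (y(v := d)) x)"
    proof (cases "w = v")
      case True
      then show ?thesis using h upd[of "covers h"] link_sum[OF h(1,4)] d' by simp
    next
      case False
      then show ?thesis using ch_link[of w] upd[of "covers (ch w - 1)"] nocov[of w] w by simp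
    qed
  next
    fix k w assume kw: "k < w" "w < n" "(ch(v := Suc h)) k \<noteq> 0" "(ch(v := Suc h)) w \<noteq> 0"
    have "ch k = 0" if "k < v" for k using unprocessed[of k] b that by simp
    then show "\<not> covers ((ch(v := Suc h)) w - 1) k"
      using nocov[of w] ch_uncovered[of k w] kw by (cases "k = v"; cases "w = v") auto
  next
    fix w assume w: "v \<le> w" "w < n" "(ch(v := Suc h)) w = 0"
    then have wv: "w \<noteq> v" by auto
    with w have "y w = 0 \<and> (\<exists>k. w < k \<and> k < n \<and> ch k \<noteq> 0 \<and> covers (ch k - 1) w)" using ch_0[of w] b by simp
    then obtain k where k: "w < k" "k < n" "ch k \<noteq> 0" "covers (ch k - 1) w" and "y w = 0" by blast
    then show "(y(v := d)) w = 0 \<and> (\<exists>k. w < k \<and> k < n \<and> (ch(v := Suc h)) k \<noteq> 0 \<and> covers ((ch(v := Suc h)) k - 1) w)"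
      using wv w(1) by (auto intro!: exI[of _ k])
  next
    fix k assume k: "k < n"
    have "(\<exists>w<n. (ch(v := Suc h)) w \<noteq> 0 \<and> covers ((ch(v := Suc h)) w - 1) k) \<longleftrightarrow>
        covers h k \<or> (\<exists>w<n. ch w \<noteq> 0 \<and> covers (ch w - 1) k)" (is "?L \<longleftrightarrow> ?R")
    proof
      assume ?L
      then obtain w where "w < n" "(ch(v := Suc h)) w \<noteq> 0" "covers ((ch(v := Suc h)) w - 1) k" by blast
      then show ?R by (cases "w = v") auto
    next
      assume ?R
      then show ?L
      proof
        assume "covers h k"
        then show ?L using v by (intro exI[of _ v]) simp
      next
        assume "\<exists>w<n. ch w \<noteq> 0 \<and> covers (ch w - 1) k"
        then obtain w where w: "w < n" "ch w \<noteq> 0" "covers (ch w - 1) k" by blast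
        then have "w \<noteq> v" using yv by auto
        then show ?L using w by (intro exI[of _ w]) simp
      qed
    qed
    then show "cov' k = of_bool (\<exists>w<n. (ch(v := Suc h)) w \<noteq> 0 \<and> covers ((ch(v := Suc h)) w - 1) k)"
      using cov'[OF k] cov_iff[OF k] by (simp add: h_def u_def)
  qed
qed

end

end

section \<open>The loops of the bottom-up phase\<close>

context tree_machine
begin

lemma mark_path:
  assumes a: "a = Cov \<or> a = Kov" and par: "iv st Par = par" and v: "iv st I 0 = v" "v < n"
    and h: "iv st Ch v = Suc h" "h < 2 * m" "iv st Top h = apex h" "iv st X 0 = q h"
  shows "run (mark_path a) st (\<lambda>st'. frame {a, X} st st' \<and> rv st' = rv st \<and>
     (\<forall>x. iv st' a x = (if covers h x then 1 else iv st a x))) (3 * n + 1)"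
proof -
  let ?Inv = "\<lambda>st'. frame {a, X} st st' \<and> rv st' = rv st \<and> anc (iv st' X 0) (q h) \<and> apex h \<le> iv st' X 0 \<and>
     (\<forall>x. iv st' a x = (if covers h x \<and> iv st' X 0 < x then 1 else iv st a x))"
  have ne: "a \<noteq> X" "a \<noteq> Inp" "a \<noteq> I" "a \<noteq> Ch" "a \<noteq> Top" "a \<noteq> Par" using a by auto
  have qh: "q h < n" using q_less h by blast
  show ?thesis unfolding mark_path_def
  \<comment> \<open>Parents have smaller numbers, so the number of the current vertex bounds the
    rest of the path.\<close>
  proof (rule run_Loop[where Inv = ?Inv and \<Phi> = "\<lambda>st'. 3 * iv st' X 0" and T = "\<lambda>_. 2"], goal_cases)
    case 1
    show ?case using h anc_le[OF lca_anc(1), of "q h" "q (mate h)"] not_anc_less[of "q h"]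
      by (auto simp: apex_def covers_def)
  next
    case (2 st')
    then have "iv st' I 0 = v" "iv st' Ch v = Suc h" using ne v h by (simp_all add: frame_def)
    then show ?case using v h n_le_m by simp
  next
    case (3 st')
    define x where "x = iv st' X 0"
    have fr: "frame {a, X} st st'" "rv st' = rv st" "iv st' Par = par" "iv st' I 0 = v" "iv st' Ch v = Suc h" "iv st' Top h = apex h"
      using 3(1) ne par v h by (simp_all add: frame_def)
    have x: "apex h < x" "anc x (q h)" using 3 fr by (simp_all add: x_def)
    have x0: "0 < x" and px: "par x < x" using x par_less[of x] by auto
    have xn: "x < n" using anc_le[OF x(2)] qh by simp
    have cx: "covers h x" using x by (simp add: covers_iff_apex)
    have ap: "anc (apex h) (q h)" using lca_anc(1) by (simp add: apex_def)
    have "anc (apex h) x" using anc_chain[OF x(2) ap] x by simp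
    then have "anc (apex h) (par x)" using anc_par_iff[of "apex h" x] x x0 by simp
    then have le: "apex h \<le> par x" by (rule anc_le)
    have pq: "anc (par x) (q h)" using anc_trans[OF x(2), of "par x"] desc.step[of x par "par x"] x0 by blast
    \<comment> \<open>No vertex of the root path has a number strictly between \<open>par x\<close>
      and \<open>x\<close>.\<close>
    have new: "covers h k \<and> par x < k \<longleftrightarrow> k = x \<or> covers h k \<and> x < k" for k
    proof
      assume k: "covers h k \<and> par x < k"
      show "k = x \<or> covers h k \<and> x < k"
      proof (rule ccontr)
        assume no: "\<not> (k = x \<or> covers h k \<and> x < k)"
        then have "anc k x" using anc_chain[OF x(2), of k] k by (auto simp: covers_def)
        then have "anc k (par x)" using anc_par_iff[of k x] no x0 by simp
        then show False using anc_le k by fastforce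
      qed
    qed (use cx px in auto)
    define R where "R st'' \<longleftrightarrow> ?Inv st'' \<and> 2 + 1 + 3 * iv st'' X 0 \<le> 3 * iv st' X 0" for st''
    have old: "iv st' a k = (if covers h k \<and> x < k then 1 else iv st a k)" for k using 3(1) by (simp add: x_def)
    have "R (put (put st' a x 1) X 0 (par x))"
      unfolding R_def using fr le pq px ne by (simp add: x_def[symmetric] new old del: One_nat_def)
    then show ?case
      using fr xn n_le_m ne by (intro run_basic'[where R = R]) (simp_all add: R_def x_def[symmetric])
  next
    case (4 st')
    then have "iv st' I 0 = v" "iv st' Ch v = Suc h" "iv st' Top h = apex h" using ne v h by (simp_all add: frame_def)
    then have "iv st' X 0 = apex h" using 4 by simp
    then show ?case using 4(1) by (simp add: covers_iff_apex)
  qed (use h qh in simp)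
qed

lemma sub_loop:
  assumes par: "iv st Par = par" and 0: "iv st I 0 = v" "iv st J 0 = v" "v < n" and sub: "\<forall>x<v. iv st Sub x = 0"
  shows "run sub_loop st (\<lambda>st'. frame {Sub, J} st st' \<and> rv st' = rv st \<and> (\<forall>x<n. iv st' Sub x = of_bool (anc v x))) (5 * n + 1)"
proof -
  let ?Inv = "\<lambda>st'. frame {Sub, J} st st' \<and> rv st' = rv st \<and> v \<le> iv st' J 0 \<and> iv st' J 0 \<le> n \<and>
    (\<forall>x<iv st' J 0. iv st' Sub x = of_bool (anc v x))"
  show ?thesis unfolding sub_loop_def
  proof (rule run_Loop[where Inv = ?Inv and \<Phi> = "\<lambda>st'. 5 * (n - iv st' J 0)" and T = "\<lambda>_. 4"], goal_cases)
    case 1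
    show ?case using 0 sub not_anc_less by simp
  next
    case (3 st')
    define j where "j = iv st' J 0"
    have fr: "frame {Sub, J} st st'" "rv st' = rv st" "iv st' Par = par" "iv st' I 0 = v"
      using 3(1) par 0 by (simp_all add: frame_def)
    have j: "v \<le> j" "j < n" and old: "\<And>x. x < j \<Longrightarrow> iv st' Sub x = of_bool (anc v x)" using 3 by (simp_all add: j_def)
    define R where "R st'' \<longleftrightarrow> ?Inv st'' \<and> 4 + 1 + 5 * (n - iv st'' J 0) \<le> 5 * (n - iv st' J 0)" for st''
    have R: "R (put (put st' Sub j (of_bool (anc v j))) J 0 (Suc j))"
      using fr j old unfolding R_def by (auto simp: j_def[symmetric] less_Suc_eq)
    show ?case
    proof (rule run_basic'[where R = R], goal_cases)
      case 1
      show ?case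
      proof (cases "j = v")
        case True
        then have "anc v j" by auto
        then show ?thesis using R True fr j n_le_m by (simp add: j_def[symmetric])
      next
        case False
        then have "par j < j" "iv st' Sub (par j) = of_bool (anc v j)"
          using old[of "par j"] par_less[of j] anc_par_iff[of v j] j by simp_all
        then show ?thesis using R False fr j n_le_m by (simp add: j_def[symmetric])
      qed
    qed (simp_all add: R_def)
  qed (use 0 in auto)
qed

definition cur_ok :: "nat set \<Rightarrow> nat \<Rightarrow> nat \<Rightarrow> nat \<Rightarrow> bool" where
  "cur_ok L b u p \<longleftrightarrow> amin cc (avail u b) p \<and> (p \<noteq> 0 \<longrightarrow> p - 1 \<in> L)"

lemma cur_ok_le: "cur_ok L b u p \<Longrightarrow> p \<le> 2 * m"
  by (auto simp: cur_ok_def amin_def avail_def links_def split: if_splits)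

text \<open>The reason why one step per vertex suffices. Upper ends of the available links are at
  most \<open>v\<close>, and exactly those with upper end \<open>v\<close> cease to be available. A
  head with a smaller upper end survives and stays minimal in the smaller set; otherwise its
  successor is by construction cheapest among the links with upper end below
  \<open>v\<close>.\<close>

lemma cur_ok_step:
  assumes L: "chain nxt tp L" and p: "cur_ok L (Suc v) u p"
  shows "cur_ok L v u (if anc v u \<and> p \<noteq> 0 \<and> tp (p - 1) = v then nxt (p - 1) else p)"
proof (cases "anc v u \<and> p \<noteq> 0")
  case False
  show ?thesis
  proof (cases "anc v u")
    case True
    then have "avail u (Suc v) = {}" "p = 0" using p False by (simp_all add: cur_ok_def amin_def)
    moreover have "avail u v \<subseteq> avail u (Suc v)" by (auto simp: avail_def)
    ultimately show ?thesis by (simp add: cur_ok_def)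
  qed (use p avail_not_anc[of v u] in \<open>simp add: cur_ok_def\<close>)
next
  case True
  have pL: "p - 1 \<in> L" and pa: "p - 1 \<in> avail u (Suc v)" using p True by (auto simp: cur_ok_def amin_def)
  have ap: "tp (p - 1) = apex (p - 1)" using L pL by (simp add: chain_def)
  \<comment> \<open>Otherwise the link would have to cover its own upper end.\<close>
  have apex_le: "apex h \<le> v" if "h \<in> avail u (Suc v)" for h
  proof (rule ccontr)
    assume "\<not> apex h \<le> v"
    moreover have "anc (apex h) u" using lca_anc(1) that by (auto simp: apex_def avail_def links_def)
    ultimately have "covers h (apex h)" using that by (simp add: avail_def)
    then show False by (simp add: covers_iff_apex)
  qed
  have av: "avail u v = {h. h \<in> links u \<and> apex h < v}"
    unfolding avail_anc[OF conjunct1[OF True]] using True by (auto simp: covers_iff_apex links_def)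
  have sub: "avail u v \<subseteq> avail u (Suc v)" by (auto simp: avail_def)
  show ?thesis
  proof (cases "apex (p - 1) = v")
    case eq: True
    have "q (p - 1) = u" using pa by (simp add: avail_def links_def)
    moreover have "amin cc {k. k \<in> links (q (p - 1)) \<and> apex k < apex (p - 1)} (nxt (p - 1))"
      "nxt (p - 1) \<noteq> 0 \<longrightarrow> nxt (p - 1) - 1 \<in> L"
      using L pL by (simp_all add: chain_def)
    ultimately show ?thesis using eq True ap av by (simp add: cur_ok_def)
  next
    case False
    then have "apex (p - 1) < v" using apex_le[OF pa] by simp
    then have "p - 1 \<in> avail u v" using pa av by (simp add: avail_def)
    then show ?thesis using p sub True False ap by (auto simp: cur_ok_def amin_def)
  qed
qed

lemma advance_loop:
  assumes 0: "iv st I 0 = v" "iv st J 0 = v" "v < n" and sub: "\<forall>x<n. iv st Sub x = of_bool (anc v x)"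
    and L: "chain (iv st Nxt) (iv st Top) L" and cur: "\<forall>u<n. cur_ok L (Suc v) u (iv st Cur u)"
  shows "run advance_loop st (\<lambda>st'. frame {Cur, J} st st' \<and> rv st' = rv st \<and> (\<forall>u<n. cur_ok L v u (iv st' Cur u))) (5 * n + 1)"
proof -
  let ?Inv = "\<lambda>st'. frame {Cur, J} st st' \<and> rv st' = rv st \<and> iv st' J 0 \<le> n \<and>
    (\<forall>u<n. cur_ok L (if u < iv st' J 0 then v else Suc v) u (iv st' Cur u))"
  show ?thesis unfolding advance_loop_def
  proof (rule run_Loop[where Inv = ?Inv and \<Phi> = "\<lambda>st'. 5 * (n - iv st' J 0)" and T = "\<lambda>_. 4"], goal_cases)
    case 1
    have "cur_ok L v u (iv st Cur u)" if "u < v" for u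
      using cur 0(3) that avail_not_anc[OF not_anc_less[OF that]] by (simp add: cur_ok_def)
    then show ?case using 0 cur by simp
  next
    case (3 st')
    define j where "j = iv st' J 0"
    define p where "p = iv st' Cur j"
    have fr: "frame {Cur, J} st st'" "rv st' = rv st" "iv st' I 0 = v" "iv st' Sub = iv st Sub" "iv st' Top = iv st Top" "iv st' Nxt = iv st Nxt"
      using 3(1) 0 by (simp_all add: frame_def)
    have j: "j < n" and old: "\<And>u. u < n \<Longrightarrow> cur_ok L (if u < j then v else Suc v) u (iv st' Cur u)" using 3 by (simp_all add: j_def)
    have pj: "cur_ok L (Suc v) j p" using old[OF j] by (simp add: p_def)
    have pl: "p - Suc 0 < Suc (2 * m)" "j < Suc (2 * m)" using cur_ok_le[OF pj] j n_le_m by simp_all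
    have sj: "iv st Sub j = of_bool (anc v j)" using sub j by simp
    define R where "R st'' \<longleftrightarrow> ?Inv st'' \<and> 4 + 1 + 5 * (n - iv st'' J 0) \<le> 5 * (n - iv st' J 0)" for st''
    have R0: "R (put st'' J 0 (Suc j))" if "frame {Cur, J} st st''" "rv st'' = rv st" "\<forall>u. u \<noteq> j \<longrightarrow> iv st'' Cur u = iv st' Cur u" "cur_ok L v j (iv st'' Cur j)" for st''
    proof -
      have "cur_ok L (if u < Suc j then v else Suc v) u (iv st'' Cur u)" if "u < n" for u
        using old[OF that] \<open>\<forall>u. u \<noteq> j \<longrightarrow> iv st'' Cur u = iv st' Cur u\<close> \<open>cur_ok L v j (iv st'' Cur j)\<close>
        by (cases "u = j") (simp_all add: less_Suc_eq)
      then show ?thesis using that j by (simp add: R_def j_def[symmetric])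
    qed
    note adv = cur_ok_step[OF L pj]
    have R1: "R (put (put st' Cur j (iv st Nxt (p - Suc 0))) J 0 (Suc j))" if "anc v j" "p \<noteq> 0" "iv st Top (p - Suc 0) = v"
      by (rule R0) (use that adv fr in simp_all)
    have R2: "R (put st' J 0 (Suc j))" if "\<not> (anc v j \<and> p \<noteq> 0 \<and> iv st Top (p - Suc 0) = v)"
    proof (rule R0)
      show "cur_ok L v j (iv st' Cur j)" using adv that unfolding p_def by (simp split: if_splits)
    qed (use fr in simp_all)
    show ?case
    proof (rule run_basic'[where R = R], goal_cases)
      case 1
      show ?case using R1 R2 fr pl j sj n_le_m
        by (cases "anc v j"; cases "p = 0"; cases "iv st Top (p - Suc 0) = v")
          (simp_all add: j_def[symmetric] p_def[symmetric])
    qed (simp_all add: R_def)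
  qed (use 0 in auto)
qed

lemma choose_loop:
  assumes 0: "iv st J 0 = v" "v < n" "iv st X 0 = 0" and sub: "\<forall>x<n. iv st Sub x = of_bool (anc v x)"
    and cost: "rv st Cost = c" and cur: "\<forall>u<n. iv st Cur u \<le> 2 * m"
  shows "run choose_loop st (\<lambda>st'. frame {X, J} st st' \<and> rv st' = rv st \<and>
    amin (\<lambda>u. c ((iv st Cur u - 1) div 2) - rv st Ysum u) {u. u < n \<and> anc v u \<and> iv st Cur u \<noteq> 0} (iv st' X 0)) (5 * n + 1)"
proof -
  define f where "f = (\<lambda>u. c ((iv st Cur u - 1) div 2) - rv st Ysum u)"
  define A where "A j = {u. u < j \<and> anc v u \<and> iv st Cur u \<noteq> 0}" for j
  let ?Inv = "\<lambda>st'. frame {X, J} st st' \<and> rv st' = rv st \<and> iv st' J 0 \<le> n \<and> iv st' X 0 \<le> iv st' J 0 \<and>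
    amin f (A (iv st' J 0)) (iv st' X 0)"
  show ?thesis unfolding choose_loop_def f_def[symmetric] A_def[symmetric]
  proof (rule run_Loop[where Inv = ?Inv and \<Phi> = "\<lambda>st'. 5 * (n - iv st' J 0)" and T = "\<lambda>_. 4"], goal_cases)
    case 1
    have "A v = {}" using not_anc_less by (auto simp: A_def)
    then show ?case using 0 by simp
  next
    case (3 st')
    define j where "j = iv st' J 0"
    define x where "x = iv st' X 0"
    have fr: "iv st' Cur = iv st Cur" "iv st' Sub = iv st Sub" "rv st' = rv st" "frame {X, J} st st'"
      using 3(1) by (simp_all add: frame_def)
    have j: "j < n" "x \<le> j" "amin f (A j) x" using 3 by (simp_all add: j_def x_def)
    have A: "A (Suc j) = (if anc v j \<and> iv st Cur j \<noteq> 0 then insert j (A j) else A j)"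
      by (auto simp: A_def less_Suc_eq)
    have am: "amin f (A (Suc j)) (if (anc v j \<and> iv st Cur j \<noteq> 0) \<and> (x = 0 \<or> f j < f (x - 1)) then Suc j else x)"
      using j(3) amin_insert[OF j(3), of j] A by (auto split: if_splits)
    have b: "iv st Cur j \<le> 2 * m" "iv st Cur (x - Suc 0) \<le> 2 * m" using cur j by auto
    have xs: "x - Suc 0 < Suc (2 * m)" "j < Suc (2 * m)" using j n_le_m by simp_all
    have sj: "iv st Sub j = of_bool (anc v j)" using sub j by simp
    define R where "R st'' \<longleftrightarrow> ?Inv st'' \<and> 4 + 1 + 5 * (n - iv st'' J 0) \<le> 5 * (n - iv st' J 0)" for st''
    have R: "R (put (if (anc v j \<and> iv st Cur j \<noteq> 0) \<and> (x = 0 \<or> f j < f (x - 1)) then put st' X 0 (Suc j) else st') J 0 (Suc j))"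
      using am j fr by (auto simp: R_def j_def[symmetric] x_def[symmetric] split: if_splits)
    show ?case
    proof (rule run_basic'[where R = R], goal_cases)
      case 1
      show ?case
        using R j b[THEN pointer_div_less] fr xs sj cost n_le_m
        by (cases "anc v j"; cases "iv st Cur j = 0"; cases "x = 0"; cases "f j < f (x - 1)")
          (simp_all add: j_def[symmetric] x_def[symmetric] f_def)
    qed (simp_all add: R_def)
  next
    case (4 st')
    then show ?case by (auto simp: A_def)
  qed (use 0 in auto)
qed

lemma raise_loop:
  assumes 0: "iv st I 0 = v" "iv st J 0 = v" "v < n" and sub: "\<forall>x<n. iv st Sub x = of_bool (anc v x)"
  shows "run raise_loop st (\<lambda>st'. frame {J} st st' \<and> rv st' Cost = rv st Cost \<and> rv st' Dual = rv st Dual \<and>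
    (\<forall>u<n. rv st' Ysum u = rv st Ysum u + (if anc v u then rv st Dual v else 0))) (5 * n + 1)"
proof -
  let ?Inv = "\<lambda>st'. frame {J} st st' \<and> rv st' Cost = rv st Cost \<and> rv st' Dual = rv st Dual \<and> iv st' J 0 \<le> n \<and>
    (\<forall>u<n. rv st' Ysum u = rv st Ysum u + (if u < iv st' J 0 \<and> anc v u then rv st Dual v else 0))"
  show ?thesis unfolding raise_loop_def
  proof (rule run_Loop[where Inv = ?Inv and \<Phi> = "\<lambda>st'. 5 * (n - iv st' J 0)" and T = "\<lambda>_. 4"], goal_cases)
    case 1
    show ?case using 0 not_anc_less by auto
  next
    case (3 st')
    define j where "j = iv st' J 0"
    have fr: "frame {J} st st'" "rv st' Cost = rv st Cost" "rv st' Dual = rv st Dual" "iv st' I 0 = v" "iv st' Sub = iv st Sub"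
      using 3(1) 0 by (simp_all add: frame_def)
    have j: "j < n" and old: "\<And>u. u < n \<Longrightarrow> rv st' Ysum u = rv st Ysum u + (if u < j \<and> anc v u then rv st Dual v else 0)"
      using 3 by (simp_all add: j_def)
    have sj: "iv st Sub j = of_bool (anc v j)" using sub j by simp
    define R where "R st'' \<longleftrightarrow> ?Inv st'' \<and> 4 + 1 + 5 * (n - iv st'' J 0) \<le> 5 * (n - iv st' J 0)" for st''
    have R1: "R (put (rput st' Ysum j (rv st' Ysum j + rv st Dual v)) J 0 (Suc j))" if "anc v j"
      using fr j old that unfolding R_def by (auto simp: j_def[symmetric] less_Suc_eq)
    have R2: "R (put st' J 0 (Suc j))" if "\<not> anc v j"
      using fr j old that unfolding R_def by (auto simp: j_def[symmetric] less_Suc_eq)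
    show ?case
    proof (rule run_basic'[where R = R], goal_cases)
      case 1
      show ?case using R1 R2 fr j sj n_le_m 0(3) by (cases "anc v j") (simp_all add: j_def[symmetric])
    qed (simp_all add: R_def)
  qed (use 0 in auto)
qed

lemma dual_loop:
  assumes ag: "agrees st" and sp: "spans2 q n {..<m}"
    and 0: "iv st I 0 = n" "iv st Sub = (\<lambda>_. 0)" "iv st Ch = (\<lambda>_. 0)" "iv st Cov = (\<lambda>_. 0)"
      "rv st Dual = (\<lambda>_. 0)" "rv st Ysum = (\<lambda>_. 0)"
    and L: "chain (iv st Nxt) (iv st Top) L"
    and cur: "\<forall>u<n. amin cc (links u) (iv st Cur u) \<and> (iv st Cur u \<noteq> 0 \<longrightarrow> iv st Cur u - 1 \<in> L)"
  shows "run dual_loop st (\<lambda>st'. frame {Sub, Cur, Ch, Cov, I, J, X} st st' \<and> rv st' Cost = c \<and>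
     chosen_links n m q par te c (iv st' Ch) (rv st' Dual) \<and>
     (\<forall>v<n. iv st' Ch v \<noteq> 0 \<longrightarrow> iv st' Top (iv st' Ch v - 1) = apex (iv st' Ch v - 1)))
     ((23 * n + 16) * n + 1)"
proof -
  let ?F = "{Sub, Cur, Ch, Cov, I, J, X}"
  define DS where "DS b st' \<longleftrightarrow> dual_state n m q par te c b (iv st' Ch) (rv st' Dual) (rv st' Ysum) (iv st' Cov)" for b and st' :: store
  let ?Inv = "\<lambda>st'. frame ?F st st' \<and> rv st' Cost = c \<and> 1 \<le> iv st' I 0 \<and> iv st' I 0 \<le> n \<and>
    (\<forall>x<iv st' I 0. iv st' Sub x = 0) \<and> DS (iv st' I 0) st' \<and> (\<forall>w<n. iv st' Ch w \<noteq> 0 \<longrightarrow> iv st' Ch w - 1 \<in> L) \<and>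
    (\<forall>u<n. cur_ok L (iv st' I 0) u (iv st' Cur u))"
  have cost: "rv st Cost = c" and par: "iv st Par = par" and Q: "\<forall>h<2 * m. iv st Q h = q h" using ag by (simp_all add: agrees_def)
  show ?thesis unfolding dual_loop_def
  \<comment> \<open>Four passes with 5 steps per vertex and one path with 3 steps per vertex give
    \<open>23 * n\<close>. The loop ends at 1 because the root has no tree edge above it.\<close>
  proof (rule run_Loop[where Inv = ?Inv and \<Phi> = "\<lambda>st'. (23 * n + 16) * (iv st' I 0 - 1)" and T = "\<lambda>_. 23 * n + 15"], goal_cases)
    case 1
    have "avail u n = links u" if "u < n" for u
      using not_anc_less[of u] that by (auto simp: avail_def)
    then have "\<forall>u<n. cur_ok L n u (iv st Cur u)" using cur by (simp add: cur_ok_def)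
    moreover have "DS n st" unfolding DS_def 0
      by unfold_locales (use c_nonneg in auto)
    ultimately show ?case using 0 cost n_pos by simp
  next
    case (3 st1)
    define v where "v = iv st1 I 0 - 1"
    have I1: "iv st1 I 0 = Suc v" and v: "0 < v" "v < n" "v < Suc (2 * m)" using 3 n_le_m by (auto simp: v_def)
    have fr1: "frame ?F st st1" "rv st1 Cost = c" and sub1: "\<forall>x<v. iv st1 Sub x = 0" and DS1: "DS (Suc v) st1"
      and chL1: "\<forall>w<n. iv st1 Ch w \<noteq> 0 \<longrightarrow> iv st1 Ch w - 1 \<in> L" and cur1: "\<forall>u<n. cur_ok L (Suc v) u (iv st1 Cur u)"
      using 3(1) I1 by auto
    define R where "R st' \<longleftrightarrow> ?Inv st' \<and> 23 * n + 15 + 1 + (23 * n + 16) * (iv st' I 0 - 1) \<le> (23 * n + 16) * (iv st1 I 0 - 1)" for st'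
    define M where "M st' \<longleftrightarrow> frame {I, J, X, Sub, Cur} st1 st' \<and> rv st' = rv st1 \<and> iv st' I 0 = v" for st'
    have M_frame: "M st''" if "M st'" "frame A st' st''" "rv st'' = rv st'" "A \<subseteq> {J, X, Sub, Cur}" for A st' st''
      using that by (auto simp: M_def frame_def subset_iff)
    have M: "frame ?F st st'" "iv st' Par = par" "\<forall>h<2 * m. iv st' Q h = q h" "iv st' Nxt = iv st Nxt" "iv st' Top = iv st Top"
        "rv st' Cost = c" "iv st' Ch = iv st1 Ch" "iv st' Cov = iv st1 Cov" "iv st' I 0 = v" "rv st' = rv st1"
      if "M st'" for st'
      using that fr1 par Q by (simp_all add: M_def frame_def)
    have R: "R st'" if "frame ?F st st'" "rv st' Cost = c" "iv st' I 0 = v" "\<forall>x<n. iv st' Sub x = of_bool (anc v x)"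
      "DS v st'" "\<forall>w<n. iv st' Ch w \<noteq> 0 \<longrightarrow> iv st' Ch w - 1 \<in> L" "\<forall>u<n. cur_ok L v u (iv st' Cur u)" for st'
    proof -
      have "v = Suc (v - 1)" using v by simp
      then have "(23 * n + 16) * v = (23 * n + 16) + (23 * n + 16) * (v - 1)" by (metis mult_Suc_right)
      then show ?thesis using that v I1 not_anc_less by (simp add: R_def)
    qed
    define B where "B = (Asg Ch (reg I) (Get Cur (dec (reg X))) ;; RAsg Dual (reg I) (slack (dec (reg X))) ;; set_reg J (reg I)) ;;
          raise_loop ;; set_reg X (Get Q (dec (Get Ch (reg I)))) ;; mark_path Cov"
    have step4: "run B st5 R (8 * n + 6)"
      if M5: "M st5" and sub: "\<forall>x<n. iv st5 Sub x = of_bool (anc v x)" and cur5: "\<forall>u<n. cur_ok L v u (iv st5 Cur u)"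
        and x: "amin (\<lambda>u. c ((iv st5 Cur u - 1) div 2) - rv st5 Ysum u) {u. u < n \<and> anc v u \<and> iv st5 Cur u \<noteq> 0} (iv st5 X 0)"
        and cov: "iv st1 Cov v = 0" for st5
    proof -
      interpret ds: dual_state n m q par te c "Suc v" "iv st1 Ch" "rv st1 Dual" "rv st1 Ysum" "iv st1 Cov"
        using DS1 by (simp add: DS_def)
      define x where "x = iv st5 X 0"
      define p where "p = iv st5 Cur (x - 1)"
      define h where "h = p - 1"
      define d where "d = c (h div 2) - rv st1 Ysum (x - 1)"
      have x': "amin (\<lambda>u. c ((iv st5 Cur u - 1) div 2) - rv st1 Ysum u) {u. u < n \<and> anc v u \<and> iv st5 Cur u \<noteq> 0} x"
        using x M(10)[OF M5] by (simp add: x_def)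
      have cu: "\<And>u. u < n \<Longrightarrow> amin cc (avail u v) (iv st5 Cur u)" using cur5 by (simp add: cur_ok_def)
      note cl = ds.chosen_link[OF HOL.refl v(1,2) cov cu sp x', folded p_def, folded h_def]
      have ph: "p = Suc h" using cl(4) by (simp add: h_def)
      have hL: "h \<in> L" using cur5 cl(2,4) by (simp add: cur_ok_def h_def p_def)
      have aph: "iv st Top h = apex h" using L hL by (simp add: chain_def)
      have bnd: "x - Suc 0 < Suc (2 * m)" "h div 2 < m" "h < Suc (2 * m)" "x - Suc 0 < n" using cl n_le_m by simp_all
      let ?st6 = "put (rput (put st5 Ch v p) Dual v d) J 0 v"
      have "run (raise_loop ;; set_reg X (Get Q (dec (Get Ch (reg I)))) ;; mark_path Cov) ?st6 R (8 * n + 3)"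
      proof (rule run_seq[where ?T2.0 = "3 * n + 2", OF raise_loop[where v = v]], goal_cases)
        case (5 st7)
        have fr7: "frame {J, Ch} st5 st7" "iv st7 Ch = (iv st1 Ch)(v := p)" "rv st7 Cost = c" "rv st7 Dual = (rv st1 Dual)(v := d)"
            "iv st7 I 0 = v"
          and ys7: "\<And>u. u < n \<Longrightarrow> rv st7 Ysum u = rv st1 Ysum u + (if anc v u then d else 0)"
          using 5 M[OF M5] by (auto simp: frame_def)
        have qx: "q h = x - Suc 0" "iv st7 Q h = q h" "iv st7 Par = par" "iv st7 Top h = apex h"
          using cl(7) fr7(1) M[OF M5] cl(5) aph by (simp_all add: frame_def)
        have "run (mark_path Cov) (put st7 X 0 (q h)) R (3 * n + 1)"
        proof (rule run_mono[OF mark_path[where v = v and h = h]], goal_cases)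
          case (9 st8)
          have fr8: "frame {J, Ch, X, Cov} st5 st8" "iv st8 Ch = (iv st1 Ch)(v := p)" "rv st8 = rv st7" "iv st8 I 0 = v"
            and cov8: "\<And>k. iv st8 Cov k = (if covers h k then 1 else iv st1 Cov k)"
            using 9 fr7 M[OF M5] by (auto simp: frame_def)
          have "DS v st8" unfolding DS_def fr8 fr7 p_def
            by (rule ds.choose[OF HOL.refl v(1,2) cov cu sp x'])
              (use ys7 cov8 in \<open>simp_all add: d_def h_def p_def\<close>)
          moreover have "frame ?F st st8" using fr8 M(1)[OF M5] by (auto simp: frame_def)
          moreover have "iv st8 Sub = iv st5 Sub" "iv st8 Cur = iv st5 Cur" using fr8 by (simp_all add: frame_def)
          ultimately show ?case using fr8 fr7 sub cur5 chL1 hL ph by (intro R) auto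
        qed (use qx fr7 v cl(5) ph in simp_all)
        then show ?case
          using fr7 qx bnd v ph by (intro run_pre_seq[where T' = "3 * n + 1"]) simp_all
      qed (use v sub M(9)[OF M5] in simp_all)
      then show ?thesis unfolding B_def
        using M[OF M5] v bnd ph n_le_m
        by (intro run_pre_seq[where T' = "8 * n + 3"])
          (simp_all add: x_def[symmetric] p_def[symmetric, unfolded One_nat_def] d_def)
    qed
    have step3: "run (choose_loop ;; If (Eq (Get Cov (reg I)) (C 0)) B Nop) (put (put st4 J 0 v) X 0 0) R (13 * n + 8)"
      if M4: "M st4" and sub: "\<forall>x<n. iv st4 Sub x = of_bool (anc v x)" and cur4: "\<forall>u<n. cur_ok L v u (iv st4 Cur u)" for st4
    proof (rule run_seq[where ?T2.0 = "8 * n + 7", OF choose_loop[where v = v]], goal_cases)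
      case (7 st5)
      have M5: "M st5" using M_frame[OF M4, of "{X, J}" st5] 7 by (auto simp: frame_def)
      have same: "iv st5 Sub = iv st4 Sub" "iv st5 Cur = iv st4 Cur" using 7 by (simp_all add: frame_def)
      show ?case
      proof (rule run_If[where T = "8 * n + 6"])
        show "bsafe st5 (Eq (Get Cov (reg I)) (C 0))" using M(9)[OF M5] v by simp
      next
        assume "bv st5 (Eq (Get Cov (reg I)) (C 0))"
        then have "iv st1 Cov v = 0" using M(8,9)[OF M5] by simp
        then show "run B st5 R (8 * n + 6)"
          using 7 sub cur4 same by (intro step4[OF M5]) simp_all
      next
        assume "\<not> bv st5 (Eq (Get Cov (reg I)) (C 0))"
        then have cov: "iv st1 Cov v \<noteq> 0" using M(8,9)[OF M5] by simp
        interpret ds: dual_state n m q par te c "Suc v" "iv st1 Ch" "rv st1 Dual" "rv st1 Ysum" "iv st1 Cov"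
          using DS1 by (simp add: DS_def)
        have "DS v st5" unfolding DS_def M(7,8,10)[OF M5] by (rule ds.covered[OF HOL.refl v(2) cov])
        then have "R st5" using M[OF M5] sub cur4 same chL1 by (intro R) simp_all
        then show "run Nop st5 R (8 * n + 6)" by (intro run_basic) simp_all
      qed simp
    qed (use v sub M(6)[OF M4] cur4 cur_ok_le in auto)
    have step2: "run (advance_loop ;; (set_reg J (reg I) ;; set_reg X (C 0)) ;; choose_loop ;; If (Eq (Get Cov (reg I)) (C 0)) B Nop)
       (put st3 J 0 v) R (18 * n + 11)"
      if M3: "M st3" and sub: "\<forall>x<n. iv st3 Sub x = of_bool (anc v x)" and cur3: "iv st3 Cur = iv st1 Cur" for st3
    proof (rule run_seq[where ?T2.0 = "13 * n + 10", OF advance_loop[where v = v and L = L]], goal_cases)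
      case (7 st4)
      have M4: "M st4" using M_frame[OF M3, of "{Cur, J}" st4] 7 by (auto simp: frame_def)
      have "iv st4 Sub = iv st3 Sub" using 7 by (simp add: frame_def)
      then show ?case
        using step3[OF M4] 7 sub M(9)[OF M4] by (intro run_pre_seq[where T' = "13 * n + 8"]) simp_all
    qed (use v sub cur1 cur3 L M[OF M3] in simp_all)
    have step1: "run (sub_loop ;; set_reg J (reg I) ;; advance_loop ;; (set_reg J (reg I) ;; set_reg X (C 0)) ;; choose_loop ;;
        If (Eq (Get Cov (reg I)) (C 0)) B Nop) (put (put st1 I 0 v) J 0 v) R (23 * n + 13)"
    proof (rule run_seq[where ?T2.0 = "18 * n + 12", OF sub_loop[where v = v]], goal_cases)
      case (6 st3)
      have M3: "M st3" using 6 unfolding M_def by (auto simp: frame_def)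
      have "iv st3 Cur = iv st1 Cur" using 6 by (simp add: frame_def)
      then show ?case
        using step2[OF M3] 6 M(9)[OF M3] by (intro run_pre_seq[where T' = "18 * n + 11"]) simp_all
    qed (use v sub1 fr1 par in \<open>simp_all add: frame_def\<close>)
    show ?case
    proof (rule run_mono[where R = R and T = "23 * n + 15"], goal_cases)
      case 1
      show ?case unfolding B_def[symmetric]
        using step1 I1 v by (intro run_pre_seq[where T' = "23 * n + 13"]) simp_all
    qed (simp_all add: R_def)
  next
    case (4 st')
    then have I: "iv st' I 0 = 1" by simp
    interpret ds: dual_state n m q par te c "1" "iv st' Ch" "rv st' Dual" "rv st' Ysum" "iv st' Cov"
      using 4(1) I by (simp add: DS_def)
    have "iv st' Top = iv st Top" using 4(1) by (simp add: frame_def)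
    then have "\<forall>v<n. iv st' Ch v \<noteq> 0 \<longrightarrow> iv st' Top (iv st' Ch v - 1) = apex (iv st' Ch v - 1)"
      using 4(1) L by (simp add: chain_def)
    then show ?case using ds.chosen_links 4(1) by simp
  next
    case 5
    have "(23 * n + 16) * (iv st I 0 - 1) \<le> (23 * n + 16) * n" using 0 by (intro mult_le_mono2) simp
    then show ?case by simp
  qed auto
qed

end

subsection \<open>The top-down phase\<close>

definition keep_loop :: cmd where
  "keep_loop =
     Loop (Lt (reg I) VN)
      (If (Conj (Not (Eq (Get Ch (reg I)) (C 0))) (Eq (Get Kov (reg I)) (C 0)))
         ((Asg Sel (Bin Div (dec (Get Ch (reg I))) (C 2)) (C 1) ;; set_reg X (Get Q (dec (Get Ch (reg I))))) ;;
          mark_path Kov)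
         Nop ;;
       set_reg I (inc (reg I)))"

lemma (in tree_machine) keep_loop:
  fixes st
  defines "ch \<equiv> iv st Ch"
  assumes ag: "agrees st" and 0: "iv st I 0 = 1" "iv st Kov = (\<lambda>_. 0)"
    and cl: "chosen_links n m q par te c ch y" and ap: "\<forall>v<n. ch v \<noteq> 0 \<longrightarrow> iv st Top (ch v - 1) = apex (ch v - 1)"
  shows "run keep_loop st (\<lambda>st'. frame {Sel, Kov, X, I} st st' \<and> rv st' = rv st \<and>
     (\<exists>K. (\<forall>v. v \<in> K \<longleftrightarrow> 0 < v \<and> v < n \<and> ch v \<noteq> 0 \<and> \<not> (\<exists>f\<in>K. f < v \<and> covers (ch f - 1) v)) \<and>
       (\<forall>e. iv st' Sel e = of_bool (e \<in> tree \<union> (\<lambda>k. (ch k - 1) div 2) ` K)))) ((3 * n + 6) * n + 1)"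
proof -
  interpret chosen_links n m q par te c ch y by (rule cl)
  \<comment> \<open>\<open>K\<close> is the kept set among the vertices below \<open>i\<close>. The
    rule for a vertex refers to smaller ones only, so increasing \<open>i\<close> never revises a
    decision.\<close>
  define G where "G K i st' \<longleftrightarrow> (\<forall>v. v \<in> K \<longleftrightarrow> 0 < v \<and> v < i \<and> ch v \<noteq> 0 \<and> \<not> (\<exists>f\<in>K. f < v \<and> covers (ch f - 1) v)) \<and>
     (\<forall>x. iv st' Kov x = of_bool (\<exists>f\<in>K. covers (ch f - 1) x)) \<and>
     (\<forall>e. iv st' Sel e = of_bool (e \<in> tree \<union> (\<lambda>k. (ch k - 1) div 2) ` K))" for K i and st' :: store
  let ?Inv = "\<lambda>st'. frame {Sel, Kov, X, I} st st' \<and> rv st' = rv st \<and> 1 \<le> iv st' I 0 \<and> iv st' I 0 \<le> n \<and> (\<exists>K. G K (iv st' I 0) st')"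
  show ?thesis unfolding keep_loop_def
  proof (rule run_Loop[where Inv = ?Inv and \<Phi> = "\<lambda>st'. (3 * n + 6) * (n - iv st' I 0)" and T = "\<lambda>_. 3 * n + 5"], goal_cases)
    case 1
    have "G {} 1 st" using 0 ag by (auto simp: G_def agrees_def)
    then show ?case using 0 n_pos by auto
  next
    case (3 st1)
    define v where "v = iv st1 I 0"
    obtain K where G: "G K v st1" using 3(1) by (auto simp: v_def)
    have v: "0 < v" "v < n" "v < Suc (2 * m)" using 3 n_le_m by (auto simp: v_def)
    have fr1: "frame {Sel, Kov, X, I} st st1" "rv st1 = rv st" "iv st1 Ch = ch" "iv st1 Par = par" "\<forall>h<2 * m. iv st1 Q h = q h" "iv st1 Top = iv st Top"
      using 3(1) ag by (simp_all add: frame_def agrees_def ch_def)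
    have K_iff: "k \<in> K \<longleftrightarrow> 0 < k \<and> k < v \<and> ch k \<noteq> 0 \<and> \<not> (\<exists>f\<in>K. f < k \<and> covers (ch f - 1) k)"
      and kov: "iv st1 Kov k = of_bool (\<exists>f\<in>K. covers (ch f - 1) k)"
      and sel: "iv st1 Sel k = of_bool (k \<in> tree \<union> (\<lambda>k. (ch k - 1) div 2) ` K)" for k
      using conjunct1[OF G[unfolded G_def], rule_format, of k] conjunct1[OF conjunct2[OF G[unfolded G_def]], rule_format, of k]
        conjunct2[OF conjunct2[OF G[unfolded G_def]], rule_format, of k] .
    have K_less: "k < v" if "k \<in> K" for k using K_iff that by blast
    define R where "R st' \<longleftrightarrow> ?Inv st' \<and> 3 * n + 5 + 1 + (3 * n + 6) * (n - iv st' I 0) \<le> (3 * n + 6) * (n - iv st1 I 0)" for st'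
    have R: "R (put st' I 0 (Suc v))" if "frame {Sel, Kov, X, I} st st'" "rv st' = rv st" "G K' (Suc v) st'" for K' st'
    proof -
      have "n - v = Suc (n - Suc v)" using v by simp
      then have "(3 * n + 6) * (n - v) = (3 * n + 6) + (3 * n + 6) * (n - Suc v)" by (simp only: mult_Suc_right)
      moreover have "G K' (Suc v) (put st' I 0 (Suc v)) \<longleftrightarrow> G K' (Suc v) st'" by (simp add: G_def)
      then have "\<exists>K. G K (Suc v) (put st' I 0 (Suc v))" using that(3) by blast
      ultimately show ?thesis using that(1,2) v by (simp add: R_def v_def[symmetric])
    qed
    define R1 where "R1 st' \<longleftrightarrow> frame {Sel, Kov, X, I} st st' \<and> rv st' = rv st \<and> iv st' I 0 = v \<and> (\<exists>K'. G K' (Suc v) st')" for st'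
    have keep: "R1 st'" if ch: "ch v \<noteq> 0" "\<not> (\<exists>f\<in>K. covers (ch f - 1) v)" and fr: "frame {Kov, X} (put (put st1 Sel ((ch v - 1) div 2) 1) X 0 (q (ch v - 1))) st'"
      "rv st' = rv st" and kv: "\<forall>x. iv st' Kov x = (if covers (ch v - 1) x then 1 else iv st1 Kov x)" for st'
    proof -
      have K': "k \<in> insert v K \<longleftrightarrow> 0 < k \<and> k < Suc v \<and> ch k \<noteq> 0 \<and> \<not> (\<exists>f\<in>insert v K. f < k \<and> covers (ch f - 1) k)" for k
      proof (cases "k = v")
        case True
        then show ?thesis using ch v by auto
      next
        case False
        then have "k < Suc v \<longleftrightarrow> k < v" by auto
        then show ?thesis using K_iff[of k] False by auto
      qed
      have sel': "iv st' Sel = (iv st1 Sel)((ch v - 1) div 2 := 1)" "iv st' I 0 = v"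
        using fr by (simp_all add: frame_def v_def)
      have kov': "iv st' Kov x = of_bool (\<exists>f\<in>insert v K. covers (ch f - 1) x)" for x
        using kv kov[of x] by simp
      have "((iv st1 Sel)((ch v - 1) div 2 := 1)) e = of_bool (e \<in> tree \<union> (\<lambda>k. (ch k - 1) div 2) ` insert v K)" for e
        using sel[of e] by simp
      then have "G (insert v K) (Suc v) st'" unfolding G_def sel' using K' kov' by blast
      moreover have "frame {Sel, Kov, X, I} st st'" using fr fr1 by (auto simp: frame_def)
      ultimately show ?thesis using fr(2) \<open>iv st' I 0 = v\<close> unfolding R1_def by blast
    qed
    have skip: "R1 st1" if "ch v = 0 \<or> (\<exists>f\<in>K. covers (ch f - 1) v)"
    proof -
      have "k \<in> K \<longleftrightarrow> 0 < k \<and> k < Suc v \<and> ch k \<noteq> 0 \<and> \<not> (\<exists>f\<in>K. f < k \<and> covers (ch f - 1) k)" for k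
      proof (cases "k = v")
        case True
        have "v \<notin> K" using K_less by blast
        then show ?thesis unfolding True using that by (auto dest: K_less)
      next
        case False
        then have "k < Suc v \<longleftrightarrow> k < v" by auto
        then show ?thesis using K_iff[of k] by simp
      qed
      then have "G K (Suc v) st1" unfolding G_def using kov sel by blast
      then show ?thesis unfolding R1_def using fr1 by (auto simp: v_def)
    qed
    have kv: "iv st1 Kov v = of_bool (\<exists>f\<in>K. covers (ch f - 1) v)" by (rule kov)
    have body: "run (If (Conj (Not (Eq (Get Ch (reg I)) (C 0))) (Eq (Get Kov (reg I)) (C 0)))
         ((Asg Sel (Bin Div (dec (Get Ch (reg I))) (C 2)) (C 1) ;; set_reg X (Get Q (dec (Get Ch (reg I))))) ;;
          mark_path Kov) Nop) st1 R1 (3 * n + 4)"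
    proof (rule run_If[where T = "3 * n + 3"], goal_cases)
      case 1
      show ?case using v by (simp add: v_def[symmetric])
    next
      case 2
      then have c2: "ch v \<noteq> 0" "\<not> (\<exists>f\<in>K. covers (ch f - 1) v)" using fr1 kv by (simp_all add: v_def[symmetric])
      define h where "h = ch v - 1"
      have h: "h < 2 * m" "iv st Top h = apex h" "ch v = Suc h" "h < Suc (2 * m)" "h div 2 < Suc (2 * m)"
        using ch_link[OF v(1,2) c2(1)] ap v c2 by (auto simp: h_def)
      have qh: "iv st1 Q h = q h" using fr1 h by simp
      have "run (mark_path Kov) (put (put st1 Sel (h div 2) 1) X 0 (q h)) R1 (3 * n + 1)"
      proof (rule run_mono[OF mark_path[where v = v and h = h]], goal_cases)
        case (9 st')
        then show ?case using c2 fr1 unfolding h_def by (intro keep) simp_all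
      qed (use fr1 h v in \<open>simp_all add: v_def[symmetric]\<close>)
      then show ?case using fr1 v h qh
        by (intro run_pre_seq[where T' = "3 * n + 1"]) (simp_all add: v_def[symmetric])
    next
      case 3
      then have "ch v = 0 \<or> (\<exists>f\<in>K. covers (ch f - 1) v)" using fr1 kv by (simp add: v_def[symmetric])
      then show ?case using skip by (intro run_basic) simp_all
    qed simp
    have "run (If (Conj (Not (Eq (Get Ch (reg I)) (C 0))) (Eq (Get Kov (reg I)) (C 0)))
         ((Asg Sel (Bin Div (dec (Get Ch (reg I))) (C 2)) (C 1) ;; set_reg X (Get Q (dec (Get Ch (reg I))))) ;;
          mark_path Kov) Nop ;; set_reg I (inc (reg I))) st1 R (3 * n + 5)"
    proof (rule run_seq[where ?T2.0 = 1, OF body])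
      fix st' assume "R1 st'"
      then have "R (put st' I 0 (Suc v))" "iv st' I 0 = v" unfolding R1_def using R by blast+
      then show "run (set_reg I (inc (reg I))) st' R 1" using v n_le_m by (intro run_basic) simp_all
    qed simp
    then show ?case by (rule run_mono) (simp_all add: R_def)
  next
    case (4 st')
    then have "iv st' I 0 = n" by simp
    then obtain K where "G K n st'" using 4(1) by auto
    then show ?case using 4(1) unfolding G_def by blast
  next
    case 5
    have "(3 * n + 6) * (n - iv st I 0) \<le> (3 * n + 6) * n" by (intro mult_le_mono2) simp
    then show ?case by simp
  qed auto
qed

subsection \<open>The complete program\<close>

text \<open>The output for edge \<open>e\<close> belongs at address \<open>e\<close>, which for
  \<open>e \<ge> 2\<close> is cell \<open>e - 2\<close> of \<open>Inp\<close>.\<close>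

definition output_loop :: cmd where
  "output_loop =
     Loop (Lt (C 2) (reg I))
      (set_reg I (dec (reg I)) ;;
       Asg Inp (Bin Monus (reg I) (C 2)) (Get Sel (reg I)))"

lemma (in machine) output_loop:
  assumes 0: "iv st I 0 = m"
  shows "run output_loop st (\<lambda>st'. iv st' Sel = iv st Sel \<and> (\<forall>e<m. 2 \<le> e \<longrightarrow> iv st' Inp (e - 2) = iv st Sel e)) (3 * m + 1)"
proof -
  let ?Inv = "\<lambda>st'. iv st' Sel = iv st Sel \<and> iv st' I 0 \<le> m \<and> (\<forall>e<m. iv st' I 0 \<le> e \<and> 2 \<le> e \<longrightarrow> iv st' Inp (e - 2) = iv st Sel e)"
  show ?thesis unfolding output_loop_def
  proof (rule run_Loop[where Inv = ?Inv and \<Phi> = "\<lambda>st'. 3 * iv st' I 0" and T = "\<lambda>_. 2"], goal_cases)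
    case (3 st')
    define i where "i = iv st' I 0 - 1"
    have i: "iv st' I 0 = Suc i" "2 \<le> i" "i < m" using 3 by (auto simp: i_def)
    have "iv (put (put st' I 0 i) Inp (i - 2) (iv st Sel i)) Inp (e - 2) = iv st Sel e" if "e < m" "i \<le> e" "2 \<le> e" for e
      using 3(1) i that by (cases "e = i") auto
    then show ?case using 3(1) i by (intro run_basic) auto
  qed (use 0 in auto)
qed

definition main :: cmd where
  "main =
     adjacency_loop ;;
     (Asg Pos (C 0) (C 1) ;; Asg Ord (C 0) (C 0) ;; set_reg I (C 1)) ;;
     prim_loop ;;
     set_reg I (C 0) ;;
     relabel_loop ;;
     set_reg I (C 0) ;;
     link_loop ;;
     set_reg I VN ;;
     dual_loop ;;
     set_reg I (C 1) ;;
     keep_loop ;;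
     set_reg I VM ;;
     output_loop"

section \<open>From Prim's result to a rooted tree on renumbered vertices\<close>

lemma spans2_relabel:
  assumes "bij_betw f {..<n} {..<n}" "\<And>h. h < 2 * m \<Longrightarrow> E h < n" "\<And>h. h < 2 * m \<Longrightarrow> q h = f (E h)" "F \<subseteq> {..<m}"
  shows "spans2 q n F \<longleftrightarrow> spans2 E n F"
proof -
  have "spans q n D \<longleftrightarrow> spans E n D" if "D \<subseteq> F" for D
    by (rule spans_relabel[OF assms(1)]) (use assms(2-4) that in \<open>auto simp: subset_iff\<close>)
  then show ?thesis by (simp add: spans2_def Diff_subset)
qed

locale prim_result =
  fixes n m E c pos ord best par sel
  assumes inv: "prim_inv n m E c n pos ord best par sel" and E_less: "\<And>h. h < 2 * m \<Longrightarrow> E h < n"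
    and cost_nonneg: "\<And>e. e < m \<Longrightarrow> 0 \<le> c e"
begin

definition label :: "nat \<Rightarrow> nat" where
  "label v = pos v - 1"

definition tree_edge :: "nat \<Rightarrow> nat" where
  "tree_edge k = (best (ord k) - 1) div 2"

lemma ord: "k < n \<Longrightarrow> ord k < n \<and> pos (ord k) = Suc k"
  and best_le: "w < n \<Longrightarrow> best w \<le> 2 * m"
  and par_less: "0 < k \<Longrightarrow> par k < k"
  and best: "0 < k \<Longrightarrow> k < n \<Longrightarrow> best (ord k) \<noteq> 0 \<and> E (best (ord k) - 1) = ord (par k) \<and> E (mate (best (ord k) - 1)) = ord k"
  and sel: "sel e = of_bool (\<exists>k. 0 < k \<and> k < n \<and> e = (best (ord k) - 1) div 2)"
  and opt: "F \<subseteq> {..<m} \<Longrightarrow> spans E n F \<Longrightarrow> \<exists>F'. F' \<subseteq> {..<m} \<and> spans E n F' \<and> {e. sel e = 1} \<subseteq> F' \<and> sum c F' \<le> sum c F"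
  using inv[unfolded prim_inv_def] by (elim conjE; simp)+

lemma n_pos: "1 \<le> n"
  using inv by (simp add: prim_inv_def)

lemma label_ord: "k < n \<Longrightarrow> label (ord k) = k"
  using ord[of k] by (simp add: label_def)

lemma bij_ord: "bij_betw ord {..<n} {..<n}"
proof -
  have inj: "inj_on ord {..<n}" by (rule inj_on_inverseI[of _ label]) (simp add: label_ord)
  moreover have "ord ` {..<n} = {..<n}" by (rule endo_inj_surj[OF _ _ inj]) (use ord in auto)
  ultimately show ?thesis by (simp add: bij_betw_def)
qed

lemma ord_label: assumes "v < n" shows "label v < n" "ord (label v) = v"
proof -
  have "v \<in> ord ` {..<n}" using bij_ord assms by (simp add: bij_betw_def)
  then show "label v < n" "ord (label v) = v" using label_ord by auto
qed

lemma bij_label: "bij_betw label {..<n} {..<n}"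
  by (rule bij_betw_byWitness[of _ ord]) (use label_ord ord ord_label in auto)

lemma tree_edge_ends:
  assumes "0 < k" "k < n"
  shows "{label (E (2 * tree_edge k)), label (E (2 * tree_edge k + 1))} = {k, par k}"
proof -
  define b where "b = best (ord k) - 1"
  have "par k < n" using par_less[OF assms(1)] assms by simp
  then have "label (E b) = par k" "label (E (mate b)) = k" using best[OF assms] label_ord assms by (simp_all add: b_def)
  then show ?thesis unfolding tree_edge_def b_def[symmetric] by (cases b rule: half_edge_cases) auto
qed

lemma rooted: "rooted_tree n m (\<lambda>h. label (E h)) par tree_edge c"
proof unfold_locales
  show "tree_edge i < m" if "0 < i" "i < n" for i
  proof -
    have "best (ord i) - 1 < 2 * m" using best[OF that] best_le[of "ord i"] ord[of i] that by linarith
    then show ?thesis by (simp add: tree_edge_def)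
  qed
  \<comment> \<open>The ends of a tree edge determine its lower end, since that is the larger of the
    two numbers.\<close>
  have "i = j" if ij: "0 < i" "i < n" "0 < j" "j < n" "tree_edge i = tree_edge j" for i j
  proof -
    have "{i, par i} = {j, par j}" using tree_edge_ends[of i] tree_edge_ends[of j] ij by simp
    then show ?thesis using par_less[of i] par_less[of j] ij by (auto simp: doubleton_eq_iff)
  qed
  then show "inj_on tree_edge {1..<n}" by (auto simp: inj_on_def Suc_le_eq)
qed (use n_pos par_less ord_label(1) E_less tree_edge_ends cost_nonneg in auto)

lemma sel_tree: "sel e = of_bool (e \<in> rooted_tree.tree n tree_edge)"
  unfolding sel rooted_tree.tree_def[OF rooted] tree_edge_def by (auto simp: image_def Suc_le_eq)

text \<open>The invariant turns \<open>F\<close> into a superset of the tree that is not more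
  expensive; nonnegative costs allow the rest to be dropped.\<close>

lemma tree_optimal:
  assumes "F \<subseteq> {..<m}" "spans E n F"
  shows "sum c (rooted_tree.tree n tree_edge) \<le> sum c F"
proof -
  obtain F' where F': "F' \<subseteq> {..<m}" "{e. sel e = 1} \<subseteq> F'" "sum c F' \<le> sum c F" using opt[OF assms] by blast
  have "rooted_tree.tree n tree_edge = {e. sel e = 1}" by (auto simp: sel_tree)
  then have "sum c (rooted_tree.tree n tree_edge) \<le> sum c F'"
    using F' cost_nonneg by (intro sum_mono2) (auto intro: finite_subset)
  then show ?thesis using F'(3) by simp
qed

text \<open>A list depends only on which half-edges share an end, and an injective renumbering
  preserves this.\<close>

lemma lists_label:
  shows "u < n \<Longrightarrow> prv E (ord u) (2 * m) = prv (\<lambda>h. label (E h)) u (2 * m)"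
    and "h < 2 * m \<Longrightarrow> prv E (E h) h = prv (\<lambda>h. label (E h)) (label (E h)) h"
proof -
  show "prv E (ord u) (2 * m) = prv (\<lambda>h. label (E h)) u (2 * m)" if "u < n"
    by (rule prv_cong) (use that E_less ord_label(2) label_ord in metis)
  show "prv E (E h) h = prv (\<lambda>h. label (E h)) (label (E h)) h" if "h < 2 * m"
    by (rule prv_cong) (use that E_less ord_label(2) in \<open>metis less_trans\<close>)
qed

end

lemma (in machine) main:
  fixes E :: "nat \<Rightarrow> nat" and c :: "nat \<Rightarrow> real"
  assumes ends: "\<forall>h<2 * m. E h < n" and cost: "\<forall>e<m. 0 \<le> c e" and sp: "spans2 E n {..<m}"
    and init: "iv st Inp = E" "\<forall>a. a \<noteq> Inp \<longrightarrow> iv st a = (\<lambda>_. 0)" "rv st Cost = c" "\<forall>a. a \<noteq> Cost \<longrightarrow> rv st a = (\<lambda>_. 0)"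
  shows "run main st (\<lambda>st'. (\<forall>e<m. 2 \<le> e \<longrightarrow> iv st' Inp (e - 2) = iv st' Sel e) \<and>
      spans2 E n {e. e < m \<and> iv st' Sel e = 1} \<and>
      (\<forall>F. F \<subseteq> {..<m} \<and> spans2 E n F \<longrightarrow> sum c {e. e < m \<and> iv st' Sel e = 1} \<le> 3 * sum c F))
     (60 * m + 110 * (n * n))"
proof -
  note E = ends[rule_format] and c = cost[rule_format] and st = init[rule_format]
  define R where "R st' \<longleftrightarrow> (\<forall>e<m. 2 \<le> e \<longrightarrow> iv st' Inp (e - 2) = iv st' Sel e) \<and>
      spans2 E n {e. e < m \<and> iv st' Sel e = 1} \<and>
      (\<forall>F. F \<subseteq> {..<m} \<and> spans2 E n F \<longrightarrow> sum c {e. e < m \<and> iv st' Sel e = 1} \<le> 3 * sum c F)" for st' :: store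
  \<comment> \<open>\<open>t5\<close> to \<open>t0\<close> are the step budgets of ever longer final
    segments of the program.\<close>
  define t5 where "t5 = 3 * m + 2"
  define t4 where "t4 = (3 * n + 6) * n + 2 + t5"
  define t3 where "t3 = (23 * n + 16) * n + 2 + t4"
  define t2 where "t2 = 16 * m + (19 * n + 12) * n + 2 + t3"
  define t1 where "t1 = 6 * m + 2 + t2"
  define t0 where "t0 = 12 * m + (5 * n + 11) * n + 1 + t1"
  have small: "0 < m" "Suc 0 < 100 * m" using m_pos by simp_all
  have run: "run main st R (8 * m + 4 + t0)"
    unfolding main_def
  proof (rule run_seq[where ?T2.0 = "3 + t0", OF adjacency_loop], goal_cases)
    case (4 st1)
    then have inp1: "iv st1 Inp = E" "rv st1 = rv st" and z1: "\<And>a. a \<notin> {Inp, Head, Next, I} \<Longrightarrow> iv st1 a = (\<lambda>_. 0)"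
      and L1: "listed st1"
      using st E by (auto simp: frame_def listed_def)
    let ?st2 = "put (put (put st1 Pos 0 1) Ord 0 0) I 0 1"
    have z2: "iv ?st2 Inp = E" "rv ?st2 = rv st" "\<And>a. a \<notin> {Inp, Head, Next, Pos, Ord, I} \<Longrightarrow> iv ?st2 a = (\<lambda>_. 0)"
      using inp1 z1 by auto
    have L2: "listed ?st2" using L1 by (simp add: listed_def)
    have inv2: "prim_inv n m (iv ?st2 Inp) (rv ?st2 Cost) (iv ?st2 I 0) (iv ?st2 Pos) (iv ?st2 Ord) (iv ?st2 Best) (iv ?st2 Par) (iv ?st2 Sel)"
      using n_pos z1[of Pos] z1[of Ord] z1[of Best] z1[of Par] z1[of Sel] by (auto simp: prim_inv_def)
    have sp2: "spans (iv ?st2 Inp) n {..<m}" using sp z2(1) by (simp add: spans2_def)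
    have "run (prim_loop ;; set_reg I (C 0) ;; relabel_loop ;; set_reg I (C 0) ;; link_loop ;; set_reg I VN ;; dual_loop ;;
       set_reg I (C 1) ;; keep_loop ;; set_reg I VM ;; output_loop) ?st2 R t0"
    proof (rule run_seq[where ?T2.0 = t1, OF prim_loop[OF L2 inv2 sp2]], goal_cases)
      case (1 st3)
      have fr3: "frame {Pos, Ord, Best, Par, Sel, I, J, P, X} ?st2 st3" "rv st3 = rv st" "iv st3 Inp = E"
        using 1 z2(1,2) by (simp_all add: frame_def)
      have z3: "iv st3 a = (\<lambda>_. 0)" if "a \<notin> {Inp, Head, Next, Pos, Ord, I, Best, Par, Sel, J, P, X}" for a
        using fr3(1) z2(3)[of a] that by (simp add: frame_def)
      have L3: "listed st3" using listed_frame[OF L2 fr3(1)] by simp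
      have inv3: "prim_inv n m E c n (iv st3 Pos) (iv st3 Ord) (iv st3 Best) (iv st3 Par) (iv st3 Sel)"
        using 1 z2(1,2) st(3) by simp
      interpret prim_result n m E c "iv st3 Pos" "iv st3 Ord" "iv st3 Best" "iv st3 Par" "iv st3 Sel"
        by unfold_locales (use inv3 E c in auto)
      define q where "q = (\<lambda>h. label (E h))"
      define par where "par = iv st3 Par"
      interpret rooted_tree n m q par tree_edge c using rooted by (simp add: q_def par_def)
      interpret tree_machine n m S W q par tree_edge c by unfold_locales
      have relabel: "spans2 q n F \<longleftrightarrow> spans2 E n F" if "F \<subseteq> {..<m}" for F
        by (rule spans2_relabel[OF bij_label _ _ that]) (use E in \<open>simp_all add: q_def\<close>)
      have spq: "spans2 q n {..<m}" using relabel sp by simp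
      show ?case
      proof (rule run_set_reg[where T = "6 * m + 1 + t2"], goal_cases)
        case 2
        show ?case unfolding av.simps
        proof (rule run_seq[where ?T2.0 = t2, OF relabel_loop], goal_cases)
          case (3 st4)
          have fr4: "frame {Q, I} st3 st4" "rv st4 = rv st" using 3 fr3 by (auto simp: frame_def)
          have q4: "\<forall>h<2 * m. iv st4 Q h = q h" using 3 fr3 by (simp add: q_def label_def)
          have ord4: "u < n \<Longrightarrow> iv st3 Ord u < n" for u using ord by blast
          have same4: "iv st4 Par = par" "iv st4 Sel = iv st3 Sel" "iv st4 Ord = iv st3 Ord" "iv st4 Head = iv st3 Head" "iv st4 Next = iv st3 Next"
            using fr4(1) by (simp_all add: frame_def par_def)
          have hd: "iv st3 Head (iv st3 Ord u) = prv q u (2 * m)" if "u < n" for u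
            using L3 fr3(3) lists_label(1)[OF that] by (simp add: listed_def q_def)
          have nx: "iv st3 Next h = prv q (q h) h" if "h < 2 * m" for h
            using L3 fr3(3) lists_label(2)[OF that] that by (simp add: listed_def q_def)
          have ag4: "agrees (put st4 I 0 0)"
            using q4 fr4(2) st(3) sel_tree ord4 same4 hd nx by (simp add: agrees_def)
          show ?case
          proof (rule run_set_reg[where T = "16 * m + (19 * n + 12) * n + 1 + t3"], goal_cases)
            case 2
            show ?case unfolding av.simps
            proof (rule run_seq[where ?T2.0 = t3, OF link_loop[OF ag4]], goal_cases)
              case (2 st5)
              then obtain L where L: "chain (iv st5 Nxt) (iv st5 Top) L"
                "\<forall>u<n. amin cc (links u) (iv st5 Cur u) \<and> (iv st5 Cur u \<noteq> 0 \<longrightarrow> iv st5 Cur u - 1 \<in> L)" by blast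
              have fr5: "frame {Mark, Lca, Bst, Cur, Nxt, Top, I, J, P, X} (put st4 I 0 0) st5" "rv st5 = rv st" using 2 fr4 by simp_all
              have ag5: "agrees st5" by (rule agrees_frame[OF ag4 fr5(1)]) (use fr5 fr4 in simp_all)
              have z5: "iv st5 a = (\<lambda>_. 0)" if "a \<in> {Sub, Ch, Cov, Kov}" for a
              proof -
                have "iv st5 a = iv st3 a" using frameD[OF fr5(1), of a] frameD[OF fr4(1), of a] that by auto
                then show ?thesis using z3[of a] that by auto
              qed
              let ?st6 = "put st5 I 0 n"
              have ag6: "agrees ?st6" using ag5 by (simp add: agrees_def)
              show ?case
              proof (rule run_set_reg[where T = "(23 * n + 16) * n + 1 + t4"], goal_cases)
                case 2
                show ?case unfolding av.simps
                proof (rule run_seq[where ?T2.0 = t4, OF dual_loop[OF ag6 spq, of L]], goal_cases)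
                  case (9 st7)
                  have fr7: "frame {Sub, Cur, Ch, Cov, I, J, X} ?st6 st7" "rv st7 Cost = c" using 9 by simp_all
                  have ag7: "agrees st7" by (rule agrees_frame[OF ag6 fr7(1)]) (use fr7 fr5 st(3) in simp_all)
                  let ?st8 = "put st7 I 0 1"
                  have ag8: "agrees ?st8" using ag7 by (simp add: agrees_def)
                  have ch8: "chosen_links n m q par tree_edge c (iv ?st8 Ch) (rv st7 Dual)"
                    and ap8: "\<forall>v<n. iv ?st8 Ch v \<noteq> 0 \<longrightarrow> iv ?st8 Top (iv ?st8 Ch v - 1) = apex (iv ?st8 Ch v - 1)" using 9 by simp_all
                  have kov8: "iv ?st8 Kov = (\<lambda>_. 0)" using fr7(1) z5[of Kov] by (simp add: frame_def)
                  show ?case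
                  proof (rule run_set_reg[where T = "(3 * n + 6) * n + 1 + t5"], goal_cases)
                    case 2
                    show ?case unfolding av.simps
                    proof (rule run_seq[where ?T2.0 = t5, OF keep_loop[OF ag8 _ kov8 ch8 ap8]], goal_cases)
                      case (2 st9)
                      let ?ch = "iv ?st8 Ch"
                      from 2 obtain K where K: "\<And>v. v \<in> K \<longleftrightarrow> 0 < v \<and> v < n \<and> ?ch v \<noteq> 0 \<and> \<not> (\<exists>f\<in>K. f < v \<and> covers (?ch f - 1) v)"
                        and sel9: "\<And>e. iv st9 Sel e = of_bool (e \<in> tree \<union> (\<lambda>k. (?ch k - 1) div 2) ` K)" by blast
                      interpret chosen_links n m q par tree_edge c ?ch "rv st7 Dual" by (rule ch8)
                      let ?A = "tree \<union> (\<lambda>k. (?ch k - 1) div 2) ` K"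
                      have Am: "e < m" if e: "e \<in> ?A" for e
                      proof (cases "e \<in> tree")
                        case True
                        then show ?thesis using te_less by (auto simp: tree_def Suc_le_eq)
                      next
                        case False
                        then obtain k where k: "k \<in> K" "e = (?ch k - 1) div 2" using e by blast
                        then have "?ch k - 1 < 2 * m" using ch_link[of k] K[of k] by blast
                        then show ?thesis using k(2) by simp
                      qed
                      have A: "{e. e < m \<and> iv st9 Sel e = 1} = ?A" using Am sel9 by auto
                      have "spans2 q n ?A" using augmented_tree(1)[OF K] .
                      then have fe: "spans2 E n ?A" using relabel[of ?A] Am by auto
                      have co: "sum c ?A \<le> 3 * sum c F" if "F \<subseteq> {..<m}" "spans2 E n F" for F
                      proof -
                        have "spans2 q n F" using relabel that by simp
                        moreover have "sum c tree \<le> sum c F" using tree_optimal[OF that(1)] that(2) by (simp add: spans2_def)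
                        ultimately show ?thesis using augmented_tree(2)[OF K] that(1) by blast
                      qed
                      show ?case unfolding t5_def
                      proof (rule run_set_reg[where T = "3 * m + 1"], goal_cases)
                        case 2
                        show ?case unfolding av.simps
                        proof (rule run_mono[OF output_loop], goal_cases)
                          case (2 st10)
                          then have s10: "iv st10 Sel = iv st9 Sel" by simp
                          show ?case unfolding R_def s10 A using 2 fe co by simp
                        qed simp_all
                      qed simp_all
                    qed simp_all
                  qed (simp_all add: t4_def)
                qed (use L z5 fr5 st(4) in simp_all)
              qed (simp_all add: t3_def)
            qed simp_all
          qed (simp_all add: t2_def)
        qed (use E fr3 in simp_all)
      qed (simp_all add: t1_def)
    qed (simp add: t0_def)
    then show ?case
      by (intro run_pre_seq[where T' = t0]) (use small in simp_all)
  qed (use E st in simp_all)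
  \<comment> \<open>The phases add up to \<open>45 * m + 15 + 50 * (n * n) + 45 * n\<close>; the
    lower-order terms are absorbed since \<open>m\<close> and \<open>n\<close> are positive.\<close>
  have bound: "8 * m + 4 + t0 \<le> 60 * m + 110 * (n * n)"
  proof -
    define N where "N = n * n"
    have "n \<le> N" using n_pos by (simp add: N_def)
    moreover have "(3 * n + 6) * n = 3 * N + 6 * n" "(23 * n + 16) * n = 23 * N + 16 * n"
      "(19 * n + 12) * n = 19 * N + 12 * n" "(5 * n + 11) * n = 5 * N + 11 * n"
      by (simp_all add: N_def algebra_simps)
    ultimately show ?thesis using m_pos
      unfolding t0_def t1_def t2_def t3_def t4_def t5_def N_def[symmetric] by linarith
  qed
  show ?thesis by (rule run_mono[OF run _ bound]) (simp add: R_def)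
qed

text \<open>
  Cell 1 holds \<open>m\<close> and thereby the addresses of all arrays, so it is overwritten last.
\<close>

definition program :: com where
  "program = Seq (comp main) (Seq (Store (Const 0) (acomp (Get Sel (C 0)))) (Store (Const 1) (acomp (Get Sel (C 1)))))"

lemma (in machine) exec_program:
  assumes "run main st R T" "rep st s"
  shows "\<exists>t s' st'. exec S W program s t s' \<and> t \<le> T + 2 \<and> R st' \<and> imem s' 0 = iv st' Sel 0 \<and> imem s' 1 = iv st' Sel 1 \<and>
    (\<forall>i<2 * m. imem s' (i + 2) = iv st' Inp i)"
proof -
  obtain t s1 st' where t: "exec S W (comp main) s t s1" "rep st' s1" "R st'" "t \<le> T"
    using assms unfolding run_def by blast
  define s2 where "s2 = s1\<lparr>imem := (imem s1)(0 := iv st' Sel 0)\<rparr>"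
  define s3 where "s3 = s2\<lparr>imem := (imem s2)(1 := iv st' Sel 1)\<rparr>"
  have S: "0 < S" "1 < S" and W: "0 < W" "1 < W" using S_bound W_bound m_pos by linarith+
  have e0: "ival S W s1 (acomp (Get Sel (C 0))) = Some (iv st' Sel 0)" using ival_acomp[OF t(2), of "Get Sel (C 0)"] by simp
  have "imem s2 1 = m" using rep_m[OF t(2)] by (simp add: s2_def)
  then have "ival S W s2 (iaddr Sel (Const 1)) = Some (iloc Sel 1)"
    using W m_pos by (intro ival_iaddr) (simp_all add: below_def)
  moreover have "iloc Sel 1 < S" using loc_less(1)[of 1 Sel] S_bound m_pos by simp
  moreover have "imem s2 (iloc Sel 1) = iv st' Sel 1"
  proof -
    have "imem s1 (iloc Sel 1) = iv st' Sel 1" using t(2) m_pos by (simp add: rep_def)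
    moreover have "iloc Sel 1 \<noteq> 0" by (simp add: iloc_def)
    ultimately show ?thesis by (simp add: s2_def)
  qed
  ultimately have e1: "ival S W s2 (acomp (Get Sel (C 1))) = Some (iv st' Sel 1)" by (simp add: below_def)
  have "exec S W (Store (Const 0) (acomp (Get Sel (C 0)))) s1 1 s2"
    unfolding s2_def by (rule exec.Store) (use S W e0 in \<open>simp_all add: below_def\<close>)
  moreover have "exec S W (Store (Const 1) (acomp (Get Sel (C 1)))) s2 1 s3"
    unfolding s3_def by (rule exec.Store) (use S W e1 in \<open>simp_all add: below_def\<close>)
  ultimately have "exec S W program s (t + (1 + 1)) s3" unfolding program_def by (intro exec.Seq[OF t(1)] exec.Seq)
  moreover have "imem s3 (i + 2) = iv st' Inp i" if "i < 2 * m" for i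
  proof -
    have "imem s1 (iloc Inp i) = iv st' Inp i" using t(2) that by (simp add: rep_def)
    then show ?thesis by (simp add: s3_def s2_def iloc_def)
  qed
  moreover have "imem s3 0 = iv st' Sel 0" "imem s3 1 = iv st' Sel 1" by (simp_all add: s3_def s2_def)
  ultimately show ?thesis using t(3,4) by (intro exI[of _ "t + (1 + 1)"] exI[of _ s3] exI[of _ st']) simp
qed

text \<open>For \<open>n \<ge> 2\<close> the logarithm is at least 1. For \<open>n = 1\<close> it
  vanishes, and \<open>m\<close> alone has to absorb the quadratic term:
  \<open>62 + 110 \<le> 200\<close>. The other bound uses \<open>n \<le> m\<close>.\<close>

lemma linear_quadratic_bound:
  assumes "1 \<le> n" "n \<le> m" "t \<le> 60 * m + 110 * (n * n) + 2"
  shows "real t \<le> 200 * min (real n * real m) (real m + (real n)\<^sup>2 * log 2 (real n))"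
proof -
  have t: "real t \<le> 62 * real m + 110 * (real n * real n)"
  proof -
    have "t \<le> 62 * m + 110 * (n * n)" using assms by linarith
    then have "real t \<le> real (62 * m + 110 * (n * n))" by (simp only: of_nat_le_iff)
    then show ?thesis by simp
  qed
  have nm: "real m \<le> real n * real m" "real n * real n \<le> real n * real m"
    using assms by (simp_all add: mult_left_mono)
  have "real t \<le> 200 * (real n * real m)" using t nm by linarith
  moreover have "real t \<le> 200 * (real m + (real n)\<^sup>2 * log 2 (real n))"
  proof (cases "n = 1")
    case True
    then show ?thesis using t assms by simp
  next
    case False
    then have "1 \<le> log 2 (real n)" using assms(1) by (subst le_log_iff) auto
    then have "(real n)\<^sup>2 * 1 \<le> (real n)\<^sup>2 * log 2 (real n)" by (intro mult_left_mono) auto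
    then have "real n * real n \<le> (real n)\<^sup>2 * log 2 (real n)" by (simp add: power2_eq_square)
    then show ?thesis using t nm zero_le_square[of "real n"] by (simp add: distrib_left)
  qed
  ultimately show ?thesis by (simp add: min_def)
qed

theorem theorem1:
  "\<exists>(prog :: com) (C :: nat).
     \<forall>(G :: (nat, nat) multigraph) (c :: nat \<Rightarrow> real) (n :: nat) (m :: nat) (s :: state).
       tecss_instance G c \<and> n = card (verts G) \<and> m = card (edges G) \<and> encodes s G c \<longrightarrow>
       (\<exists>t s'.
          exec (C * m) ((n + m) ^ C) prog s t s' \<and>
          real t \<le> real C * min (real n * real m) (real m + (real n)\<^sup>2 * log 2 (real n)) \<and>
          tecss_feasible G (output_edges G s') \<and>
          (\<Sum>e\<in>output_edges G s'. c e) \<le> 3 * tecss_opt G c)"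
proof (rule exI[of _ program], rule exI[of _ 200], intro allI impI, elim conjE)
  fix G :: "(nat, nat) multigraph" and c :: "nat \<Rightarrow> real" and n m :: nat and s :: state
  assume inst: "tecss_instance G c" and nm: "n = card (verts G)" "m = card (edges G)" and enc: "encodes s G c"
  have V: "verts G = {..<n}" and Ed: "edges G = {..<m}" and cells: "imem s 0 = n" "imem s 1 = m"
    "\<And>a. 2 + 2 * m \<le> a \<Longrightarrow> imem s a = 0" "\<And>e. e < m \<Longrightarrow> rmem s e = c e" "\<And>a. m \<le> a \<Longrightarrow> rmem s a = 0"
    and ends: "\<And>e. e < m \<Longrightarrow> ends G e = {imem s (2 + 2 * e), imem s (3 + 2 * e)}"
    using enc nm by (auto simp: encodes_def)
  have fin: "finite_multigraph G" and tec: "two_edge_connected G" and n_le: "n \<le> m" and c: "\<And>e. e < m \<Longrightarrow> 0 \<le> c e"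
    using inst unfolding tecss_instance_def V Ed by auto
  have n1: "1 \<le> n" using tec V by (auto simp: two_edge_connected_def connected_graph_def lessThan_empty_iff Suc_le_eq)
  define E where "E h = (if h < 2 * m then imem s (2 + h) else 0)" for h
  have ends_E: "ends G e = {E (2 * e), E (2 * e + 1)}" if "e < m" for e
    using ends[OF that] that by (simp add: E_def numeral_3_eq_3)
  have E: "E h < n" if "h < 2 * m" for h
  proof -
    have "h div 2 < m" using that by simp
    then have "ends G (h div 2) \<subseteq> {..<n}" using fin V Ed by (simp add: finite_multigraph_def)
    then have "E (2 * (h div 2)) < n" "E (2 * (h div 2) + 1) < n" using ends_E[OF \<open>h div 2 < m\<close>] by auto
    then show ?thesis by (cases h rule: half_edge_cases) auto
  qed
  have conn: "connected_graph (G\<lparr>edges := F\<rparr>) \<longleftrightarrow> spans E n F" if "F \<subseteq> {..<m}" for F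
    by (rule connected_graph_iff_spans[OF V n1]) (use ends_E E that in auto)
  have tec_iff: "two_edge_connected (G\<lparr>edges := F\<rparr>) \<longleftrightarrow> spans2 E n F" if "F \<subseteq> {..<m}" for F
    using conn[OF that] conn[of "F - {_}"] that by (auto simp: two_edge_connected_def spans2_def subset_iff)
  have feas_iff: "tecss_feasible G F \<longleftrightarrow> F \<subseteq> {..<m} \<and> spans2 E n F" for F
    using tec_iff[of F] Ed by (auto simp: tecss_feasible_def)
  have "G\<lparr>edges := {..<m}\<rparr> = G" using Ed by simp
  then have sp: "spans2 E n {..<m}" using tec_iff[of "{..<m}"] tec by simp
  \<comment> \<open>The constant 200 serves as time factor, memory factor and exponent at once. As
    \<open>n + m\<close> is at least 2, already 199 of the factors exceed 100, and the last one
    exceeds \<open>m\<close>.\<close>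
  let ?W = "(n + m) ^ 200"
  have W: "100 * m \<le> ?W"
  proof -
    have "(100 :: nat) \<le> 2 ^ 199" by simp
    also have "(2 :: nat) ^ 199 \<le> (n + m) ^ 199" using n1 n_le by (intro power_mono) auto
    finally have "100 * m \<le> (n + m) ^ 199 * (n + m)" by (intro mult_mono) auto
    also have "\<dots> = (n + m) ^ Suc 199" by (simp only: power_Suc2)
    also have "\<dots> = ?W" by simp
    finally show ?thesis .
  qed
  interpret machine n m "200 * m" ?W by unfold_locales (use n1 n_le W in auto)
  define st where "st = \<lparr>iv = (\<lambda>a. if a = Inp then E else (\<lambda>_. 0)), rv = (\<lambda>a. if a = Cost then c else (\<lambda>_. 0))\<rparr>"
  have "E h < ?W" if "h < 2 * m" for h using E[OF that] W n_le by linarith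
  moreover have "0 < ?W" using n1 by simp
  ultimately have rep: "rep st s"
    unfolding rep_def st_def using cells n_le by (auto simp: iloc_def rloc_def E_def)
  have "\<forall>h<2 * m. E h < n" "\<forall>e<m. 0 \<le> c e" using E c by blast+
  moreover have init: "iv st Inp = E" "\<forall>a. a \<noteq> Inp \<longrightarrow> iv st a = (\<lambda>_. 0)" "rv st Cost = c" "\<forall>a. a \<noteq> Cost \<longrightarrow> rv st a = (\<lambda>_. 0)"
    by (simp_all add: st_def)
  define R where "R st' \<longleftrightarrow> (\<forall>e<m. 2 \<le> e \<longrightarrow> iv st' Inp (e - 2) = iv st' Sel e) \<and>
      spans2 E n {e. e < m \<and> iv st' Sel e = 1} \<and>
      (\<forall>F. F \<subseteq> {..<m} \<and> spans2 E n F \<longrightarrow> sum c {e. e < m \<and> iv st' Sel e = 1} \<le> 3 * sum c F)" for st' :: store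
  have "run main st R (60 * m + 110 * (n * n))" unfolding R_def by (rule main[OF calculation(1,2) sp init])
  from exec_program[OF this rep]
  obtain t s' st' where ex: "exec (200 * m) ?W program s t s'" and t: "t \<le> 60 * m + 110 * (n * n) + 2" and "R st'"
    and s': "imem s' 0 = iv st' Sel 0" "imem s' 1 = iv st' Sel 1" "\<forall>i<2 * m. imem s' (i + 2) = iv st' Inp i"
    by blast
  have out: "\<forall>e<m. 2 \<le> e \<longrightarrow> iv st' Inp (e - 2) = iv st' Sel e"
    and fe: "spans2 E n {e. e < m \<and> iv st' Sel e = 1}"
    and co: "\<forall>F. F \<subseteq> {..<m} \<and> spans2 E n F \<longrightarrow> sum c {e. e < m \<and> iv st' Sel e = 1} \<le> 3 * sum c F"
    using \<open>R st'\<close> unfolding R_def by simp_all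
  have "imem s' e = iv st' Sel e" if e: "e < m" for e
  proof -
    consider "e = 0" | "e = 1" | "2 \<le> e" by linarith
    then show ?thesis
    proof cases
      case 3
      have "e - 2 < 2 * m" using e by simp
      then have "imem s' (e - 2 + 2) = iv st' Inp (e - 2)" using s'(3) by blast
      moreover have "e - 2 + 2 = e" using 3 by simp
      ultimately show ?thesis using out[rule_format, OF e 3] by simp
    qed (use s' in auto)
  qed
  then have F: "output_edges G s' = {e. e < m \<and> iv st' Sel e = 1}" using Ed by (auto simp: output_edges_def)
  have feasible: "tecss_feasible G (output_edges G s')" unfolding F feas_iff using fe by auto
  \<comment> \<open>Needed for the minimum to be attained; the computed solution shows that the set
    is not empty.\<close>
  have "finite {\<Sum>e\<in>F. c e | F. tecss_feasible G F}"
  proof (rule finite_subset)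
    show "{\<Sum>e\<in>F. c e | F. tecss_feasible G F} \<subseteq> sum c ` Pow {..<m}" using feas_iff by auto
  qed simp
  then have "tecss_opt G c \<in> {\<Sum>e\<in>F. c e | F. tecss_feasible G F}"
    unfolding tecss_opt_def using feasible by (intro Min_in) auto
  then obtain F where "tecss_feasible G F" "tecss_opt G c = sum c F" by blast
  then have "sum c (output_edges G s') \<le> 3 * tecss_opt G c" unfolding F using co feas_iff by simp
  moreover have "real t \<le> real 200 * min (real n * real m) (real m + (real n)\<^sup>2 * log 2 (real n))"
    using linear_quadratic_bound[OF n1 n_le t] by simp
  ultimately show "\<exists>t s'. exec (200 * m) ?W program s t s' \<and>
      real t \<le> real 200 * min (real n * real m) (real m + (real n)\<^sup>2 * log 2 (real n)) \<and>
      tecss_feasible G (output_edges G s') \<and> (\<Sum>e\<in>output_edges G s'. c e) \<le> 3 * tecss_opt G c"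
    using ex feasible by blast
qed

end
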